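(* Let $\mathbb{K}$ be an algebraically closed field of characteristic zero and let $$T = \frac{\mathbb{K} \langle x_1, x_2, x_3, x_4 \rangle}{\langle x_1x_2-x_3^2,\ x_4^2+x_2x_1,\ x_1x_3-x_2x_4,\ x_4x_1-x_3x_2,\ x_2x_3-x_3x_1,\ x_4x_2+x_1x_4 \rangle}.$$ Grade $T$ by the semidihedral group $SD_{16}$ of order 16 by assigning $x_1,x_2,x_3,x_4$ the group degrees $b, bc, ab, abcd$ respectively. Then the identity component (invariant subalgebra) $T_e$ is the subalgebra of $T$ generated by the set $Y=\{y_1=x_1^2,\ y_2=x_2^2,\ y_3=x_3x_4,\ y_4=x_4x_3\}$. The pairs $(y_1,y_2)$, $(y_1,y_3)$, $(y_2,y_4)$ and $(y_3,y_4)$ $(-1)$-skew commute (i.e. $y_iy_j=-y_jy_i$), whereas the pairs $(y_1,y_4)$ and $(y_2,y_3)$ commute. Hence $T_e$ is a skew polynomial ring (in $y_1,\dots,y_4$) and therefore Artin-Schelter regular.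
   Context: $SD_{16}=\langle a,b,c,d \mid a^2=c^2=d,\ b^2=d^2=e,\ a^{-1}ba=bc,\ a^{-1}ca=cd,\ b^{-1}cb=cd,\ d\text{ central}\rangle$, a group of order 16 with identity $e$. The defining relations of $T$ are homogeneous for the stated $SD_{16}$-degrees, so $T=\bigoplus_{g\in SD_{16}}T_g$ is $SD_{16}$-graded, and $T_e$ denotes the component of group degree $e$. A connected graded $\mathbb{K}$-algebra $A$ is Artin-Schelter regular if: (a) it has finite global dimension $d$ on the left and right; (b) $\operatorname{Ext}^i_A({}_A\mathbb{K},{}_AA)=\operatorname{Ext}^i_A(\mathbb{K}_A,A_A)=0$ for $i\neq d$; (c) $\operatorname{Ext}^d_A({}_A\mathbb{K},{}_AA)\cong\operatorname{Ext}^d_A(\mathbb{K}_A,A_A)\cong\mathbb{K}(\mathfrak{l})$ for some integer $\mathfrak{l}$; (d) $A$ has finite Gelfand-Kirillov dimension. A skew polynomial ring in $y_1,\dots,y_n$ is the algebra $\mathbb{K}\langle y_1,\dots,y_n\rangle/\langle y_jy_i-q_{ij}y_iy_j : i<j\rangle$ with all $q_{ij}\in\mathbb{K}^{\times}$. *)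

theory Defs
  imports
    "HOL-Computational_Algebra.Polynomial"
    "HOL-Library.Poly_Mapping"
    "HOL-Library.Function_Algebras"
    "HOL-Library.Product_Plus"
    "HOL-Library.Extended_Real"
    "HOL-Library.Liminf_Limsup"
begin

section \<open>Free algebras\<close>

datatype 'x fword = FWord (letters: "'x list")

instantiation fword :: (type) monoid_add
begin

definition "0 = FWord []"
definition "u + v = FWord (letters u @ letters v)"

instance
  by standard (simp_all add: zero_fword_def plus_fword_def)

end

lemma letters_zero [simp]: "letters 0 = []"
  by (simp add: zero_fword_def)

lemma letters_plus [simp]: "letters (u + v) = letters u @ letters v"
  by (simp add: plus_fword_def)

text \<open>
  The free algebra on the letters \<^typ>\<open>'x\<close> over \<^typ>\<open>'k\<close> is the monoid algebra
  \<^typ>\<open>'x fword \<Rightarrow>\<^sub>0 'k\<close> of the free monoid; its ring structure is the convolution product of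
  \<^theory>\<open>HOL-Library.Poly_Mapping\<close>.
\<close>

definition free_var :: "'x \<Rightarrow> ('x fword \<Rightarrow>\<^sub>0 'k::ring_1)" where
  "free_var i = Poly_Mapping.single (FWord [i]) 1"

definition free_const :: "'k::ring_1 \<Rightarrow> ('x fword \<Rightarrow>\<^sub>0 'k)" where
  "free_const c = Poly_Mapping.single 0 c"

definition two_sided_ideal :: "'r::ring_1 set \<Rightarrow> bool" where
  "two_sided_ideal I \<longleftrightarrow>
     0 \<in> I \<and> (\<forall>x\<in>I. \<forall>y\<in>I. x + y \<in> I) \<and> (\<forall>x\<in>I. \<forall>a b. a * x * b \<in> I)"

lemma two_sided_ideal_hull: "two_sided_ideal (two_sided_ideal hull R)"
  by (rule hull_in) (auto simp: two_sided_ideal_def)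

lemma two_sided_ideal_uminus:
  assumes "two_sided_ideal I" "x \<in> I"
  shows "- x \<in> I"
proof -
  have "(- 1) * x * 1 \<in> I"
    using assms by (simp only: two_sided_ideal_def)
  then show ?thesis by simp
qed

lemma two_sided_ideal_mult:
  assumes "two_sided_ideal I" "x \<in> I"
  shows "a * x \<in> I" "x * a \<in> I"
proof -
  have "a * x * 1 \<in> I" "1 * x * a \<in> I"
    using assms by (simp_all only: two_sided_ideal_def)
  then show "a * x \<in> I" "x * a \<in> I" by simp_all
qed

section \<open>Graded algebras\<close>

text \<open>
  An algebra is carried by a subspace of a \<^typ>\<open>'k\<close>-vector space \<^typ>\<open>'a\<close>, whose addition is that
  of the type class.  The multiplication is a field of the record so that the opposite algebra is
  available on the same carrier: right modules are left modules over \<open>op_alg A\<close>.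
\<close>

record ('k, 'a) galg =
  carr :: "'a set"
  mul :: "'a \<Rightarrow> 'a \<Rightarrow> 'a"
  unit :: "'a"
  scl :: "'k \<Rightarrow> 'a \<Rightarrow> 'a"
  piece :: "nat \<Rightarrow> 'a set"

definition op_alg :: "('k, 'a) galg \<Rightarrow> ('k, 'a) galg" where
  "op_alg A = A\<lparr>mul := \<lambda>x y. mul A y x\<rparr>"

definition is_algebra :: "('k::field, 'a::ab_group_add) galg \<Rightarrow> bool" where
  "is_algebra A \<longleftrightarrow>
     vector_space (scl A) \<and> module.subspace (scl A) (carr A) \<and>
     unit A \<in> carr A \<and>
     (\<forall>x\<in>carr A. mul A (unit A) x = x \<and> mul A x (unit A) = x) \<and>
     (\<forall>x\<in>carr A. \<forall>y\<in>carr A. mul A x y \<in> carr A) \<and>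
     (\<forall>x\<in>carr A. \<forall>y\<in>carr A. \<forall>z\<in>carr A.
        mul A (mul A x y) z = mul A x (mul A y z) \<and>
        mul A (x + y) z = mul A x z + mul A y z \<and>
        mul A x (y + z) = mul A x y + mul A x z) \<and>
     (\<forall>c. \<forall>x\<in>carr A. \<forall>y\<in>carr A.
        mul A (scl A c x) y = scl A c (mul A x y) \<and>
        mul A x (scl A c y) = scl A c (mul A x y))"

definition is_subalgebra :: "('k::field, 'a::ab_group_add) galg \<Rightarrow> 'a set \<Rightarrow> bool" where
  "is_subalgebra A S \<longleftrightarrow>
     S \<subseteq> carr A \<and> module.subspace (scl A) S \<and> unit A \<in> S \<and> (\<forall>x\<in>S. \<forall>y\<in>S. mul A x y \<in> S)"

definition direct_sum_of :: "'a::ab_group_add set \<Rightarrow> ('i \<Rightarrow> 'a set) \<Rightarrow> bool" where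
  "direct_sum_of X V \<longleftrightarrow>
     (\<forall>i. V i \<subseteq> X \<and> 0 \<in> V i \<and> (\<forall>x\<in>V i. \<forall>y\<in>V i. x - y \<in> V i)) \<and>
     (\<forall>x\<in>X. \<exists>!f :: 'i \<Rightarrow>\<^sub>0 'a.
        (\<forall>i. Poly_Mapping.lookup f i \<in> V i) \<and>
        x = (\<Sum>i\<in>Poly_Mapping.keys f. Poly_Mapping.lookup f i))"

definition connected_graded :: "('k::field, 'a::ab_group_add) galg \<Rightarrow> bool" where
  "connected_graded A \<longleftrightarrow>
     is_algebra A \<and>
     (\<forall>n. module.subspace (scl A) (piece A n)) \<and>
     direct_sum_of (carr A) (piece A) \<and>
     (\<forall>m n. \<forall>x\<in>piece A m. \<forall>y\<in>piece A n. mul A x y \<in> piece A (m + n)) \<and>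
     piece A 0 = range (\<lambda>c. scl A c (unit A)) \<and> unit A \<noteq> 0"

text \<open>The scalar part of \<open>a\<close> modulo the augmentation ideal \<open>A\<^sub>1 \<oplus> A\<^sub>2 \<oplus> \<dots>\<close>.\<close>

definition aug :: "('k::field, 'a::ab_group_add) galg \<Rightarrow> 'a \<Rightarrow> 'k" where
  "aug A a = (THE c. a - scl A c (unit A) \<in> module.span (scl A) (\<Union>n\<in>{1..}. piece A n))"

definition alg_prod :: "('k, 'a) galg \<Rightarrow> 'a list \<Rightarrow> 'a" where
  "alg_prod A xs = foldr (mul A) xs (unit A)"

text \<open>
  \<open>GKdim A = sup\<^sub>V limsup\<^sub>n log\<^sub>n dim (K + V + V\<^sup>2 + \<dots> + V\<^sup>n)\<close> over the finite dimensional subspaces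
  \<open>V\<close> of \<open>A\<close>; here \<open>V\<close> is the span of \<open>F\<close>.
\<close>

definition GKdim :: "('k::field, 'a::ab_group_add) galg \<Rightarrow> ereal" where
  "GKdim A = (SUP F\<in>{F. finite F \<and> F \<subseteq> carr A}.
     limsup (\<lambda>n. ereal (log (real n) (real (vector_space.dim (scl A)
       (module.span (scl A) {alg_prod A xs |xs. set xs \<subseteq> F \<and> length xs \<le> n}))))))"

section \<open>Skew polynomial rings\<close>

definition free_eval ::
    "('k::field, 'a::ab_group_add) galg \<Rightarrow> ('x \<Rightarrow> 'a) \<Rightarrow> ('x fword \<Rightarrow>\<^sub>0 'k) \<Rightarrow> 'a" where
  "free_eval A y p =
     (\<Sum>w\<in>Poly_Mapping.keys p. scl A (Poly_Mapping.lookup p w) (alg_prod A (map y (letters w))))"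

definition skew_relators ::
    "('n::linorder \<Rightarrow> 'n \<Rightarrow> 'k::field) \<Rightarrow> ('n fword \<Rightarrow>\<^sub>0 'k) set" where
  "skew_relators q =
     {free_var j * free_var i - free_const (q i j) * free_var i * free_var j |i j. i < j}"

text \<open>
  \<open>A\<close> is a skew polynomial ring in the elements \<open>y\<close>: the homomorphism from the free algebra sending
  the variables to \<open>y\<close> induces an isomorphism from the quotient by the skew relators onto \<open>A\<close>.
\<close>

definition is_skew_polynomial_ring ::
    "('k::field, 'a::ab_group_add) galg \<Rightarrow> ('n::{finite,linorder} \<Rightarrow> 'a) \<Rightarrow> bool" where
  "is_skew_polynomial_ring A y \<longleftrightarrow>
     is_algebra A \<and> range y \<subseteq> carr A \<and>
     (\<exists>q. (\<forall>i j. i < j \<longrightarrow> q i j \<noteq> 0) \<and>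
          range (free_eval A y) = carr A \<and>
          {p. free_eval A y p = 0} = two_sided_ideal hull (skew_relators q))"

section \<open>Modules and projective resolutions\<close>

record ('a, 'm) lmod =
  mcarr :: "'m set"
  act :: "'a \<Rightarrow> 'm \<Rightarrow> 'm"

definition is_lmod ::
    "('k, 'a::ab_group_add) galg \<Rightarrow> ('a, 'm::ab_group_add, 'z) lmod_scheme \<Rightarrow> bool" where
  "is_lmod A M \<longleftrightarrow>
     0 \<in> mcarr M \<and> (\<forall>x\<in>mcarr M. \<forall>y\<in>mcarr M. x - y \<in> mcarr M) \<and>
     (\<forall>a\<in>carr A. \<forall>x\<in>mcarr M. act M a x \<in> mcarr M) \<and>
     (\<forall>a\<in>carr A. \<forall>x\<in>mcarr M. \<forall>y\<in>mcarr M. act M a (x + y) = act M a x + act M a y) \<and>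
     (\<forall>a\<in>carr A. \<forall>b\<in>carr A. \<forall>x\<in>mcarr M.
        act M (a + b) x = act M a x + act M b x \<and>
        act M (mul A a b) x = act M a (act M b x)) \<and>
     (\<forall>x\<in>mcarr M. act M (unit A) x = x)"

definition is_hom ::
    "('k, 'a) galg \<Rightarrow> ('a, 'm::ab_group_add, 'y) lmod_scheme
      \<Rightarrow> ('a, 'n::ab_group_add, 'z) lmod_scheme \<Rightarrow> ('m \<Rightarrow> 'n) \<Rightarrow> bool" where
  "is_hom A M N f \<longleftrightarrow>
     (\<forall>x\<in>mcarr M. f x \<in> mcarr N) \<and>
     (\<forall>x\<in>mcarr M. \<forall>y\<in>mcarr M. f (x + y) = f x + f y) \<and>
     (\<forall>a\<in>carr A. \<forall>x\<in>mcarr M. f (act M a x) = act N a (f x))"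

definition free_lmod :: "('k, 'a::ab_group_add) galg \<Rightarrow> 'i set \<Rightarrow> ('a, 'i \<Rightarrow>\<^sub>0 'a) lmod" where
  "free_lmod A I =
     \<lparr>mcarr = {f. Poly_Mapping.keys f \<subseteq> I \<and> (\<forall>i. Poly_Mapping.lookup f i \<in> carr A)},
      act = (\<lambda>a. Poly_Mapping.map (mul A a))\<rparr>"

text \<open>
  Projective means direct summand of a free module.  Basis sets \<open>I\<close> inside the type of the module
  suffice, because the elements of the module generate it.
\<close>

definition projective ::
    "('k, 'a::ab_group_add) galg \<Rightarrow> ('a, 'm::ab_group_add, 'z) lmod_scheme \<Rightarrow> bool" where
  "projective A P \<longleftrightarrow>
     is_lmod A P \<and>
     (\<exists>(I :: 'm set) \<iota> \<pi>. is_hom A P (free_lmod A I) \<iota> \<and> is_hom A (free_lmod A I) P \<pi> \<and>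
        (\<forall>x\<in>mcarr P. \<pi> (\<iota> x) = x))"

definition projective_resolution ::
    "('k, 'a::ab_group_add) galg \<Rightarrow> ('a, 'm::ab_group_add, 'y) lmod_scheme
      \<Rightarrow> (nat \<Rightarrow> ('a, 'p::ab_group_add, 'z) lmod_scheme) \<Rightarrow> (nat \<Rightarrow> 'p \<Rightarrow> 'p) \<Rightarrow> ('p \<Rightarrow> 'm)
      \<Rightarrow> bool" where
  "projective_resolution A M P \<delta> \<eta> \<longleftrightarrow>
     (\<forall>i. projective A (P i)) \<and>
     (\<forall>i. is_hom A (P (Suc i)) (P i) (\<delta> i)) \<and>
     is_hom A (P 0) M \<eta> \<and>
     \<eta> ` mcarr (P 0) = mcarr M \<and>
     {x\<in>mcarr (P 0). \<eta> x = 0} = \<delta> 0 ` mcarr (P (Suc 0)) \<and>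
     (\<forall>i. {x\<in>mcarr (P (Suc i)). \<delta> i x = 0} = \<delta> (Suc i) ` mcarr (P (Suc (Suc i))))"

text \<open>
  A type in which every module with underlying set in \<^typ>\<open>'m\<close> has a projective resolution: free
  covers and their kernels have at most as many elements as \<^typ>\<open>'m \<times> 'a \<times> nat\<close>, hence free modules
  on subsets of that type suffice in every degree.
\<close>

type_synonym ('a, 'm) res = "('m \<times> 'a \<times> nat) \<Rightarrow>\<^sub>0 'a"

definition pd_le ::
    "('k, 'a::ab_group_add) galg \<Rightarrow> ('a, 'm::ab_group_add) lmod \<Rightarrow> nat \<Rightarrow> bool" where
  "pd_le A M d \<longleftrightarrow>
     (\<exists>(P :: nat \<Rightarrow> ('a, ('a, 'm) res) lmod) \<delta> \<eta>.
        projective_resolution A M P \<delta> \<eta> \<and> (\<forall>i>d. mcarr (P i) = {0}))"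

text \<open>
  The left global dimension of \<open>A\<close> is \<open>d\<close>.  HOL cannot quantify over all types inside a definition,
  so the modules range over those carried by subgroups of \<^typ>\<open>'m \<times> 'a\<close>, with \<^typ>\<open>'m\<close> a parameter.
  Leaving \<^typ>\<open>'m\<close> arbitrary covers all modules; the factor \<^typ>\<open>'a\<close> ensures that copies of
  all cyclic modules, on which the supremum of the projective dimensions is attained, are always
  present.
\<close>

definition gldim_le ::
    "'m::ab_group_add itself \<Rightarrow> ('k, 'a::ab_group_add) galg \<Rightarrow> nat \<Rightarrow> bool" where
  "gldim_le U A d \<longleftrightarrow> (\<forall>M :: ('a, 'm \<times> 'a) lmod. is_lmod A M \<longrightarrow> pd_le A M d)"

definition has_gldim ::
    "'m::ab_group_add itself \<Rightarrow> ('k, 'a::ab_group_add) galg \<Rightarrow> nat \<Rightarrow> bool" where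
  "has_gldim U A d \<longleftrightarrow> gldim_le U A d \<and> (\<forall>d'. gldim_le U A d' \<longrightarrow> d \<le> d')"

section \<open>Graded modules and Ext\<close>

record ('a, 'm) gmod = "('a, 'm) lmod" +
  mpiece :: "int \<Rightarrow> 'm set"

definition is_gmod ::
    "('k, 'a::ab_group_add) galg \<Rightarrow> ('a, 'm::ab_group_add) gmod \<Rightarrow> bool" where
  "is_gmod A M \<longleftrightarrow>
     is_lmod A M \<and> direct_sum_of (mcarr M) (mpiece M) \<and>
     (\<forall>i j. \<forall>a\<in>piece A i. \<forall>x\<in>mpiece M j. act M a x \<in> mpiece M (int i + j))"

definition is_graded_hom ::
    "('k, 'a) galg \<Rightarrow> ('a, 'm::ab_group_add) gmod \<Rightarrow> ('a, 'n::ab_group_add) gmod \<Rightarrow> int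
      \<Rightarrow> ('m \<Rightarrow> 'n) \<Rightarrow> bool" where
  "is_graded_hom A M N n f \<longleftrightarrow>
     is_hom A M N f \<and> (\<forall>j. f ` mpiece M j \<subseteq> mpiece N (j + n))"

definition regular_gmod :: "('k, 'a::ab_group_add) galg \<Rightarrow> ('a, 'a) gmod" where
  "regular_gmod A =
     \<lparr>mcarr = carr A, act = mul A, mpiece = (\<lambda>n. if 0 \<le> n then piece A (nat n) else {0})\<rparr>"

text \<open>The shifted trivial module \<open>K(l)\<close>, with \<open>K(l)\<^sub>n = K\<^sub>n\<^sub>+\<^sub>l\<close>.\<close>

definition trivial_gmod ::
    "('k::field, 'a::ab_group_add) galg \<Rightarrow> int \<Rightarrow> ('a, 'k) gmod" where
  "trivial_gmod A l =
     \<lparr>mcarr = UNIV, act = (\<lambda>a c. aug A a * c),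
      mpiece = (\<lambda>n. if n + l = 0 then UNIV else {0})\<rparr>"

definition graded_projective_resolution ::
    "('k, 'a::ab_group_add) galg \<Rightarrow> ('a, 'm::ab_group_add) gmod
      \<Rightarrow> (nat \<Rightarrow> ('a, 'p::ab_group_add) gmod) \<Rightarrow> (nat \<Rightarrow> 'p \<Rightarrow> 'p) \<Rightarrow> ('p \<Rightarrow> 'm) \<Rightarrow> bool" where
  "graded_projective_resolution A M P \<delta> \<eta> \<longleftrightarrow>
     projective_resolution A M P \<delta> \<eta> \<and>
     (\<forall>i. is_gmod A (P i)) \<and>
     (\<forall>i. is_graded_hom A (P (Suc i)) (P i) 0 (\<delta> i)) \<and>
     is_graded_hom A (P 0) M 0 \<eta>"

text \<open>
  The graded dual \<open>Hom\<^sub>A(P, A) = \<Oplus>\<^sub>n Hom\<^sub>A(P, A)\<^sub>n\<close>, a left \<open>op_alg A\<close>-module through the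
  multiplication of \<open>A\<close> on the other side.  Homomorphisms are normalised to \<open>0\<close> outside the carrier.
\<close>

definition dual_piece ::
    "('k, 'a::ab_group_add) galg \<Rightarrow> ('a, 'p::ab_group_add) gmod \<Rightarrow> int \<Rightarrow> ('p \<Rightarrow> 'a) set" where
  "dual_piece A P n =
     {f. is_graded_hom A P (regular_gmod A) n f \<and> (\<forall>x. x \<notin> mcarr P \<longrightarrow> f x = 0)}"

definition dual_gmod ::
    "('k, 'a::ab_group_add) galg \<Rightarrow> ('a, 'p::ab_group_add) gmod \<Rightarrow> ('a, 'p \<Rightarrow> 'a) gmod" where
  "dual_gmod A P =
     \<lparr>mcarr = {\<Sum>n\<in>N. h n |N h. finite N \<and> (\<forall>n\<in>N. h n \<in> dual_piece A P n)},
      act = (\<lambda>a f x. mul A (f x) a),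
      mpiece = dual_piece A P\<rparr>"

definition cocycles ::
    "('k, 'a::ab_group_add) galg \<Rightarrow> (nat \<Rightarrow> ('a, 'p::ab_group_add) gmod) \<Rightarrow> (nat \<Rightarrow> 'p \<Rightarrow> 'p)
      \<Rightarrow> nat \<Rightarrow> ('p \<Rightarrow> 'a) set" where
  "cocycles A P \<delta> i =
     {f\<in>mcarr (dual_gmod A (P i)). \<forall>x\<in>mcarr (P (Suc i)). f (\<delta> i x) = 0}"

primrec coboundaries ::
    "('k, 'a::ab_group_add) galg \<Rightarrow> (nat \<Rightarrow> ('a, 'p::ab_group_add) gmod) \<Rightarrow> (nat \<Rightarrow> 'p \<Rightarrow> 'p)
      \<Rightarrow> nat \<Rightarrow> ('p \<Rightarrow> 'a) set" where
  "coboundaries A P \<delta> 0 = {0}"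
| "coboundaries A P \<delta> (Suc i) =
     {f\<in>mcarr (dual_gmod A (P (Suc i))).
        \<exists>g\<in>mcarr (dual_gmod A (P i)). \<forall>x\<in>mcarr (P (Suc i)). f x = g (\<delta> i x)}"

text \<open>
  \<open>Ext\<^sup>i(M, A)\<close>, computed from the graded projective resolution \<open>P\<close> of \<open>M\<close>, is the quotient of
  cocycles by coboundaries.  It is isomorphic to \<open>N\<close> as a graded \<open>op_alg A\<close>-module iff there is a
  surjective homomorphism of degree \<open>0\<close> from the cocycles to \<open>N\<close> with kernel the coboundaries.
\<close>

definition ext_vanishes ::
    "('k, 'a::ab_group_add) galg \<Rightarrow> (nat \<Rightarrow> ('a, 'p::ab_group_add) gmod) \<Rightarrow> (nat \<Rightarrow> 'p \<Rightarrow> 'p)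
      \<Rightarrow> nat \<Rightarrow> bool" where
  "ext_vanishes A P \<delta> i \<longleftrightarrow> cocycles A P \<delta> i = coboundaries A P \<delta> i"

definition ext_iso ::
    "('k, 'a::ab_group_add) galg \<Rightarrow> (nat \<Rightarrow> ('a, 'p::ab_group_add) gmod) \<Rightarrow> (nat \<Rightarrow> 'p \<Rightarrow> 'p)
      \<Rightarrow> nat \<Rightarrow> ('a, 'n::ab_group_add) gmod \<Rightarrow> bool" where
  "ext_iso A P \<delta> i N \<longleftrightarrow>
     (let Z = (dual_gmod A (P i))
            \<lparr>mcarr := cocycles A P \<delta> i,
             mpiece := \<lambda>n. cocycles A P \<delta> i \<inter> dual_piece A (P i) n\<rparr>
      in \<exists>\<phi>. is_graded_hom (op_alg A) Z N 0 \<phi> \<and> \<phi> ` mcarr Z = mcarr N \<and>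
             {f\<in>mcarr Z. \<phi> f = 0} = coboundaries A P \<delta> i)"

section \<open>Artin-Schelter regular algebras\<close>

text \<open>
  The conditions on \<open>Ext\<^sub>A(K, A)\<close> for left modules, with Ext computed from some graded projective
  resolution of the trivial module; up to isomorphism Ext does not depend on the resolution.
\<close>

definition AS_Gorenstein ::
    "('k::field, 'a::ab_group_add) galg \<Rightarrow> nat \<Rightarrow> int \<Rightarrow> bool" where
  "AS_Gorenstein A d l \<longleftrightarrow>
     (\<exists>(P :: nat \<Rightarrow> ('a, ('a, 'k) res) gmod) \<delta> \<eta>.
        graded_projective_resolution A (trivial_gmod A 0) P \<delta> \<eta> \<and>
        (\<forall>i. i \<noteq> d \<longrightarrow> ext_vanishes A P \<delta> i) \<and>
        ext_iso A P \<delta> d (trivial_gmod (op_alg A) l))"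

definition AS_regular ::
    "'m::ab_group_add itself \<Rightarrow> ('k::field, 'a::ab_group_add) galg \<Rightarrow> bool" where
  "AS_regular U A \<longleftrightarrow>
     connected_graded A \<and> GKdim A < \<infinity> \<and>
     (\<exists>d l. has_gldim U A d \<and> has_gldim U (op_alg A) d \<and>
            AS_Gorenstein A d l \<and> AS_Gorenstein (op_alg A) d l)"

section \<open>The semidihedral group of order 16\<close>

text \<open>
  Words in the generators and their formal inverses; \<open>(g, True)\<close> stands for \<open>g\<close> and \<open>(g, False)\<close>
  for its inverse.  The relation below is the congruence whose quotient is the group
  presented by \<open>R\<close>.
\<close>

inductive presented_eq ::
    "(('g \<times> bool) list \<times> ('g \<times> bool) list) set \<Rightarrow> ('g \<times> bool) list \<Rightarrow> ('g \<times> bool) list \<Rightarrow> bool"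
  for R where
  refl: "presented_eq R u u"
| sym: "presented_eq R u v \<Longrightarrow> presented_eq R v u"
| trans: "presented_eq R u v \<Longrightarrow> presented_eq R v w \<Longrightarrow> presented_eq R u w"
| cancel: "presented_eq R [(g, s), (g, \<not> s)] []"
| relation: "(u, v) \<in> R \<Longrightarrow> presented_eq R u v"
| append: "presented_eq R u u' \<Longrightarrow> presented_eq R v v' \<Longrightarrow> presented_eq R (u @ v) (u' @ v')"

datatype sd_gen = Ga | Gb | Gc | Gd

definition sd_relations :: "((sd_gen \<times> bool) list \<times> (sd_gen \<times> bool) list) set" where
  "sd_relations =
     (let a = (Ga, True); b = (Gb, True); c = (Gc, True); d = (Gd, True);
          a' = (Ga, False); b' = (Gb, False)
      in {([a, a], [d]), ([c, c], [d]), ([b, b], []), ([d, d], []),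
          ([a', b, a], [b, c]), ([a', c, a], [c, d]), ([b', c, b], [c, d]),
          ([a, d], [d, a]), ([b, d], [d, b]), ([c, d], [d, c])})"

quotient_type sd16 = "(sd_gen \<times> bool) list" / "presented_eq sd_relations"
  by (rule equivpI; rule reflpI sympI transpI)
    (blast intro: presented_eq.refl presented_eq.sym presented_eq.trans)+

instantiation sd16 :: monoid_mult
begin

lift_definition one_sd16 :: sd16 is "[]" .

lift_definition times_sd16 :: "sd16 \<Rightarrow> sd16 \<Rightarrow> sd16" is "(@)"
  by (rule presented_eq.append)

instance
  by standard (transfer, simp add: presented_eq.refl)+

end

lift_definition sd :: "sd_gen \<Rightarrow> sd16" is "\<lambda>g. [(g, True)]" .

section \<open>The algebra T and its identity component\<close>

datatype idx = I1 | I2 | I3 | I4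

instantiation idx :: "{finite, linorder}"
begin

primrec idx_pos :: "idx \<Rightarrow> nat" where
  "idx_pos I1 = 1" | "idx_pos I2 = 2" | "idx_pos I3 = 3" | "idx_pos I4 = 4"

definition "i \<le> j \<longleftrightarrow> idx_pos i \<le> idx_pos j"
definition "i < j \<longleftrightarrow> idx_pos i < idx_pos j"

instance
proof
  have "(UNIV :: idx set) = {I1, I2, I3, I4}"
    using idx.exhaust by blast
  then show "finite (UNIV :: idx set)"
    by (metis finite.emptyI finite.insertI)
next
  fix x y :: idx
  assume "x \<le> y" "y \<le> x"
  then show "x = y"
    by (cases x; cases y) (simp_all add: less_eq_idx_def)
qed (auto simp: less_eq_idx_def less_idx_def)

end

definition T_relators :: "(idx fword \<Rightarrow>\<^sub>0 'k::field) set" where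
  "T_relators =
     (let x1 = free_var I1; x2 = free_var I2; x3 = free_var I3; x4 = free_var I4
      in {x1 * x2 - x3 * x3, x4 * x4 + x2 * x1, x1 * x3 - x2 * x4,
          x4 * x1 - x3 * x2, x2 * x3 - x3 * x1, x4 * x2 + x1 * x4})"

definition T_eq :: "(idx fword \<Rightarrow>\<^sub>0 'k::field) \<Rightarrow> (idx fword \<Rightarrow>\<^sub>0 'k) \<Rightarrow> bool" where
  "T_eq p q \<longleftrightarrow> p - q \<in> two_sided_ideal hull T_relators"

lemma T_ideal_add:
  "p \<in> two_sided_ideal hull T_relators \<Longrightarrow> q \<in> two_sided_ideal hull T_relators \<Longrightarrow>
   p + q \<in> two_sided_ideal hull T_relators"
  using two_sided_ideal_hull[of T_relators] unfolding two_sided_ideal_def by blast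

lemma T_eq_refl: "T_eq p (p :: idx fword \<Rightarrow>\<^sub>0 'a::field)"
proof -
  have "two_sided_ideal (two_sided_ideal hull (T_relators :: (idx fword \<Rightarrow>\<^sub>0 'a) set))"
    by (rule two_sided_ideal_hull)
  then have "0 \<in> two_sided_ideal hull (T_relators :: (idx fword \<Rightarrow>\<^sub>0 'a) set)"
    unfolding two_sided_ideal_def[of "two_sided_ideal hull _"] by (rule conjunct1)
  then show ?thesis by (simp add: T_eq_def)
qed

quotient_type (overloaded) 'k T = "idx fword \<Rightarrow>\<^sub>0 'k::field" / T_eq
proof (rule equivpI; rule reflpI sympI transpI)
  fix p q r :: "idx fword \<Rightarrow>\<^sub>0 'k"
  show "T_eq p p" by (rule T_eq_refl)
  show "T_eq q p" if "T_eq p q"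
    using two_sided_ideal_uminus[OF two_sided_ideal_hull] that unfolding T_eq_def by fastforce
  show "T_eq p r" if "T_eq p q" "T_eq q r"
    using T_ideal_add that unfolding T_eq_def by fastforce
qed

lemma lookup_mult_zero:
  fixes p q :: "'x fword \<Rightarrow>\<^sub>0 'k::field"
  shows "Poly_Mapping.lookup (p * q) 0 = Poly_Mapping.lookup p 0 * Poly_Mapping.lookup q 0"
proof -
  have split: "0 = u + v \<longleftrightarrow> u = 0 \<and> v = 0" for u v :: "'x fword"
    by (cases u; cases v) (auto simp: zero_fword_def plus_fword_def)
  have "(\<Sum>v. Poly_Mapping.lookup q v when 0 = u + v) = (Poly_Mapping.lookup q 0 when u = 0)"
    for u :: "'x fword"
    by (cases "u = 0") (simp_all add: split)
  then show ?thesis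
    by (simp add: lookup_mult mult_when)
qed

lemma one_notin_T_ideal: "1 \<notin> two_sided_ideal hull (T_relators :: (idx fword \<Rightarrow>\<^sub>0 'k::field) set)"
proof -
  let ?I = "{p :: idx fword \<Rightarrow>\<^sub>0 'k. Poly_Mapping.lookup p 0 = 0}"
  have "Poly_Mapping.lookup (free_var i :: idx fword \<Rightarrow>\<^sub>0 'k) 0 = 0" for i
    by (simp add: free_var_def lookup_single zero_fword_def)
  then have "T_relators \<subseteq> ?I"
    by (auto simp: T_relators_def Let_def lookup_minus lookup_add lookup_mult_zero)
  moreover have "two_sided_ideal ?I"
    by (simp add: two_sided_ideal_def lookup_add lookup_mult_zero)
  ultimately have "two_sided_ideal hull T_relators \<subseteq> ?I"
    by (rule hull_minimal)
  then show ?thesis by auto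
qed

instantiation T :: (field) ring_1
begin

lift_definition zero_T :: "'a T" is 0 .
lift_definition one_T :: "'a T" is 1 .

lift_definition plus_T :: "'a T \<Rightarrow> 'a T \<Rightarrow> 'a T" is "(+)"
  unfolding T_eq_def by (drule (1) T_ideal_add) (simp add: algebra_simps)

lift_definition uminus_T :: "'a T \<Rightarrow> 'a T" is uminus
  unfolding T_eq_def
  by (drule two_sided_ideal_uminus[OF two_sided_ideal_hull]) (simp add: algebra_simps)

lift_definition minus_T :: "'a T \<Rightarrow> 'a T \<Rightarrow> 'a T" is minus
  unfolding T_eq_def
  by (drule (1) T_ideal_add[OF _ two_sided_ideal_uminus[OF two_sided_ideal_hull]])
    (simp add: algebra_simps)

lift_definition times_T :: "'a T \<Rightarrow> 'a T \<Rightarrow> 'a T" is times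
proof -
  fix p p' q q' :: "idx fword \<Rightarrow>\<^sub>0 'a"
  assume "T_eq p p'" "T_eq q q'"
  then have "(p - p') * q + p' * (q - q') \<in> two_sided_ideal hull T_relators"
    unfolding T_eq_def by (intro T_ideal_add two_sided_ideal_mult[OF two_sided_ideal_hull])
  then show "T_eq (p * q) (p' * q')"
    by (simp add: T_eq_def algebra_simps)
qed

instance
proof
  show "0 \<noteq> (1 :: 'a T)"
    by transfer
      (use two_sided_ideal_uminus[OF two_sided_ideal_hull] one_notin_T_ideal in
        \<open>fastforce simp: T_eq_def\<close>)
qed (transfer; simp add: T_eq_refl algebra_simps)+

end

lift_definition scale_T :: "'k::field \<Rightarrow> 'k T \<Rightarrow> 'k T" is "\<lambda>c p. free_const c * p"
  unfolding T_eq_def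
  by (drule two_sided_ideal_mult(1)[OF two_sided_ideal_hull]) (simp add: algebra_simps)

lift_definition xT :: "idx \<Rightarrow> 'k::field T" is free_var .

primrec x_deg :: "idx \<Rightarrow> sd16" where
  "x_deg I1 = sd Gb"
| "x_deg I2 = sd Gb * sd Gc"
| "x_deg I3 = sd Ga * sd Gb"
| "x_deg I4 = sd Ga * sd Gb * sd Gc * sd Gd"

definition T_component :: "sd16 \<Rightarrow> 'k::field T set" where
  "T_component g =
     abs_T ` {p. \<forall>w\<in>Poly_Mapping.keys p. prod_list (map x_deg (letters w)) = g}"

definition T_piece :: "nat \<Rightarrow> 'k::field T set" where
  "T_piece n = abs_T ` {p. \<forall>w\<in>Poly_Mapping.keys p. length (letters w) = n}"

definition T_alg :: "('k::field, 'k T) galg" where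
  "T_alg = \<lparr>carr = UNIV, mul = (*), unit = 1, scl = scale_T, piece = T_piece\<rparr>"

text \<open>
  The identity component as a graded algebra, with the grading by word length inherited from the
  free algebra.
\<close>

definition T_e :: "('k::field, 'k T) galg" where
  "T_e = T_alg\<lparr>carr := T_component 1, piece := \<lambda>n. T_component 1 \<inter> T_piece n\<rparr>"

end

theory Submission
  imports Defs "HOL-Library.FuncSet"
begin

text \<open>
  For each \<open>g\<close> the component \<open>T\<^sub>g\<close> is \<open>m\<^sub>g T\<^sub>e\<close> for a word \<open>m\<^sub>g\<close>, and \<open>x\<^sub>i m\<^sub>g\<close> is up to sign \<open>m\<^sub>g\<^sub>'\<close> or
  \<open>m\<^sub>g\<^sub>' y\<^sub>j\<close>.  Hence every word of degree \<open>e\<close> is up to sign a monomial in the \<open>y\<^sub>j\<close>; and the same formulas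
  define an action of \<open>T\<close> on the space with basis \<open>m\<^sub>g y\<^sup>\<beta>\<close>, which shows that these monomials are
  linearly independent.

  Regularity is a property of every \<open>(\<plusminus> 1)\<close>-skew polynomial algebra \<open>A\<close>.  A module \<open>M\<close> has the
  Koszul resolution \<open>A \<otimes> \<Lambda> \<otimes> M\<close> of length 4, with the differential
  \<open>a \<otimes> \<omega> \<otimes> x \<mapsto> \<Sum>\<^sub>j \<plusminus> a y\<^sub>j \<otimes> \<iota>\<^sub>j \<omega> \<otimes> x \<plusminus> a \<otimes> \<iota>\<^sub>j \<omega> \<otimes> y\<^sub>j x\<close>, so the global dimension is at most 4.
  It is not smaller since \<open>Tor\<^sub>4(K, K) \<noteq> 0\<close>, and the dual of the resolution of \<open>K\<close> is again a Koszul
  complex, of the opposite algebra.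
\<close>

text \<open>The complex \<open>A \<otimes> \<Lambda> \<otimes> M\<close> is the Koszul bimodule
  resolution of \<open>A\<close>, tensored over \<open>A\<close> with \<open>M\<close>. It is needed
  for every \<open>M\<close>, not only for \<open>K\<close>, because the global dimension ranges
  over arbitrary ungraded modules; so exactness cannot use a grading of \<open>M\<close>. Instead
  the factor \<open>A\<close> is filtered by degree: right multiplication by a variable raises the
  filtration, the action on \<open>M\<close> leaves it alone, and the leading part of the
  differential is contracted by a homotopy that trades the first variable of a monomial for an
  exterior generator.

  The lower bound must refute any projective resolution of \<open>K\<close> that is too short.
  Rather than comparing resolutions, vanishing of Koszul homology is shifted along the kernels of
  the given resolution until it contradicts \<open>Tor\<^sub>4(K, K) \<noteq> 0\<close>.

  All structure constants are signs, hence Booleans with \<open>\<noteq>\<close> as product. In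
  \<open>T\<close> this turns the action on signed basis elements into a finite automaton with
  counters: the relations are checked for 16 values of \<open>g\<close>, since signs depend on
  \<open>\<beta>\<close> only through parities.\<close>

abbreviation "lookup \<equiv> Poly_Mapping.lookup"
abbreviation "keys \<equiv> Poly_Mapping.keys"
abbreviation "single \<equiv> Poly_Mapping.single"

section \<open>Signed Koszul complexes\<close>

definition sg :: "bool \<Rightarrow> 'a::ab_group_add \<Rightarrow> 'a" where
  "sg b x = (if b then - x else x)"

lemma sg_simps [simp]:
  "sg False x = x" "sg b 0 = 0" "sg b (sg c x) = sg (b \<noteq> c) x"
  "sg b (- x) = - sg b x"
  by (auto simp: sg_def)

lemma sg_add: "sg b (x + y) = sg b x + sg b y"
  and sg_diff: "sg b (x - y) = sg b x - sg b y"
  and sg_not: "sg (\<not> b) x = - sg b x"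
  by (auto simp: sg_def)

lemma sg_sum: "sg b (sum f S) = (\<Sum>i\<in>S. sg b (f i))"
  by (simp add: sg_def sum_negf)

lemma sg_eq_0_iff [simp]: "sg b x = 0 \<longleftrightarrow> x = 0"
  by (simp add: sg_def)

lemma UNIV_idx: "(UNIV :: idx set) = {I1, I2, I3, I4}"
  using idx.exhaust by blast

lemma sum_idx: "(\<Sum>i\<in>UNIV. f i) = f I1 + f I2 + f I3 + (f I4 :: 'b::ab_group_add)"
  by (simp add: UNIV_idx add.assoc)

lemma card_idx_le: "card (L :: idx set) \<le> 4"
proof -
  have "card (UNIV :: idx set) = 4" by (simp add: UNIV_idx)
  then show ?thesis using card_mono[of UNIV L] by simp
qed

text \<open>Carriers of algebras and modules are mere subsets of their types, so closure and
  additivity are assumed on \<open>W\<close> only.\<close>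

locale additive_group =
  fixes W :: "'w::ab_group_add set"
  assumes zero_W: "0 \<in> W" and diff_W: "x \<in> W \<Longrightarrow> y \<in> W \<Longrightarrow> x - y \<in> W"
begin

lemma uminus_W: "x \<in> W \<Longrightarrow> - x \<in> W"
  using diff_W[of 0 x] zero_W by simp

lemma add_W: "x \<in> W \<Longrightarrow> y \<in> W \<Longrightarrow> x + y \<in> W"
  using diff_W[of x "- y"] uminus_W by simp

lemma sg_W: "x \<in> W \<Longrightarrow> sg b x \<in> W"
  by (simp add: sg_def uminus_W)

lemma sum_W: "(\<And>i. i \<in> S \<Longrightarrow> f i \<in> W) \<Longrightarrow> sum f S \<in> W"
  by (induction S rule: infinite_finite_induct) (auto intro: zero_W add_W)

end

locale additive_op = additive_group W for W :: "'w::ab_group_add set" +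
  fixes f :: "'w \<Rightarrow> 'w"
  assumes op_W: "x \<in> W \<Longrightarrow> f x \<in> W"
    and op_add: "x \<in> W \<Longrightarrow> y \<in> W \<Longrightarrow> f (x + y) = f x + f y"
begin

lemma op_zero: "f 0 = 0"
  using op_add[of 0 0] zero_W by simp

lemma op_uminus: "x \<in> W \<Longrightarrow> f (- x) = - f x"
  using op_add[of x "- x"] uminus_W op_zero by (simp add: eq_neg_iff_add_eq_0 add.commute)

lemma op_sg: "x \<in> W \<Longrightarrow> f (sg b x) = sg b (f x)"
  by (simp add: sg_def op_uminus)

lemma op_diff: "x \<in> W \<Longrightarrow> y \<in> W \<Longrightarrow> f (x - y) = f x - f y"
  using op_add[of x "- y"] uminus_W op_uminus by simp

lemma op_sum: "(\<And>i. i \<in> S \<Longrightarrow> g i \<in> W) \<Longrightarrow> f (sum g S) = (\<Sum>i\<in>S. f (g i))"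
  by (induction S rule: infinite_finite_induct)
    (auto simp: op_zero op_add add_W sum_W)

end

section \<open>The one-sided Koszul complex and its contracting homotopy\<close>

text \<open>The sign rule under which the terms for \<open>(j, k)\<close> and \<open>(k, j)\<close>
  in the square of the differential cancel when \<open>R j\<close> and \<open>R k\<close> commute up
  to the sign \<open>eps j k\<close>. The equality on the right is a negated
  \<open>\<noteq>\<close>; it supplies the extra minus sign.\<close>

definition koszul_sign :: "(idx \<Rightarrow> idx \<Rightarrow> bool) \<Rightarrow> (idx \<Rightarrow> idx set \<Rightarrow> bool) \<Rightarrow> bool" where
  "koszul_sign eps kap \<longleftrightarrow> (\<forall>L j k. j \<notin> L \<and> k \<notin> L \<and> j \<noteq> k \<longrightarrow>
     (((kap j L \<noteq> kap k (insert j L)) \<noteq> eps j k) \<longleftrightarrow> (kap k L = kap j (insert k L))))"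

text \<open>A family \<open>F\<close> holds the coefficients of a chain at all exterior monomials at
  once; the homological degree is \<open>card L\<close>. Contraction with the \<open>j\<close>-th
  generator moves the coefficient of \<open>insert j L\<close> to \<open>L\<close>.\<close>

definition koszul_d ::
    "(idx \<Rightarrow> idx set \<Rightarrow> bool) \<Rightarrow> (idx \<Rightarrow> 'w \<Rightarrow> 'w) \<Rightarrow> (idx set \<Rightarrow> 'w) \<Rightarrow> idx set \<Rightarrow> 'w::ab_group_add" where
  "koszul_d kap R F L = (\<Sum>j\<in>- L. sg (kap j L) (R j (F (insert j L))))"

text \<open>Trades the first variable of a monomial for the exterior generator of the same index,
  provided that it precedes all generators already present: \<open>Min L\<close> is the new
  generator, and \<open>del (Min L)\<close> kills the monomials that begin otherwise.\<close>

definition koszul_h ::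
    "(idx \<Rightarrow> idx set \<Rightarrow> bool) \<Rightarrow> (idx \<Rightarrow> 'w \<Rightarrow> 'w) \<Rightarrow> (idx set \<Rightarrow> 'w) \<Rightarrow> idx set \<Rightarrow> 'w::ab_group_add" where
  "koszul_h kap del F L =
     (if L = {} then 0 else sg (kap (Min L) (L - {Min L})) (del (Min L) (F (L - {Min L}))))"

lemma sum_less_idx:
  fixes E :: "nat \<Rightarrow> 'b::ab_group_add"
  shows "(\<Sum>j | j < s. E (idx_pos j) - E (Suc (idx_pos j))) = E 1 - E (idx_pos s)"
proof -
  have *: "{j. j < I1} = {}" "{j. j < I2} = {I1}" "{j. j < I3} = {I1, I2}" "{j. j < I4} = {I1, I2, I3}"
    by (rule set_eqI, rename_tac j, case_tac j; simp add: less_idx_def)+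
  have "E (Suc (Suc 0)) = E 2" by (simp add: numeral_2_eq_2)
  then show ?thesis by (cases s) (simp_all add: *)
qed

lemma sum_all_idx:
  fixes E :: "nat \<Rightarrow> 'b::ab_group_add"
  shows "(\<Sum>j\<in>UNIV. E (idx_pos j) - E (Suc (idx_pos j))) = E 1 - E 5"
proof -
  have n: "Suc 1 = 2" "Suc 2 = 3" "Suc 3 = 4" "Suc 4 = 5" by simp_all
  show ?thesis by (simp only: sum_idx idx_pos.simps n) simp
qed

text \<open>
  In the model, \<open>W\<close> has a basis of monomials and \<open>R j\<close> multiplies by the \<open>j\<close>-th variable; \<open>del s\<close>
  divides by the \<open>s\<close>-th variable those monomials in which it is the first variable to occur and
  kills the others; \<open>E n\<close> projects to the monomials in which none of the variables before the
  \<open>n\<close>-th occurs.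
\<close>

locale koszul =
  fixes W :: "'w::ab_group_add set"
    and R del :: "idx \<Rightarrow> 'w \<Rightarrow> 'w" and E :: "nat \<Rightarrow> 'w \<Rightarrow> 'w"
    and eps :: "idx \<Rightarrow> idx \<Rightarrow> bool"
  assumes R_op: "\<And>j. additive_op W (R j)"
    and del_op: "\<And>j. additive_op W (del j)"
    and del_R_less: "j < s \<Longrightarrow> w \<in> W \<Longrightarrow> del s (R j w) = 0"
    and del_R_greater: "s < j \<Longrightarrow> w \<in> W \<Longrightarrow> del s (R j w) = sg (eps s j) (R j (del s w))"
    and R_del: "w \<in> W \<Longrightarrow> R s (del s w) = E (idx_pos s) w - E (Suc (idx_pos s)) w"
    and del_R: "w \<in> W \<Longrightarrow> del s (R s w) = E (idx_pos s) w"
    and E_1: "w \<in> W \<Longrightarrow> E 1 w = w"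
    and eps_commute: "eps i j = eps j i"
begin

sublocale additive_group W
  using R_op[of I1] by (simp add: additive_op_def)

lemma koszul_h_W: "(\<And>L. F L \<in> W) \<Longrightarrow> koszul_h kap del F L \<in> W"
  unfolding koszul_h_def
  by (auto intro!: zero_W sg_W additive_op.op_W[OF del_op])

text \<open>Let \<open>m\<close> be the least element of \<open>L\<close>. In the first composite
  the indices \<open>j < m\<close> telescope to \<open>F L - E (idx_pos m) (F L)\<close>; in the
  second the index \<open>j = m\<close> returns the missing term, and the indices
  \<open>j > m\<close> cancel between the two by the sign rule. For \<open>L = {}\<close> the sum
  telescopes all the way to \<open>E 5\<close>, the part free of variables.\<close>

lemma koszul_homotopy:
  assumes kap: "koszul_sign eps kap" and F: "\<And>L. F L \<in> W"
  shows "koszul_d kap R (koszul_h kap del F) L + koszul_h kap del (koszul_d kap R F) L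
    = F L - (if L = {} then E 5 (F {}) else 0)"
proof (cases "L = {}")
  case True
  have *: "Min {j} = j" for j :: idx by simp
  have "koszul_d kap R (koszul_h kap del F) L = (\<Sum>j\<in>UNIV. R j (del j (F {})))"
    unfolding koszul_d_def koszul_h_def True using F
    by (intro sum.cong)
      (simp_all add: additive_op.op_sg[OF R_op] additive_op.op_W[OF del_op])
  also have "\<dots> = (\<Sum>j\<in>UNIV. E (idx_pos j) (F {}) - E (Suc (idx_pos j)) (F {}))"
    using F by (simp add: R_del)
  also have "\<dots> = F {} - E 5 (F {})"
    by (subst sum_all_idx[where E = "\<lambda>n. E n (F {})"]) (use F E_1 in simp)
  finally show ?thesis by (simp add: True koszul_h_def)
next
  case False
  define m where "m = Min L"
  have m: "m \<in> L" "\<And>k. k \<in> L \<Longrightarrow> m \<le> k"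
    using False unfolding m_def by (auto intro: Min_in Min_le)
  define L' where "L' = L - {m}"
  have L': "m \<notin> L'" "L = insert m L'"
    using m(1) unfolding L'_def by auto
  note delW = additive_op.op_W[OF del_op F]
  have below: "- L = {j. j < m} \<union> {j. m < j \<and> j \<notin> L}" "{j. j < m} \<inter> {j. m < j \<and> j \<notin> L} = {}"
  proof -
    have "j \<notin> L" if "j < m" for j using m(2)[of j] that by auto
    moreover have "m < j" if "j \<notin> L" "\<not> j < m" for j
      using m(1) that by (metis not_less_iff_gr_or_eq)
    ultimately show "- L = {j. j < m} \<union> {j. m < j \<and> j \<notin> L}" using m(1) by blast
    show "{j. j < m} \<inter> {j. m < j \<and> j \<notin> L} = {}" using less_asym by blast
  qed
  have cL': "- L' = insert m (- L)" using L' by auto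
  let ?h = "koszul_h kap del F"
  have h_less: "sg (kap j L) (R j (?h (insert j L))) = E (idx_pos j) (F L) - E (Suc (idx_pos j)) (F L)"
    if "j < m" for j
  proof -
    have "Min (insert j L) = j" using that False m_def by simp
    moreover have "insert j L - {j} = L" using that m(2) by force
    ultimately have "?h (insert j L) = sg (kap j L) (del j (F L))"
      by (simp add: koszul_h_def)
    then show ?thesis
      using F delW by (simp add: additive_op.op_sg[OF R_op] R_del)
  qed
  have h_greater: "sg (kap j L) (R j (?h (insert j L)))
      = sg (kap j L \<noteq> kap m (insert j L')) (R j (del m (F (insert j L'))))"
    if "m < j" "j \<notin> L" for j
  proof -
    have "Min (insert j L) = m" using that False by (simp add: m_def[symmetric] min_def not_le[symmetric])
    moreover have "insert j L - {m} = insert j L'" using that L' by auto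
    ultimately have "?h (insert j L) = sg (kap m (insert j L')) (del m (F (insert j L')))"
      by (simp add: koszul_h_def)
    then show ?thesis
      using F delW by (simp add: additive_op.op_sg[OF R_op])
  qed
  have "koszul_d kap R ?h L = (\<Sum>j | j < m. E (idx_pos j) (F L) - E (Suc (idx_pos j)) (F L))
      + (\<Sum>j | m < j \<and> j \<notin> L. sg (kap j L \<noteq> kap m (insert j L')) (R j (del m (F (insert j L')))))"
    unfolding koszul_d_def below(1)
    by (subst sum.union_disjoint[OF _ _ below(2)]) (simp_all add: h_less h_greater)
  also have "(\<Sum>j | j < m. E (idx_pos j) (F L) - E (Suc (idx_pos j)) (F L)) = F L - E (idx_pos m) (F L)"
    by (subst sum_less_idx[where E = "\<lambda>n. E n (F L)"]) (use F E_1 in simp)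
  finally have d: "koszul_d kap R ?h L = F L - E (idx_pos m) (F L)
      + (\<Sum>j | m < j \<and> j \<notin> L. sg (kap j L \<noteq> kap m (insert j L')) (R j (del m (F (insert j L')))))" .
  \<comment> \<open>Division by the variable \<open>m\<close> undoes multiplication by it, kills
    multiples of earlier variables, and passes later variables at the cost of
    \<open>eps\<close>.\<close>
  have del_term: "sg (kap m L') (del m (sg (kap j L') (R j (F (insert j L')))))
      = (if j = m then E (idx_pos m) (F L) else if j < m then 0
         else - sg (kap j L \<noteq> kap m (insert j L')) (R j (del m (F (insert j L')))))"
    if "j \<notin> L'" for j
  proof -
    have RW: "R i (F K) \<in> W" for i K by (rule additive_op.op_W[OF R_op F])
    consider "j = m" | "j < m" | "m < j" by (meson not_less_iff_gr_or_eq)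
    then show ?thesis
    proof cases
      case 1
      then show ?thesis
        using F L'(2) RW by (simp add: additive_op.op_sg[OF del_op] del_R)
    next
      case 2
      then show ?thesis
        using F RW by (simp add: additive_op.op_sg[OF del_op] del_R_less less_imp_neq)
    next
      case 3
      have "((kap j L' \<noteq> kap m (insert j L')) \<noteq> eps j m) \<longleftrightarrow> (kap m L' = kap j (insert m L'))"
        using kap[unfolded koszul_sign_def, rule_format, of j L' m] that L'(1) 3 by auto
      then have *: "(kap m L' \<noteq> (kap j L' \<noteq> eps m j)) = (\<not> (kap j L \<noteq> kap m (insert j L')))"
        using eps_commute[of j m] L'(2) by auto
      have "sg (kap m L') (del m (sg (kap j L') (R j (F (insert j L')))))
          = sg (kap m L' \<noteq> (kap j L' \<noteq> eps m j)) (R j (del m (F (insert j L'))))"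
        using F RW 3 by (simp add: additive_op.op_sg[OF del_op] del_R_greater)
      also have "\<dots> = - sg (kap j L \<noteq> kap m (insert j L')) (R j (del m (F (insert j L'))))"
        by (simp only: * sg_not)
      finally show ?thesis
        using 3 less_imp_neq[OF 3] less_not_sym[OF 3] by (metis (no_types))
    qed
  qed
  have "koszul_h kap del (koszul_d kap R F) L
      = sg (kap m L') (del m (\<Sum>j\<in>- L'. sg (kap j L') (R j (F (insert j L')))))"
    using False by (simp add: koszul_h_def koszul_d_def m_def L'_def)
  also have "\<dots> = (\<Sum>j\<in>- L'. sg (kap m L') (del m (sg (kap j L') (R j (F (insert j L'))))))"
    by (subst additive_op.op_sum[OF del_op]) (auto simp: sg_sum intro!: sg_W additive_op.op_W[OF R_op] F)
  also have "\<dots> = (\<Sum>j\<in>- L'. if j = m then E (idx_pos m) (F L) else if j < m then 0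
         else - sg (kap j L \<noteq> kap m (insert j L')) (R j (del m (F (insert j L')))))"
    by (intro sum.cong) (auto simp: del_term)
  also have "\<dots> = E (idx_pos m) (F L) + (\<Sum>j\<in>- L. if j < m then 0
         else - sg (kap j L \<noteq> kap m (insert j L')) (R j (del m (F (insert j L')))))"
    unfolding cL' using m(1) by (subst sum.insert) (auto intro!: sum.cong)
  also have "(\<Sum>j\<in>- L. if j < m then 0
         else - sg (kap j L \<noteq> kap m (insert j L')) (R j (del m (F (insert j L')))))
      = (\<Sum>j | m < j \<and> j \<notin> L. - sg (kap j L \<noteq> kap m (insert j L')) (R j (del m (F (insert j L')))))"
    using m(1) by (intro sum.mono_neutral_cong_right) (auto simp: not_less order_le_less)
  finally show ?thesis
    using False by (simp add: d sum_negf)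
qed

end


text \<open>Exchanging \<open>j\<close> and \<open>k\<close> shows only that the sum is its own
  negative, which does not make it 0 in a group with 2-torsion; so it is split along the diagonal
  into two sums that cancel.\<close>

lemma sum_antisym:
  fixes f :: "idx \<Rightarrow> idx \<Rightarrow> 'b::ab_group_add"
  assumes "\<And>j k. j \<in> X \<Longrightarrow> k \<in> X \<Longrightarrow> j \<noteq> k \<Longrightarrow> f j k = - f k j"
  shows "(\<Sum>j\<in>X. \<Sum>k\<in>X - {j}. f j k) = 0"
proof -
  have "(\<Sum>k\<in>X - {j}. f j k) = (\<Sum>k | k \<in> X \<and> k < j. f j k) + (\<Sum>k | k \<in> X \<and> j < k. f j k)" for j
    by (subst sum.union_disjoint[symmetric]) (auto intro!: sum.cong simp: neq_iff)
  then have "(\<Sum>j\<in>X. \<Sum>k\<in>X - {j}. f j k)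
      = (\<Sum>j\<in>X. \<Sum>k | k \<in> X \<and> k < j. f j k) + (\<Sum>j\<in>X. \<Sum>k | k \<in> X \<and> j < k. f j k)"
    by (simp add: sum.distrib)
  also have "(\<Sum>j\<in>X. \<Sum>k | k \<in> X \<and> j < k. f j k) = (\<Sum>k\<in>X. \<Sum>j | j \<in> X \<and> j < k. f j k)"
    by (rule sum.swap_restrict) auto
  also have "\<dots> = - (\<Sum>k\<in>X. \<Sum>j | j \<in> X \<and> j < k. f k j)"
    unfolding sum_negf[symmetric] using assms by (intro sum.cong) auto
  finally show ?thesis by simp
qed

text \<open>
  The signs of moving the \<open>j\<close>-th generator of the skew exterior algebra to the left, respectively
  to the right, of the product of the generators in \<open>L\<close>.
\<close>

definition left_sign :: "(idx \<Rightarrow> idx \<Rightarrow> bool) \<Rightarrow> idx \<Rightarrow> idx set \<Rightarrow> bool" where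
  "left_sign eps j L = odd (card {k\<in>L. k < j \<and> \<not> eps j k})"

definition right_sign :: "(idx \<Rightarrow> idx \<Rightarrow> bool) \<Rightarrow> idx \<Rightarrow> idx set \<Rightarrow> bool" where
  "right_sign eps j L = odd (card {k\<in>L. k < j \<or> j < k \<and> eps j k})"

lemma odd_card_insert:
  fixes L :: "idx set"
  assumes "k \<notin> L"
  shows "odd (card {i\<in>insert k L. P i}) \<longleftrightarrow> odd (card {i\<in>L. P i}) \<noteq> P k"
proof -
  have "{i\<in>insert k L. P i} = (if P k then insert k {i\<in>L. P i} else {i\<in>L. P i})" by auto
  then show ?thesis using assms by simp
qed

lemma left_sign_insert:
  "k \<notin> L \<Longrightarrow> left_sign eps j (insert k L) \<longleftrightarrow> left_sign eps j L \<noteq> (k < j \<and> \<not> eps j k)"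
  unfolding left_sign_def by (rule odd_card_insert)

lemma right_sign_insert:
  "k \<notin> L \<Longrightarrow> right_sign eps j (insert k L) \<longleftrightarrow> right_sign eps j L \<noteq> (k < j \<or> j < k \<and> eps j k)"
  unfolding right_sign_def by (rule odd_card_insert)

lemma koszul_sign_left:
  assumes "\<And>i j. eps i j = eps j i"
  shows "koszul_sign eps (left_sign eps)"
  unfolding koszul_sign_def
proof (intro allI impI)
  fix L j k assume *: "j \<notin> L \<and> k \<notin> L \<and> j \<noteq> (k :: idx)"
  then have "j < k \<longleftrightarrow> \<not> k < j" by auto
  then show "((left_sign eps j L \<noteq> left_sign eps k (insert j L)) \<noteq> eps j k)
      \<longleftrightarrow> (left_sign eps k L = left_sign eps j (insert k L))"
    using * assms[of j k] by (auto simp: left_sign_insert)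
qed

lemma koszul_sign_right:
  assumes "\<And>i j. eps i j = eps j i"
  shows "koszul_sign eps (right_sign eps)"
  unfolding koszul_sign_def
proof (intro allI impI)
  fix L j k assume *: "j \<notin> L \<and> k \<notin> L \<and> j \<noteq> (k :: idx)"
  then have "j < k \<longleftrightarrow> \<not> k < j" by auto
  then show "((right_sign eps j L \<noteq> right_sign eps k (insert j L)) \<noteq> eps j k)
      \<longleftrightarrow> (right_sign eps k L = right_sign eps j (insert k L))"
    using * assms[of j k] by (auto simp: right_sign_insert)
qed

text \<open>Contraction with \<open>j\<close> from the left and with \<open>k\<close> from the right
  anticommute without a factor \<open>eps\<close>. This matches operators \<open>R j\<close> and
  \<open>S k\<close> that commute strictly, so the mixed terms of the squared two-sided differential
  cancel.\<close>

lemma left_right_sign: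
  assumes "\<And>i j. eps i j = eps j i" "j \<notin> L" "k \<notin> L" "j \<noteq> k"
  shows "(left_sign eps j L \<noteq> right_sign eps k (insert j L))
    \<longleftrightarrow> (right_sign eps k L = left_sign eps j (insert k L))"
proof -
  have "j < k \<longleftrightarrow> \<not> k < j" using assms(4) by auto
  then show ?thesis
    using assms(2-4) assms(1)[of j k] by (auto simp: left_sign_insert right_sign_insert)
qed

lemma koszul_d_support:
  assumes "\<And>L. F L \<noteq> 0 \<Longrightarrow> card L = Suc p" "\<And>j. R j 0 = 0" "koszul_d kap R F L \<noteq> 0"
  shows "card L = p"
proof -
  obtain j where j: "j \<notin> L" "sg (kap j L) (R j (F (insert j L))) \<noteq> 0"
    using assms(3) unfolding koszul_d_def by (metis (mono_tags, lifting) ComplD sum.neutral)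
  then have "F (insert j L) \<noteq> 0" using assms(2)[of j] by auto
  then have "card (insert j L) = Suc p" by (rule assms(1))
  then show ?thesis using j(1) by simp
qed

lemma koszul_h_support:
  assumes "\<And>L. F L \<noteq> 0 \<Longrightarrow> card L = p" "\<And>j. del j 0 = 0" "koszul_h kap del F L \<noteq> 0"
  shows "card L = Suc p"
proof -
  have L: "L \<noteq> {}" and "del (Min L) (F (L - {Min L})) \<noteq> 0"
    using assms(3) by (auto simp: koszul_h_def split: if_splits)
  then have "card (L - {Min L}) = p" using assms(1,2) by metis
  moreover have "Min L \<in> L" using L by (simp add: Min_in)
  ultimately show ?thesis by (metis card.remove finite_code)
qed

lemma koszul_d_comp:
  fixes W :: "'w::ab_group_add set"
  assumes R: "\<And>j. additive_op W (R j)" and SF: "\<And>k K. S k (F K) \<in> W"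
  shows "koszul_d kap R (koszul_d kap' S F) L = (\<Sum>j\<in>- L. \<Sum>k\<in>- L - {j}.
    sg (kap j L \<noteq> kap' k (insert j L)) (R j (S k (F (insert j (insert k L))))))"
  unfolding koszul_d_def[of kap R]
proof (rule sum.cong[OF HOL.refl])
  fix j
  interpret additive_op W "R j" by (rule R)
  have "koszul_d kap' S F (insert j L)
      = (\<Sum>k\<in>- L - {j}. sg (kap' k (insert j L)) (S k (F (insert j (insert k L)))))"
    unfolding koszul_d_def by (rule sum.cong) (auto simp: insert_commute)
  then show "sg (kap j L) (R j (koszul_d kap' S F (insert j L)))
      = (\<Sum>k\<in>- L - {j}. sg (kap j L \<noteq> kap' k (insert j L)) (R j (S k (F (insert j (insert k L))))))"
    by (simp add: op_sum sg_W SF op_sg sg_sum)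
qed

lemma koszul_d_koszul_d:
  fixes W :: "'w::ab_group_add set"
  assumes R: "\<And>j. additive_op W (R j)" and kap: "koszul_sign eps kap"
    and R_R: "\<And>j k w. w \<in> W \<Longrightarrow> R j (R k w) = sg (eps j k) (R k (R j w))"
    and F: "\<And>L. F L \<in> W"
  shows "koszul_d kap R (koszul_d kap R F) L = 0"
proof -
  interpret additive_group W using R[of I1] by (simp add: additive_op_def)
  have RF: "R j (F K) \<in> W" for j K by (rule additive_op.op_W[OF R F])
  have "koszul_d kap R (koszul_d kap R F) L = (\<Sum>j\<in>- L. \<Sum>k\<in>- L - {j}.
      sg (kap j L \<noteq> kap k (insert j L)) (R j (R k (F (insert j (insert k L))))))"
    by (rule koszul_d_comp[where W = W]) (simp_all add: R RF)
  also have "\<dots> = 0"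
  proof (rule sum_antisym)
    fix j k assume *: "j \<in> - L" "k \<in> - L" "j \<noteq> k"
    then have "((kap j L \<noteq> kap k (insert j L)) \<noteq> eps j k) = (\<not> (kap k L \<noteq> kap j (insert k L)))"
      using kap[unfolded koszul_sign_def, rule_format, of j L k] by auto
    then show "sg (kap j L \<noteq> kap k (insert j L)) (R j (R k (F (insert j (insert k L)))))
        = - sg (kap k L \<noteq> kap j (insert k L)) (R k (R j (F (insert k (insert j L)))))"
      unfolding R_R[OF F, of j k] sg_simps(3) insert_commute[of j k] by (simp only: sg_not)
  qed
  finally show ?thesis .
qed

section \<open>The two-sided Koszul complex\<close>

text \<open>In the model \<open>W\<close> is \<open>A \<otimes> M\<close>, \<open>R j\<close> is
  right multiplication by a variable on \<open>A\<close>, \<open>S j\<close> its action on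
  \<open>M\<close>, \<open>Wf t\<close> consists of the tensors of degree less than \<open>t\<close>
  in \<open>A\<close>, and \<open>Wc\<close> is \<open>K \<otimes> M\<close>. As \<open>R\<close>
  raises the filtration and \<open>S\<close> preserves it, \<open>R\<close> dominates the
  differential.\<close>

locale koszul_bimodule = koszul W R del E eps
  for W :: "'w::ab_group_add set" and R del E eps +
  fixes S :: "idx \<Rightarrow> 'w \<Rightarrow> 'w" and Wf :: "nat \<Rightarrow> 'w set" and Wc :: "'w set"
  assumes S_op: "\<And>j. additive_op W (S j)"
    and R_R: "w \<in> W \<Longrightarrow> R j (R k w) = sg (eps j k) (R k (R j w))"
    and S_S: "w \<in> W \<Longrightarrow> S j (S k w) = sg (eps j k) (S k (S j w))"
    and R_S: "w \<in> W \<Longrightarrow> R j (S k w) = S k (R j w)"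
    and Wf_group: "additive_group (Wf t)"
    and Wf_0: "Wf 0 = {0}"
    and Wf_mono: "Wf t \<subseteq> Wf (Suc t)"
    and W_Wf: "W = (\<Union>t. Wf t)"
    and R_Wf: "w \<in> Wf t \<Longrightarrow> R j w \<in> Wf (Suc t)"
    and del_Wf: "w \<in> Wf (Suc t) \<Longrightarrow> del j w \<in> Wf t"
    and S_Wf: "w \<in> Wf t \<Longrightarrow> S j w \<in> Wf t"
    and Wc_group: "additive_group Wc"
    and E_5: "w \<in> W \<Longrightarrow> E 5 w \<in> Wc \<inter> Wf 1"
begin

definition koszul_b :: "(idx set \<Rightarrow> 'w) \<Rightarrow> idx set \<Rightarrow> 'w" where
  "koszul_b F L = koszul_d (left_sign eps) R F L - koszul_d (right_sign eps) S F L"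

lemma koszul_b_W: "(\<And>L. F L \<in> W) \<Longrightarrow> koszul_b F L \<in> W"
  unfolding koszul_b_def koszul_d_def
  by (intro diff_W sum_W sg_W additive_op.op_W[OF R_op] additive_op.op_W[OF S_op])

lemma koszul_b_add:
  assumes "\<And>L. F L \<in> W" "\<And>L. G L \<in> W"
  shows "koszul_b (\<lambda>L. F L + G L) L = koszul_b F L + koszul_b G L"
  using assms by (simp add: koszul_b_def koszul_d_def additive_op.op_add[OF R_op]
      additive_op.op_add[OF S_op] sg_add sum.distrib)

lemma koszul_b_diff:
  assumes "\<And>L. F L \<in> W" "\<And>L. G L \<in> W"
  shows "koszul_b (\<lambda>L. F L - G L) L = koszul_b F L - koszul_b G L"
  using assms by (simp add: koszul_b_def koszul_d_def additive_op.op_diff[OF R_op]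
      additive_op.op_diff[OF S_op] sg_diff sum_subtractf)

lemma koszul_b_support:
  assumes "\<And>L. F L \<noteq> 0 \<Longrightarrow> card L = Suc p" "koszul_b F L \<noteq> 0"
  shows "card L = p"
proof -
  have "koszul_d (left_sign eps) R F L \<noteq> 0 \<or> koszul_d (right_sign eps) S F L \<noteq> 0"
    using assms(2) by (auto simp: koszul_b_def)
  then show ?thesis
    using koszul_d_support[OF assms(1)] additive_op.op_zero[OF R_op] additive_op.op_zero[OF S_op]
    by metis
qed

lemma koszul_b_koszul_b:
  assumes F: "\<And>L. F L \<in> W"
  shows "koszul_b (koszul_b F) L = 0"
proof -
  let ?a = "left_sign eps" and ?b = "right_sign eps"
  have W: "R j w \<in> W" "S j w \<in> W" if "w \<in> W" for j w
    using that by (simp_all add: additive_op.op_W[OF R_op] additive_op.op_W[OF S_op])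
  have dW: "koszul_d ?a R F K \<in> W" "koszul_d ?b S F K \<in> W" for K
    unfolding koszul_d_def by (intro sum_W sg_W W F)+
  have "koszul_b (koszul_b F) L
      = koszul_d ?a R (koszul_d ?a R F) L + koszul_d ?b S (koszul_d ?b S F) L
        - (koszul_d ?a R (koszul_d ?b S F) L + koszul_d ?b S (koszul_d ?a R F) L)"
    unfolding koszul_b_def
    by (simp add: koszul_d_def[of _ _ "\<lambda>L. koszul_d ?a R F L - koszul_d ?b S F L"]
        koszul_d_def[of ?a R "koszul_d _ _ _"] koszul_d_def[of ?b S "koszul_d _ _ _"]
        additive_op.op_diff[OF R_op] additive_op.op_diff[OF S_op] dW sg_diff sum_subtractf)
  also have "koszul_d ?a R (koszul_d ?a R F) L = 0"
    by (rule koszul_d_koszul_d[OF R_op koszul_sign_left R_R F]) (auto simp: eps_commute)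
  also have "koszul_d ?b S (koszul_d ?b S F) L = 0"
    by (rule koszul_d_koszul_d[OF S_op koszul_sign_right S_S F]) (auto simp: eps_commute)
  also have "koszul_d ?a R (koszul_d ?b S F) L + koszul_d ?b S (koszul_d ?a R F) L
      = (\<Sum>j\<in>- L. \<Sum>k\<in>- L - {j}.
          sg (?a j L \<noteq> ?b k (insert j L)) (R j (S k (F (insert j (insert k L)))))
        + sg (?b j L \<noteq> ?a k (insert j L)) (S j (R k (F (insert j (insert k L))))))"
    by (simp add: koszul_d_comp[where W = W] R_op S_op W F sum.distrib)
  also have "\<dots> = 0"
  proof (rule sum_antisym)
    fix j k assume *: "j \<in> - L" "k \<in> - L" "j \<noteq> k"
    have s: "(?a j L \<noteq> ?b k (insert j L)) = (\<not> (?b k L \<noteq> ?a j (insert k L)))"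
      if "j \<in> - L" "k \<in> - L" "j \<noteq> k" for j k
      using left_right_sign[of eps j L k] that eps_commute by blast
    show "sg (?a j L \<noteq> ?b k (insert j L)) (R j (S k (F (insert j (insert k L)))))
        + sg (?b j L \<noteq> ?a k (insert j L)) (S j (R k (F (insert j (insert k L)))))
      = - (sg (?a k L \<noteq> ?b j (insert k L)) (R k (S j (F (insert k (insert j L)))))
        + sg (?b k L \<noteq> ?a j (insert k L)) (S k (R j (F (insert k (insert j L))))))"
      unfolding s[OF *] s[OF *(2,1) *(3)[symmetric]] R_S[OF F] insert_commute[of j k] sg_not
      by simp
  qed
  finally show ?thesis by simp
qed

text \<open>
  The part of the differential given by \<open>R\<close> is contractible, and the part given by \<open>S\<close> lowers the
  filtration degree; so every cycle is a boundary up to a cycle of smaller filtration degree.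
\<close>

lemma koszul_b_exact_filtered:
  assumes "\<And>L. F L \<in> Wf (t - card L)" "\<And>L. F L \<noteq> 0 \<Longrightarrow> card L = p"
    and "p > 0 \<Longrightarrow> (\<And>L. koszul_b F L = 0)"
  shows "\<exists>G c. (\<forall>L. G L \<in> W) \<and> (\<forall>L. G L \<noteq> 0 \<longrightarrow> card L = Suc p) \<and> c \<in> Wc \<and>
    (\<forall>L. F L = koszul_b G L + (if L = {} then c else 0))"
  using assms
proof (induction t arbitrary: F)
  case 0
  then have "F L = 0" for L using Wf_0 by (metis diff_0_eq_0 singletonD)
  moreover have "koszul_b (\<lambda>L. 0) L = 0" for L
    by (simp add: koszul_b_def koszul_d_def additive_op.op_zero[OF R_op] additive_op.op_zero[OF S_op])
  ultimately show ?case
    using zero_W additive_group.zero_W[OF Wc_group]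
    by (intro exI[of _ "\<lambda>L. 0"] exI[of _ "0"]) simp
next
  case (Suc t)
  let ?a = "left_sign eps" and ?b = "right_sign eps"
  have sgn: "koszul_sign eps ?a" by (rule koszul_sign_left) (rule eps_commute)
  have F: "F L \<in> W" for L using Suc.prems(1) W_Wf by blast
  \<comment> \<open>Weigh a coefficient at \<open>L\<close> by its filtration degree plus
    \<open>card L\<close>: the differential of \<open>R\<close> and the homotopy preserve this
    weight, the differential of \<open>S\<close> lowers it by one.\<close>
  define G where "G = koszul_h ?a del F"
  have G: "G L \<in> W" for L unfolding G_def by (rule koszul_h_W[OF F])
  have G_supp: "card L = Suc p" if "G L \<noteq> 0" for L
    by (rule koszul_h_support[OF Suc.prems(2) additive_op.op_zero[OF del_op] that[unfolded G_def]])
  have G_Wf: "G L \<in> Wf (Suc t - card L)" for L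
  proof (cases "L = {}")
    case True
    then show ?thesis by (simp add: G_def koszul_h_def additive_group.zero_W[OF Wf_group])
  next
    case False
    then have c: "card (L - {Min L}) = card L - 1" "card L > 0"
      by (auto simp: card_gt_0_iff card_Diff_singleton)
    have FW: "F (L - {Min L}) \<in> Wf (Suc t - (card L - 1))"
      using Suc.prems(1)[of "L - {Min L}"] unfolding c(1) .
    have "del (Min L) (F (L - {Min L})) \<in> Wf (Suc t - card L)"
    \<comment> \<open>Subtraction is truncated: for larger \<open>L\<close> the coefficient lies in
      \<open>Wf 0 = {0}\<close>.\<close>
    proof (cases "card L \<le> Suc t")
      case True
      then have "Suc t - (card L - 1) = Suc (Suc t - card L)" using c by linarith
      then show ?thesis using FW del_Wf by simp
    next
      case False
      then have "F (L - {Min L}) = 0" using FW Wf_0 by simp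
      then show ?thesis
        by (simp add: additive_op.op_zero[OF del_op] additive_group.zero_W[OF Wf_group])
    qed
    then show ?thesis
      using False by (simp add: G_def koszul_h_def additive_group.sg_W[OF Wf_group])
  qed
  define c where "c = (if p = 0 then E 5 (F {}) else 0)"
  have c: "c \<in> Wc" "c \<in> Wf 1" "c \<in> W"
    using E_5[OF F, of "{}"] additive_group.zero_W[OF Wc_group] additive_group.zero_W[OF Wf_group]
      W_Wf unfolding c_def by auto
  \<comment> \<open>The remainder. For a cycle the differentials of \<open>R\<close> and
    \<open>S\<close> agree on \<open>F\<close> (for \<open>p = 0\<close> both vanish), so the
    homotopy formula expresses \<open>N\<close> by two terms that each contain the differential of
    \<open>S\<close> once; the weight drops and the induction hypothesis applies.\<close>
  define N where "N L = F L - koszul_b G L - (if L = {} then c else 0)" for L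
  have dF_supp: "koszul_d ?a R F L = koszul_d ?b S F L" for L
  proof (cases "p = 0")
    case True
    have "F (insert j L) = 0" for j using Suc.prems(2)[of "insert j L"] True by auto
    then show ?thesis
      by (simp add: koszul_d_def additive_op.op_zero[OF R_op] additive_op.op_zero[OF S_op])
  next
    case False
    then show ?thesis using Suc.prems(3)[of L] by (simp add: koszul_b_def)
  qed
  have c_eq: "(if L = {} then E 5 (F {}) else 0) = (if L = {} then c else 0)" for L :: "idx set"
  proof -
    have "E 5 (F {}) = 0" if "p \<noteq> 0"
    proof -
      have "F {} = 0" using Suc.prems(2)[of "{}"] that by auto
      \<comment> \<open>\<open>E 5\<close> is not assumed additive; its value at 0 comes from the
        homotopy formula for the zero family.\<close>
      then have "F {} - E 5 (F {}) = 0"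
        using koszul_homotopy[OF sgn, of "\<lambda>L. 0" "{}"] zero_W
        by (simp add: koszul_d_def koszul_h_def additive_op.op_zero[OF R_op] additive_op.op_zero[OF del_op])
      then show ?thesis using \<open>F {} = 0\<close> by simp
    qed
    then show ?thesis by (auto simp: c_def)
  qed
  have N_eq: "N L = koszul_h ?a del (koszul_d ?b S F) L + koszul_d ?b S G L" for L
  proof -
    have "koszul_h ?a del (koszul_d ?a R F) L = koszul_h ?a del (koszul_d ?b S F) L"
      by (simp add: koszul_h_def dF_supp)
    then show ?thesis
      using koszul_homotopy[OF sgn, of F L, OF F] unfolding N_def koszul_b_def c_eq G_def
      by (simp add: algebra_simps)
  qed
  have dS: "koszul_d ?b S H L \<in> Wf (t - card L)" if H: "\<And>L. H L \<in> Wf (Suc t - card L)" for H :: "idx set \<Rightarrow> 'w" and L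
    unfolding koszul_d_def
  proof (intro additive_group.sum_W[OF Wf_group] additive_group.sg_W[OF Wf_group] S_Wf)
    fix j assume "j \<in> - L"
    then have "card (insert j L) = Suc (card L)" by simp
    then show "H (insert j L) \<in> Wf (t - card L)" using H[of "insert j L"] by simp
  qed
  have N_Wf: "N L \<in> Wf (t - card L)" for L
  proof -
    have "koszul_h ?a del (koszul_d ?b S F) L \<in> Wf (t - card L)"
    proof (cases "L = {}")
      case True
      then show ?thesis by (simp add: koszul_h_def additive_group.zero_W[OF Wf_group])
    next
      case False
      then have c: "card (L - {Min L}) = card L - 1" "card L > 0"
        by (auto simp: card_gt_0_iff card_Diff_singleton)
      let ?w = "koszul_d ?b S F (L - {Min L})"
      have w: "?w \<in> Wf (t - (card L - 1))"
        using dS[of F "L - {Min L}", OF Suc.prems(1)] unfolding c(1) .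
      have "del (Min L) ?w \<in> Wf (t - card L)"
      proof (cases "card L \<le> t")
        case True
        then have "t - (card L - 1) = Suc (t - card L)" using c by linarith
        then show ?thesis using w del_Wf by simp
      next
        case False
        then have "?w = 0" using w Wf_0 by simp
        then show ?thesis
          by (simp add: additive_op.op_zero[OF del_op] additive_group.zero_W[OF Wf_group])
      qed
      then show ?thesis
        using False by (simp add: koszul_h_def additive_group.sg_W[OF Wf_group])
    qed
    then show ?thesis
      unfolding N_eq using dS[of G L, OF G_Wf] by (rule additive_group.add_W[OF Wf_group])
  qed
  have N_supp: "card L = p" if "N L \<noteq> 0" for L
  proof -
    have "F L \<noteq> 0 \<or> koszul_b G L \<noteq> 0 \<or> (L = {} \<and> c \<noteq> 0)"
      using that by (auto simp: N_def split: if_splits)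
    then show ?thesis
      using Suc.prems(2) koszul_b_support[of G p L, OF G_supp] by (auto simp: c_def split: if_splits)
  qed
  have N_cycle: "koszul_b N L = 0" if "p > 0" for L
  proof -
    have "N = (\<lambda>L. F L - koszul_b G L)" using that by (auto simp: N_def c_def)
    then have "koszul_b N L = koszul_b F L - koszul_b (koszul_b G) L"
      by (simp add: koszul_b_diff F koszul_b_W G)
    then show ?thesis using Suc.prems(3)[OF that] koszul_b_koszul_b[OF G] by simp
  qed
  obtain G' c' where G': "\<And>L. G' L \<in> W" "\<And>L. G' L \<noteq> 0 \<Longrightarrow> card L = Suc p" "c' \<in> Wc"
      "\<And>L. N L = koszul_b G' L + (if L = {} then c' else 0)"
    using Suc.IH[OF N_Wf N_supp N_cycle] by blast
  show ?case
  proof (intro exI[of _ "\<lambda>L. G L + G' L"] exI[of _ "c + c'"] conjI allI impI)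
    show "G L + G' L \<in> W" for L using G G' add_W by simp
    show "card L = Suc p" if "G L + G' L \<noteq> 0" for L
      using that G_supp[of L] G'(2)[of L] by (cases "G L = 0") auto
    show "c + c' \<in> Wc" using c G' additive_group.add_W[OF Wc_group] by simp
    show "F L = koszul_b (\<lambda>L. G L + G' L) L + (if L = {} then c + c' else 0)" for L
    proof -
      have "F L = N L + koszul_b G L + (if L = {} then c else 0)" by (simp add: N_def)
      then show ?thesis
        unfolding G'(4)[of L] by (simp add: koszul_b_add G G' add_ac)
    qed
  qed
qed

lemma koszul_b_exact:
  assumes F: "\<And>L. F L \<in> W" and supp: "\<And>L. F L \<noteq> 0 \<Longrightarrow> card L = p"
    and cycle: "p > 0 \<Longrightarrow> (\<And>L. koszul_b F L = 0)"
  obtains G c where "\<And>L. G L \<in> W" "\<And>L. G L \<noteq> 0 \<Longrightarrow> card L = Suc p" "c \<in> Wc"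
    "\<And>L. F L = koszul_b G L + (if L = {} then c else 0)"
proof -
  have "\<forall>L. \<exists>t. F L \<in> Wf t" using F W_Wf by blast
  then obtain T where T: "\<And>L. F L \<in> Wf (T L)" by metis
  have mono: "Wf s \<subseteq> Wf t" if "s \<le> t" for s t
    using lift_Suc_mono_le[of Wf, OF Wf_mono that] .
  \<comment> \<open>At most 4 is subtracted from \<open>t\<close>, so \<open>t - card L\<close>
    still bounds every \<open>T L\<close>.\<close>
  define t where "t = (\<Sum>L\<in>UNIV. T L) + 4"
  have "F L \<in> Wf (t - card L)" for L
  proof -
    have "T L \<le> (\<Sum>L\<in>UNIV. T L)" by (rule member_le_sum) auto
    then have "T L \<le> t - card L" using card_idx_le[of L] by (simp add: t_def)
    then show ?thesis using T mono by blast
  qed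
  from koszul_b_exact_filtered[OF this supp cycle] that show thesis by blast
qed

end

section \<open>Modules over an algebra\<close>

lemma lookup_map_zero:
  "f 0 = 0 \<Longrightarrow> lookup (Poly_Mapping.map f v) i = f (lookup v i)"
  by (simp add: Poly_Mapping.map.rep_eq when_def)

lemma keys_map_subset: "keys (Poly_Mapping.map f v) \<subseteq> keys v"
  by (auto simp: in_keys_iff Poly_Mapping.map.rep_eq when_def)

lemma lookup_sg: "lookup (sg b v) i = sg b (lookup v i)"
  by (simp add: sg_def)

text \<open>The direct sum of copies of \<open>W\<close> indexed by \<open>I\<close>; for
  \<open>W = carr A\<close> it is the free module on \<open>I\<close>.\<close>

definition pm_set :: "'i set \<Rightarrow> 'w::zero set \<Rightarrow> ('i \<Rightarrow>\<^sub>0 'w) set" where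
  "pm_set I W = {v. keys v \<subseteq> I \<and> (\<forall>i. lookup v i \<in> W)}"

lemma pm_set_lookup: "v \<in> pm_set I W \<Longrightarrow> lookup v i \<in> W"
  by (simp add: pm_set_def)

lemma additive_group_pm_set:
  assumes "additive_group W"
  shows "additive_group (pm_set I W)"
proof -
  interpret additive_group W by (rule assms)
  show ?thesis
  proof
    show "0 \<in> pm_set I W" by (simp add: pm_set_def zero_W)
    fix v w assume "v \<in> pm_set I W" "w \<in> pm_set I W"
    then show "v - w \<in> pm_set I W"
      using keys_diff[of v w] by (auto simp: pm_set_def lookup_minus diff_W)
  qed
qed

lemma additive_op_pm_set:
  assumes "additive_op W f"
  shows "additive_op (pm_set I W) (Poly_Mapping.map f)"
proof -
  interpret additive_op W f by (rule assms)
  interpret V: additive_group "pm_set I W"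
    by (rule additive_group_pm_set) (rule additive_group_axioms)
  show ?thesis
  proof
    fix v w assume v: "v \<in> pm_set I W" and w: "w \<in> pm_set I W"
    show "Poly_Mapping.map f v \<in> pm_set I W"
      using v keys_map_subset[of f v] by (auto simp: pm_set_def lookup_map_zero op_zero op_W)
    show "Poly_Mapping.map f (v + w) = Poly_Mapping.map f v + Poly_Mapping.map f w"
      using v w by (intro poly_mapping_eqI)
        (simp add: lookup_map_zero op_zero lookup_add op_add pm_set_lookup)
  qed
qed

text \<open>Koszul data act coordinatewise on direct sums. \<open>Poly_Mapping.map f\<close> applies
  \<open>f\<close> to nonzero values only, so each operator must be known to send 0 to 0.\<close>

lemma koszul_pm_set:
  assumes "koszul W R del E eps"
  shows "koszul (pm_set I W) (\<lambda>j. Poly_Mapping.map (R j)) (\<lambda>j. Poly_Mapping.map (del j))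
    (\<lambda>n. Poly_Mapping.map (E n)) eps"
proof -
  interpret koszul W R del E eps by (rule assms)
  note z = additive_op.op_zero[OF R_op] additive_op.op_zero[OF del_op]
  have E0: "E (idx_pos s) 0 = 0" "E (Suc (idx_pos s)) 0 = 0" for s
    using del_R[OF zero_W, of s] R_del[OF zero_W, of s] by (simp_all add: z)
  show ?thesis
  proof
    show "0 \<in> pm_set I W"
      using additive_group_pm_set[OF additive_group_axioms, of I] by (simp add: additive_group_def)
    show "x - y \<in> pm_set I W" if "x \<in> pm_set I W" "y \<in> pm_set I W" for x y
      using additive_group_pm_set[OF additive_group_axioms, of I] that
      by (simp add: additive_group_def)
  next
    fix j w assume w: "w \<in> pm_set I W"
    show "Poly_Mapping.map (R j) w \<in> pm_set I W" "Poly_Mapping.map (del j) w \<in> pm_set I W"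
      using additive_op.op_W[OF additive_op_pm_set w] R_op del_op by blast+
  next
    fix j v w assume w: "v \<in> pm_set I W" "w \<in> pm_set I W"
    show "Poly_Mapping.map (R j) (v + w) = Poly_Mapping.map (R j) v + Poly_Mapping.map (R j) w"
      "Poly_Mapping.map (del j) (v + w) = Poly_Mapping.map (del j) v + Poly_Mapping.map (del j) w"
      using additive_op.op_add[OF additive_op_pm_set w] R_op del_op by blast+
  next
    fix s w assume w: "w \<in> pm_set I W"
    show "Poly_Mapping.map (del s) (Poly_Mapping.map (R j) w) = 0" if "j < s" for j
      using that by (intro poly_mapping_eqI) (simp add: lookup_map_zero z del_R_less pm_set_lookup[OF w])
    show "Poly_Mapping.map (del s) (Poly_Mapping.map (R j) w)
        = sg (eps s j) (Poly_Mapping.map (R j) (Poly_Mapping.map (del s) w))" if "s < j" for j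
      using that by (intro poly_mapping_eqI)
        (simp add: lookup_map_zero z del_R_greater lookup_sg pm_set_lookup[OF w])
    show "Poly_Mapping.map (R s) (Poly_Mapping.map (del s) w)
        = Poly_Mapping.map (E (idx_pos s)) w - Poly_Mapping.map (E (Suc (idx_pos s))) w"
      by (intro poly_mapping_eqI)
        (simp add: lookup_minus lookup_map_zero z E0 R_del pm_set_lookup[OF w])
    show "Poly_Mapping.map (del s) (Poly_Mapping.map (R s) w)
        = Poly_Mapping.map (E (idx_pos s)) w"
      by (intro poly_mapping_eqI) (simp add: lookup_map_zero z E0 del_R pm_set_lookup[OF w])
    show "Poly_Mapping.map (E 1) w = w"
      by (intro poly_mapping_eqI) (simp only: lookup_map_zero[where f = "E 1", OF E_1[OF zero_W]] E_1 pm_set_lookup[OF w])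
  qed (simp_all add: eps_commute)
qed

section \<open>Algebras and their free modules\<close>

locale algebra_carrier =
  fixes A :: "('k::field, 'a::ab_group_add) galg"
  assumes alg: "is_algebra A"
begin

sublocale vs: vector_space "scl A"
  using alg unfolding is_algebra_def by blast

lemma subspace_carr: "vs.subspace (carr A)"
  using alg unfolding is_algebra_def by blast

sublocale carr: additive_group "carr A"
  using vs.subspace_0[OF subspace_carr] vs.subspace_diff[OF subspace_carr] by unfold_locales

lemma scl_carr: "x \<in> carr A \<Longrightarrow> scl A c x \<in> carr A"
  by (rule vs.subspace_scale[OF subspace_carr])

lemma unit_carr: "unit A \<in> carr A"
  and unit_left: "x \<in> carr A \<Longrightarrow> mul A (unit A) x = x"
  and unit_right: "x \<in> carr A \<Longrightarrow> mul A x (unit A) = x"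
  and mul_carr: "x \<in> carr A \<Longrightarrow> y \<in> carr A \<Longrightarrow> mul A x y \<in> carr A"
  and mul_assoc: "x \<in> carr A \<Longrightarrow> y \<in> carr A \<Longrightarrow> z \<in> carr A \<Longrightarrow> mul A (mul A x y) z = mul A x (mul A y z)"
  and mul_add_left: "x \<in> carr A \<Longrightarrow> y \<in> carr A \<Longrightarrow> z \<in> carr A \<Longrightarrow> mul A (x + y) z = mul A x z + mul A y z"
  and mul_add_right: "x \<in> carr A \<Longrightarrow> y \<in> carr A \<Longrightarrow> z \<in> carr A \<Longrightarrow> mul A x (y + z) = mul A x y + mul A x z"
  and mul_scl_left: "x \<in> carr A \<Longrightarrow> y \<in> carr A \<Longrightarrow> mul A (scl A c x) y = scl A c (mul A x y)"
  and mul_scl_right: "x \<in> carr A \<Longrightarrow> y \<in> carr A \<Longrightarrow> mul A x (scl A c y) = scl A c (mul A x y)"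
  using alg unfolding is_algebra_def by blast+

lemma left_mul_op: "a \<in> carr A \<Longrightarrow> additive_op (carr A) (mul A a)"
  by unfold_locales (simp_all add: mul_carr mul_add_right)

lemma right_mul_op: "a \<in> carr A \<Longrightarrow> additive_op (carr A) (\<lambda>x. mul A x a)"
  by unfold_locales (simp_all add: mul_carr mul_add_left)

lemma mul_zero_left: "a \<in> carr A \<Longrightarrow> mul A 0 a = 0"
  using additive_op.op_zero[OF right_mul_op] .

lemma mul_zero_right: "a \<in> carr A \<Longrightarrow> mul A a 0 = 0"
  using additive_op.op_zero[OF left_mul_op] .

lemma scl_sg: "scl A c (sg b x) = sg b (scl A c x)"
  by (simp add: sg_def)

lemma is_algebra_op: "is_algebra (op_alg A)"
  using alg unfolding is_algebra_def op_alg_def by simp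

lemma free_lmod_carr: "mcarr (free_lmod A I) = pm_set I (carr A)"
  by (simp add: free_lmod_def pm_set_def)

lemma lookup_free_act:
  "a \<in> carr A \<Longrightarrow> lookup (act (free_lmod A I) a v) i = mul A a (lookup v i)"
  by (simp add: free_lmod_def lookup_map_zero mul_zero_right)

lemma is_lmod_free: "is_lmod A (free_lmod A I)"
proof -
  interpret V: additive_group "pm_set I (carr A)"
    by (rule additive_group_pm_set) (rule carr.additive_group_axioms)
  note L = pm_set_lookup[of _ I "carr A"]
  have act: "act (free_lmod A I) a = Poly_Mapping.map (mul A a)" for a
    by (simp add: free_lmod_def)
  have "act (free_lmod A I) a v \<in> pm_set I (carr A)" if "a \<in> carr A" "v \<in> pm_set I (carr A)" for a v
    unfolding act using additive_op.op_W[OF additive_op_pm_set[OF left_mul_op]] that by blast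
  then show ?thesis
    unfolding is_lmod_def free_lmod_carr
    by (auto simp: V.zero_W V.diff_W lookup_free_act lookup_add L mul_add_left mul_add_right
        mul_assoc mul_carr carr.add_W unit_carr unit_left intro!: poly_mapping_eqI)
qed

end

lemma pm_sum_single:
  fixes v :: "'i \<Rightarrow>\<^sub>0 'b::comm_monoid_add"
  shows "v = (\<Sum>i\<in>keys v. single i (lookup v i))"
proof (rule poly_mapping_eqI)
  fix k
  show "lookup v k = lookup
      (\<Sum>i\<in>keys v. single i (lookup v i)) k"
    by (simp add: lookup_sum lookup_single when_def in_keys_iff)
qed

definition pm_push :: "('i \<Rightarrow> 'j) \<Rightarrow> ('i \<Rightarrow>\<^sub>0 'b::comm_monoid_add) \<Rightarrow> ('j \<Rightarrow>\<^sub>0 'b)" where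
  "pm_push g v = (\<Sum>i\<in>keys v. single (g i) (lookup v i))"

lemma lookup_pm_push:
  assumes "inj g"
  shows "lookup (pm_push g v) j =
    (if j \<in> range g then lookup v (inv g j) else 0)"
proof (cases "j \<in> range g")
  case True
  then obtain i where j: "j = g i" by blast
  have "lookup (pm_push g v) j = (\<Sum>k\<in>keys v. lookup v k when k = i)"
    unfolding pm_push_def lookup_sum lookup_single j using assms by (simp add: inj_eq)
  also have "\<dots> = lookup v i"
    by (simp add: when_def in_keys_iff)
  finally show ?thesis using assms j by simp
next
  case False
  then have "lookup (pm_push g v) j = 0"
    unfolding pm_push_def lookup_sum lookup_single by (intro sum.neutral) auto
  then show ?thesis using False by simp
qed

lemma lookup_pm_push_app [simp]:
  "inj g \<Longrightarrow> lookup (pm_push g v) (g i) = lookup v i"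
  by (simp add: lookup_pm_push)

context algebra_carrier
begin

text \<open>\<open>projective\<close> asks for a free module on a subset of the type of the module
  itself, so the index set is replaced by the set of basis vectors \<open>single i (unit A)\<close>;
  they are distinct because \<open>unit A \<noteq> 0\<close>.\<close>

lemma projective_free:
  fixes I :: "'i set"
  assumes unit: "unit A \<noteq> 0"
  shows "projective A (free_lmod A I)"
proof -
  define g :: "'i \<Rightarrow> 'i \<Rightarrow>\<^sub>0 'a" where "g i = single i (unit A)" for i
  have inj: "inj g"
    unfolding inj_def g_def using unit by (metis lookup_single_eq lookup_single_not_eq)
  have look: "lookup (Poly_Mapping.map_key g w) i = lookup w (g i)" for w :: "('i \<Rightarrow>\<^sub>0 'a) \<Rightarrow>\<^sub>0 'a" and i
    using inj by (simp add: map_key.rep_eq)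
  have push: "pm_push g v \<in> pm_set (g ` I) (carr A)" if "v \<in> pm_set I (carr A)" for v
    using that inj by (fastforce simp: pm_set_def lookup_pm_push in_keys_iff carr.zero_W split: if_splits)
  have pull: "Poly_Mapping.map_key g w \<in> pm_set I (carr A)" if "w \<in> pm_set (g ` I) (carr A)" for w
    using that inj by (fastforce simp: pm_set_def look in_keys_iff inj_eq)
  show ?thesis
    unfolding projective_def
  proof (intro conjI exI)
    show "is_lmod A (free_lmod A I)" by (rule is_lmod_free)
    show "is_hom A (free_lmod A I) (free_lmod A (g ` I)) (pm_push g)"
      unfolding is_hom_def free_lmod_carr using push inj
      by (auto simp: lookup_pm_push lookup_add lookup_free_act mul_zero_right intro!: poly_mapping_eqI)
    show "is_hom A (free_lmod A (g ` I)) (free_lmod A I) (Poly_Mapping.map_key g)"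
      unfolding is_hom_def free_lmod_carr using pull
      by (auto simp: look lookup_add lookup_free_act intro!: poly_mapping_eqI)
    show "\<forall>x\<in>mcarr (free_lmod A I). Poly_Mapping.map_key g (pm_push g x) = x"
      using inj by (auto simp: look intro!: poly_mapping_eqI)
  qed
qed

end


lemma additive_expand:
  fixes f :: "('i \<Rightarrow>\<^sub>0 'w::ab_group_add) \<Rightarrow> 'v::ab_group_add"
  assumes W: "additive_group W"
    and add: "\<And>v w. v \<in> pm_set I W \<Longrightarrow> w \<in> pm_set I W \<Longrightarrow> f (v + w) = f v + f w"
    and v: "v \<in> pm_set I W"
  shows "f v = (\<Sum>i\<in>keys v. f (single i (lookup v i)))"
proof -
  interpret W: additive_group W by (rule W)
  interpret V: additive_group "pm_set I W" by (rule additive_group_pm_set[OF W])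
  have f0: "f 0 = 0" using add[OF V.zero_W V.zero_W] by simp
  have single: "single i (lookup v i) \<in> pm_set I W" if "i \<in> keys v" for i
    using v that by (auto simp: pm_set_def lookup_single when_def W.zero_W)
  have "f (\<Sum>i\<in>S. single i (lookup v i))
      = (\<Sum>i\<in>S. f (single i (lookup v i)))"
    if "finite S" "S \<subseteq> keys v" for S
    using that
  proof (induction S)
    case empty
    then show ?case by (simp add: f0)
  next
    case (insert i S)
    have "(\<Sum>i\<in>S. single i (lookup v i)) \<in> pm_set I W"
      using insert.prems single by (intro V.sum_W) auto
    then show ?case
      using insert single[of i] by (simp add: add)
  qed
  from this[of "keys v"] show ?thesis
    by (simp flip: pm_sum_single)
qed

lemma single_pm_set: "i \<in> I \<Longrightarrow> a \<in> W \<Longrightarrow> 0 \<in> W \<Longrightarrow> single i a \<in> pm_set I W"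
  by (auto simp: pm_set_def lookup_single when_def)

lemma additive_eqI:
  fixes f g :: "('i \<Rightarrow>\<^sub>0 'w::ab_group_add) \<Rightarrow> 'v::ab_group_add"
  assumes W: "additive_group W"
    and f: "\<And>v w. v \<in> pm_set I W \<Longrightarrow> w \<in> pm_set I W \<Longrightarrow> f (v + w) = f v + f w"
    and g: "\<And>v w. v \<in> pm_set I W \<Longrightarrow> w \<in> pm_set I W \<Longrightarrow> g (v + w) = g v + g w"
    and eq: "\<And>i a. i \<in> I \<Longrightarrow> a \<in> W \<Longrightarrow> f (single i a) = g (single i a)"
    and v: "v \<in> pm_set I W"
  shows "f v = g v"
proof -
  have "f v = (\<Sum>i\<in>keys v. f (single i (lookup v i)))"
    by (rule additive_expand[OF W f v])
  also have "\<dots> = (\<Sum>i\<in>keys v. g (single i (lookup v i)))"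
    using v by (intro sum.cong HOL.refl eq) (auto simp: pm_set_def)
  also have "\<dots> = g v"
    by (rule additive_expand[OF W g v, symmetric])
  finally show ?thesis .
qed

section \<open>Modules as vector spaces over the ground field\<close>

locale lmodule = algebra_carrier A for A :: "('k::field, 'a::ab_group_add) galg" +
  fixes M :: "('a, 'm::ab_group_add, 'z) lmod_scheme"
  assumes lmod: "is_lmod A M"
begin

sublocale M: additive_group "mcarr M"
  using lmod unfolding is_lmod_def by unfold_locales blast+

lemma act_M: "a \<in> carr A \<Longrightarrow> x \<in> mcarr M \<Longrightarrow> act M a x \<in> mcarr M"
  and act_add: "a \<in> carr A \<Longrightarrow> x \<in> mcarr M \<Longrightarrow> y \<in> mcarr M \<Longrightarrow> act M a (x + y) = act M a x + act M a y"
  and act_add_left: "a \<in> carr A \<Longrightarrow> b \<in> carr A \<Longrightarrow> x \<in> mcarr M \<Longrightarrow> act M (a + b) x = act M a x + act M b x"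
  and act_mul: "a \<in> carr A \<Longrightarrow> b \<in> carr A \<Longrightarrow> x \<in> mcarr M \<Longrightarrow> act M (mul A a b) x = act M a (act M b x)"
  and act_unit: "x \<in> mcarr M \<Longrightarrow> act M (unit A) x = x"
  using lmod unfolding is_lmod_def by blast+

lemma act_op: "a \<in> carr A \<Longrightarrow> additive_op (mcarr M) (act M a)"
  by unfold_locales (simp_all add: act_M act_add)

lemma act_zero_left: "x \<in> mcarr M \<Longrightarrow> act M 0 x = 0"
  using act_add_left[of 0 0 x] carr.zero_W by simp

lemma act_zero: "a \<in> carr A \<Longrightarrow> act M a 0 = 0"
  by (rule additive_op.op_zero[OF act_op])

lemma act_uminus_left: "a \<in> carr A \<Longrightarrow> x \<in> mcarr M \<Longrightarrow> act M (- a) x = - act M a x"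
  using act_add_left[of a "- a" x] act_zero_left[of x] carr.uminus_W[of a]
  by (simp add: eq_neg_iff_add_eq_0 add.commute)

lemma act_sg_left: "a \<in> carr A \<Longrightarrow> x \<in> mcarr M \<Longrightarrow> act M (sg b a) x = sg b (act M a x)"
  by (simp add: sg_def act_uminus_left)

text \<open>Module records carry no scalars; the field acts through the multiples of the
  unit.\<close>

definition ks :: "'k \<Rightarrow> 'm \<Rightarrow> 'm" where
  "ks c x = act M (scl A c (unit A)) x"

lemma ks_M: "x \<in> mcarr M \<Longrightarrow> ks c x \<in> mcarr M"
  by (simp add: ks_def act_M scl_carr unit_carr)

lemma ks_add: "x \<in> mcarr M \<Longrightarrow> y \<in> mcarr M \<Longrightarrow> ks c (x + y) = ks c x + ks c y"
  by (simp add: ks_def act_add scl_carr unit_carr)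

lemma ks_op: "additive_op (mcarr M) (ks c)"
  by unfold_locales (simp_all add: ks_M ks_add)

lemma ks_add_left: "x \<in> mcarr M \<Longrightarrow> ks (c + d) x = ks c x + ks d x"
  by (simp add: ks_def act_add_left scl_carr unit_carr vs.scale_left_distrib)

lemma ks_zero_left: "x \<in> mcarr M \<Longrightarrow> ks 0 x = 0"
  by (simp add: ks_def act_zero_left)

lemma ks_one: "x \<in> mcarr M \<Longrightarrow> ks 1 x = x"
  by (simp add: ks_def act_unit)

lemma act_scl: "a \<in> carr A \<Longrightarrow> x \<in> mcarr M \<Longrightarrow> act M (scl A c a) x = ks c (act M a x)"
proof -
  assume "a \<in> carr A" "x \<in> mcarr M"
  moreover from this have "scl A c a = mul A (scl A c (unit A)) a"
    by (simp add: mul_scl_left unit_carr unit_left)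
  ultimately show ?thesis by (simp add: ks_def act_mul scl_carr unit_carr)
qed

lemma act_ks: "a \<in> carr A \<Longrightarrow> x \<in> mcarr M \<Longrightarrow> act M a (ks c x) = ks c (act M a x)"
proof -
  assume "a \<in> carr A" "x \<in> mcarr M"
  moreover from this have "scl A c a = mul A a (scl A c (unit A))"
    by (simp add: mul_scl_right unit_carr unit_right)
  ultimately have "act M (scl A c a) x = act M a (ks c x)"
    by (simp add: ks_def act_mul scl_carr unit_carr)
  then show ?thesis using act_scl \<open>a \<in> carr A\<close> \<open>x \<in> mcarr M\<close> by simp
qed

lemma ks_mult: "x \<in> mcarr M \<Longrightarrow> ks (c * d) x = ks c (ks d x)"
  using act_scl[of "scl A d (unit A)" x c] by (simp add: ks_def scl_carr unit_carr)

end

text \<open>\<open>B\<close> is a basis over the ground field and \<open>chi x\<close> the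
  coordinate vector of \<open>x\<close>. A basis makes \<open>A \<otimes> M\<close> a free
  \<open>A\<close>-module whose index set lies inside the type of \<open>M\<close>.\<close>

locale lmodule_basis = lmodule A M
  for A :: "('k::field, 'a::ab_group_add) galg" and M :: "('a, 'm::ab_group_add, 'z) lmod_scheme" +
  fixes B :: "'m set" and chi :: "'m \<Rightarrow> 'm \<Rightarrow>\<^sub>0 'k"
  assumes B_M: "B \<subseteq> mcarr M"
    and chi_keys: "x \<in> mcarr M \<Longrightarrow> keys (chi x) \<subseteq> B"
    and chi_add: "x \<in> mcarr M \<Longrightarrow> y \<in> mcarr M \<Longrightarrow> chi (x + y) = chi x + chi y"
    and chi_ks: "x \<in> mcarr M \<Longrightarrow> lookup (chi (ks c x)) b = c * lookup (chi x) b"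
    and chi_basis: "b \<in> B \<Longrightarrow> chi b = single b 1"
    and chi_expand: "x \<in> mcarr M \<Longrightarrow>
      x = (\<Sum>b\<in>keys (chi x). ks (lookup (chi x) b) b)"

definition pm_scale :: "'k::field \<Rightarrow> ('m \<Rightarrow>\<^sub>0 'k) \<Rightarrow> ('m \<Rightarrow>\<^sub>0 'k)" where
  "pm_scale c = Poly_Mapping.map ((*) c)"

lemma lookup_pm_scale [simp]: "lookup (pm_scale c v) i = c * lookup v i"
  by (simp add: pm_scale_def lookup_map_zero)

lemma vector_space_pm_scale: "vector_space (pm_scale :: 'k::field \<Rightarrow> ('m \<Rightarrow>\<^sub>0 'k) \<Rightarrow> _)"
  by standard (auto intro!: poly_mapping_eqI simp: lookup_add algebra_simps)

context lmodule
begin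

text \<open>
  The module is only a subset of its type, which need not be a vector space; so the basis is found
  inside the vector space freely generated by all elements of the type.
\<close>

lemma basis_exists: "\<exists>B chi. lmodule_basis A M B chi"
proof -
  interpret F: vector_space "pm_scale :: 'k \<Rightarrow> ('m \<Rightarrow>\<^sub>0 'k) \<Rightarrow> _" by (rule vector_space_pm_scale)
  define V where "V = pm_set (mcarr M) (UNIV :: 'k set)"
  have UNIV: "additive_group (UNIV :: 'k set)" by unfold_locales auto
  interpret V: additive_group V unfolding V_def by (rule additive_group_pm_set[OF UNIV])
  define ev where "ev v = (\<Sum>x\<in>keys v. ks (lookup v x) x)" for v :: "'m \<Rightarrow>\<^sub>0 'k"
  have V_M: "x \<in> mcarr M" if "v \<in> V" "x \<in> keys v" for v x
    using that by (auto simp: V_def pm_set_def)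
  have ev_super: "ev v = (\<Sum>x\<in>S. ks (lookup v x) x)"
    if "finite S" "keys v \<subseteq> S" "S \<subseteq> mcarr M" for v S
    unfolding ev_def using that
    by (intro sum.mono_neutral_left) (auto simp: in_keys_iff subset_iff ks_zero_left)
  have ev_M: "ev v \<in> mcarr M" if "v \<in> V" for v
    unfolding ev_def using that by (intro M.sum_W ks_M V_M)
  have ev_add: "ev (v + w) = ev v + ev w" if "v \<in> V" "w \<in> V" for v w
  proof -
    let ?S = "keys v \<union> keys w"
    have S: "finite ?S" "?S \<subseteq> mcarr M" using that V_M by auto
    have "ev (v + w) = (\<Sum>x\<in>?S. ks (lookup (v + w) x) x)"
      using S by (intro ev_super) (auto dest: subsetD[OF Poly_Mapping.keys_add])
    also have "\<dots> = (\<Sum>x\<in>?S. ks (lookup v x) x) + (\<Sum>x\<in>?S. ks (lookup w x) x)"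
      unfolding sum.distrib[symmetric] using S by (intro sum.cong) (auto simp: lookup_add ks_add_left)
    also have "\<dots> = ev v + ev w" using S ev_super[of ?S v] ev_super[of ?S w] by simp
    finally show ?thesis .
  qed
  have V_scale: "pm_scale c v \<in> V" if "v \<in> V" for c v
    using that by (auto simp: V_def pm_set_def in_keys_iff)
  have ev_scale: "ev (pm_scale c v) = ks c (ev v)" if "v \<in> V" for c v
  proof -
    have "ev (pm_scale c v) = (\<Sum>x\<in>keys v. ks (lookup (pm_scale c v) x) x)"
      using that V_M by (intro ev_super) (auto simp: in_keys_iff)
    also have "\<dots> = (\<Sum>x\<in>keys v. ks c (ks (lookup v x) x))"
      using that V_M by (intro sum.cong) (auto simp: ks_mult)
    also have "\<dots> = ks c (ev v)"
      unfolding ev_def using that V_M by (intro additive_op.op_sum[OF ks_op, symmetric] ks_M)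
    finally show ?thesis .
  qed
  define e where "e x = single x (1::'k)" for x :: 'm
  have e_V: "e x \<in> V" if "x \<in> mcarr M" for x
    using that unfolding e_def V_def by (intro single_pm_set) auto
  have ev_e: "ev (e x) = x" if "x \<in> mcarr M" for x
    using that by (simp add: ev_def e_def ks_one)
  have e_inj: "e x = e x' \<longleftrightarrow> x = x'" for x x'
    unfolding e_def by (metis lookup_single_eq lookup_single_not_eq zero_neq_one)
  define N where "N = {v \<in> V. ev v = 0}"
  have N: "F.subspace N"
    using V.zero_W V.add_W ev_add V_scale ev_scale additive_op.op_zero[OF ks_op]
    by (auto simp: N_def F.subspace_def ev_def)
  \<comment> \<open>The quotient \<open>V / N\<close> is the module. A basis \<open>C\<close> of
    \<open>N\<close> is extended to \<open>D\<close> by vectors \<open>e x\<close>, so the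
    \<open>x\<close> with \<open>e x \<in> D - C\<close> form a basis of the module.\<close>
  obtain C where C: "C \<subseteq> N" "F.independent C" "N \<subseteq> F.span C"
    using F.maximal_independent_subset[of N] by blast
  obtain D where D: "C \<subseteq> D" "D \<subseteq> C \<union> e ` mcarr M" "F.independent D" "C \<union> e ` mcarr M \<subseteq> F.span D"
    using F.maximal_independent_subset_extend[of C "C \<union> e ` mcarr M"] C(2) by blast
  define B where "B = {x \<in> mcarr M. e x \<in> D - C}"
  define chi where "chi x = Poly_Mapping.map_key e
      (Abs_poly_mapping (\<lambda>d. if d \<in> D - C then F.representation D (e x) d else 0))" for x
  have injE: "inj e" by (simp add: inj_def e_inj)
  have look: "lookup (chi x) b = (if e b \<in> D - C then F.representation D (e x) (e b) else 0)" for x b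
  proof -
    have "finite {d. (if d \<in> D - C then F.representation D (e x) d else 0) \<noteq> 0}"
      by (rule finite_subset[OF _ F.finite_representation[of D "e x"]]) (auto split: if_splits)
    then show ?thesis
      using injE by (simp add: chi_def map_key.rep_eq Abs_poly_mapping_inverse)
  qed
  have DV: "D \<subseteq> V" using D(2) C(1) e_V by (auto simp: N_def)
  have eD: "e x \<in> F.span D" if "x \<in> mcarr M" for x using D(4) that by auto
  \<comment> \<open>Coordinates along \<open>D - C\<close> vanish on \<open>N\<close>; hence they
    are linear on the module although \<open>e\<close> is not additive.\<close>
  have rep_N: "F.representation D v d = 0" if "v \<in> N" "d \<notin> C" for v d
  proof -
    have "F.representation D v = F.representation C v"
      using F.representation_extend[OF D(3) _ D(1)] C(3) that by blast
    then show ?thesis using F.representation_ne_zero[of C v d] that by auto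
  qed
  have key_B: "b \<in> B" if "lookup (chi x) b \<noteq> 0" for x b
  proof -
    have eb: "e b \<in> D - C" using that by (simp add: look split: if_splits)
    then obtain x' where "x' \<in> mcarr M" "e b = e x'" using D(2) by blast
    then show ?thesis using eb by (simp add: e_inj B_def)
  qed
  have "lmodule_basis A M B chi"
  proof
    show "B \<subseteq> mcarr M" by (auto simp: B_def)
    show "keys (chi x) \<subseteq> B" for x
      using key_B by (auto simp: in_keys_iff)
    show "chi b = single b 1" if "b \<in> B" for b
    proof (rule poly_mapping_eqI)
      fix c
      have "e b \<in> D" using that by (simp add: B_def)
      then have "F.representation D (e b) = (\<lambda>v. if v = e b then 1 else 0)"
        by (rule F.representation_basis[OF D(3)])
      then show "lookup (chi b) c = lookup (single b 1) c"
        using that by (auto simp: look lookup_single when_def e_inj B_def)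
    qed
  next
    fix x y assume xy: "x \<in> mcarr M" "y \<in> mcarr M"
    have "e (x + y) - (e x + e y) \<in> N"
      using xy e_V M.add_W V.diff_W V.add_W ev_add[of "e (x + y) - (e x + e y)" "e x + e y"]
        ev_add[of "e x" "e y"] by (auto simp: N_def ev_e)
    moreover have "F.representation D (e (x + y)) d = F.representation D (e (x + y) - (e x + e y)) d
        + (F.representation D (e x) d + F.representation D (e y) d)" for d
      using xy eD M.add_W by (simp add: F.representation_diff F.representation_add D(3) F.span_add)
    ultimately show "chi (x + y) = chi x + chi y"
      by (intro poly_mapping_eqI) (auto simp: look lookup_add rep_N)
  next
    fix x c b assume x: "x \<in> mcarr M"
    have "e (ks c x) - pm_scale c (e x) \<in> N"
      using x e_V ks_M V.diff_W V_scale ev_add[of "e (ks c x) - pm_scale c (e x)" "pm_scale c (e x)"]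
      by (auto simp: N_def ev_e ev_scale)
    moreover have "F.representation D (e (ks c x)) d = F.representation D (e (ks c x) - pm_scale c (e x)) d
        + c * F.representation D (e x) d" for d
      using x eD ks_M by (simp add: F.representation_diff F.representation_scale D(3) F.span_scale)
    ultimately show "lookup (chi (ks c x)) b = c * lookup (chi x) b"
      by (auto simp: look rep_N)
  next
    fix x assume x: "x \<in> mcarr M"
    let ?r = "F.representation D (e x)"
    define P where "P = {d. ?r d \<noteq> 0}"
    have P: "finite P" "P \<subseteq> D"
      using F.finite_representation F.representation_ne_zero by (auto simp: P_def)
    have "e x = (\<Sum>d\<in>P. pm_scale (?r d) d)"
      using F.sum_nonzero_representation_eq[OF D(3) eD[OF x]] by (simp add: P_def)
    then have "x = ev (\<Sum>d\<in>P. pm_scale (?r d) d)" using ev_e[OF x] by simp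
    also have "\<dots> = (\<Sum>d\<in>P. ev (pm_scale (?r d) d))"
    proof -
      have "(\<Sum>d\<in>S. pm_scale (?r d) d) \<in> V \<and>
          ev (\<Sum>d\<in>S. pm_scale (?r d) d) = (\<Sum>d\<in>S. ev (pm_scale (?r d) d))"
        if "finite S" "S \<subseteq> P" for S
        using that
      proof (induction S)
        case empty
        then show ?case using V.zero_W by (simp add: ev_def)
      next
        case (insert d S)
        then have "pm_scale (?r d) d \<in> V" using P DV V_scale by blast
        then show ?case using insert by (simp add: ev_add V.add_W)
      qed
      then show ?thesis using P(1) by blast
    qed
    also have "\<dots> = (\<Sum>d\<in>P. ks (?r d) (ev d))"
      using P DV by (intro sum.cong) (auto simp: ev_scale)
    also have "\<dots> = (\<Sum>d\<in>P - C. ks (?r d) (ev d))"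
      using C(1) P(1) by (intro sum.mono_neutral_right) (auto simp: N_def additive_op.op_zero[OF ks_op])
    also have "P - C = e ` keys (chi x)"
    proof
      show "P - C \<subseteq> e ` keys (chi x)"
      proof
        fix d assume d: "d \<in> P - C"
        then obtain b where "d = e b" using P(2) D(2) by blast
        then show "d \<in> e ` keys (chi x)"
          using d P(2) by (auto simp: in_keys_iff look P_def)
      qed
      show "e ` keys (chi x) \<subseteq> P - C"
        by (auto simp: in_keys_iff look P_def split: if_splits)
    qed
    also have "(\<Sum>d\<in>e ` keys (chi x). ks (?r d) (ev d))
        = (\<Sum>b\<in>keys (chi x). ks (?r (e b)) (ev (e b)))"
      using injE by (subst sum.reindex) (auto simp: inj_def inj_on_def)
    also have "\<dots> = (\<Sum>b\<in>keys (chi x). ks (lookup (chi x) b) b)"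
      using key_B by (intro sum.cong) (auto simp: in_keys_iff look ev_e B_def split: if_splits)
    finally show "x = (\<Sum>b\<in>keys (chi x). ks (lookup (chi x) b) b)" .
  qed
  then show ?thesis by blast
qed

end

section \<open>Skew polynomial algebras in coordinates\<close>

definition mdeg :: "(idx \<Rightarrow> nat) \<Rightarrow> nat" where
  "mdeg \<beta> = (\<Sum>j\<in>UNIV. \<beta> j)"

definition inc :: "idx \<Rightarrow> (idx \<Rightarrow> nat) \<Rightarrow> idx \<Rightarrow> nat" where
  "inc j \<beta> = \<beta>(j := Suc (\<beta> j))"

definition dec :: "idx \<Rightarrow> (idx \<Rightarrow> nat) \<Rightarrow> idx \<Rightarrow> nat" where
  "dec j \<beta> = \<beta>(j := \<beta> j - 1)"

lemma dec_inc [simp]: "dec j (inc j \<beta>) = \<beta>"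
  and inc_dec [simp]: "\<beta> j \<noteq> 0 \<Longrightarrow> inc j (dec j \<beta>) = \<beta>"
  and inc_app [simp]: "inc j \<beta> i = (if i = j then Suc (\<beta> j) else \<beta> i)"
  and dec_app [simp]: "dec j \<beta> i = (if i = j then \<beta> j - 1 else \<beta> i)"
  by (auto simp: inc_def dec_def fun_eq_iff)

lemma inc_inj [simp]: "inc j \<beta> = inc j \<gamma> \<longleftrightarrow> \<beta> = \<gamma>"
  by (metis dec_inc)

lemma inc_commute: "inc i (inc j \<beta>) = inc j (inc i \<beta>)"
  by (rule ext) auto

lemma dec_inc_commute: "i \<noteq> j \<Longrightarrow> dec i (inc j \<beta>) = inc j (dec i \<beta>)"
  by (auto simp: fun_eq_iff)

lemma mdeg_inc [simp]: "mdeg (inc j \<beta>) = Suc (mdeg \<beta>)"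
proof -
  have "mdeg (inc j \<beta>) = (\<Sum>i\<in>UNIV. \<beta> i + (if i = j then 1 else 0))"
    unfolding mdeg_def by (rule sum.cong) auto
  then show ?thesis by (simp add: sum.distrib mdeg_def)
qed

lemma mdeg_dec: "\<beta> j \<noteq> 0 \<Longrightarrow> mdeg \<beta> = Suc (mdeg (dec j \<beta>))"
  using mdeg_inc[of j "dec j \<beta>"] by simp

lemma mdeg_eq_0_iff: "mdeg \<beta> = 0 \<longleftrightarrow> \<beta> = 0"
  by (auto simp: mdeg_def fun_eq_iff zero_fun_def)

lemma mdeg_zero [simp]: "mdeg 0 = 0"
  by (simp add: mdeg_eq_0_iff)

lemma mdeg_less_subset: "{\<beta>. mdeg \<beta> < n} \<subseteq> UNIV \<rightarrow>\<^sub>E {..<n}"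
proof
  fix \<beta> assume "\<beta> \<in> {\<beta>. mdeg \<beta> < n}"
  moreover have "\<beta> j \<le> mdeg \<beta>" for j unfolding mdeg_def by (rule member_le_sum) auto
  ultimately show "\<beta> \<in> UNIV \<rightarrow>\<^sub>E {..<n}" by (auto intro: order_le_less_trans)
qed

lemma finite_mdeg_less: "finite {\<beta>. mdeg \<beta> < n}"
  by (rule finite_subset[OF mdeg_less_subset]) (intro finite_PiE, auto)

lemma card_mdeg_less: "card {\<beta>. mdeg \<beta> < n} \<le> n ^ 4"
proof -
  have "card {\<beta>. mdeg \<beta> < n} \<le> card (UNIV \<rightarrow>\<^sub>E {..<n} :: (idx \<Rightarrow> nat) set)"
    by (rule card_mono[OF _ mdeg_less_subset]) (intro finite_PiE, auto)
  also have "\<dots> = n ^ 4"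
  proof -
    have "card (UNIV :: idx set) = 4" by (simp add: UNIV_idx)
    then show ?thesis by (simp add: card_PiE)
  qed
  finally show ?thesis .
qed

lemma idx_pos_less_iff: "idx_pos s < idx_pos t \<longleftrightarrow> s < t"
  by (simp add: less_idx_def)

lemma idx_pos_eq_iff: "idx_pos s = idx_pos t \<longleftrightarrow> s = t"
  by (cases s; cases t) simp_all

lemma idx_pos_range: "1 \<le> idx_pos s" "idx_pos s < 5"
  by (cases s; simp)+

text \<open>
  \<open>co u \<beta>\<close> is the coefficient of the monomial \<open>y\<^sup>\<beta>\<close> in \<open>u\<close>, and \<open>lam j \<beta>\<close>, \<open>rho j \<beta>\<close> tell whether
  \<open>y\<^sub>j y\<^sup>\<beta>\<close>, \<open>y\<^sup>\<beta> y\<^sub>j\<close> are minus a monomial.  The variables have degree 2.  Exchanging \<open>lam\<close> and \<open>rho\<close>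
  passes to the opposite algebra.
\<close>

locale skew_coords = algebra_carrier A for A :: "('k::field, 'a::ab_group_add) galg" +
  fixes y :: "idx \<Rightarrow> 'a" and eps :: "idx \<Rightarrow> idx \<Rightarrow> bool"
    and lam rho :: "idx \<Rightarrow> (idx \<Rightarrow> nat) \<Rightarrow> bool"
    and co :: "'a \<Rightarrow> (idx \<Rightarrow> nat) \<Rightarrow> 'k"
  assumes y_carr: "y j \<in> carr A"
    and eps_sym: "eps i j = eps j i"
    and y_comm: "mul A (y i) (y j) = sg (eps i j) (mul A (y j) (y i))"
    and lam_comm: "i \<noteq> j \<Longrightarrow>
      (lam i (inc j \<beta>) \<noteq> lam j \<beta>) = ((lam j (inc i \<beta>) \<noteq> lam i \<beta>) \<noteq> eps i j)"
    and rho_comm: "i \<noteq> j \<Longrightarrow>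
      (rho i (inc j \<beta>) \<noteq> rho j \<beta>) = ((rho j (inc i \<beta>) \<noteq> rho i \<beta>) \<noteq> eps i j)"
    and co_add: "u \<in> carr A \<Longrightarrow> v \<in> carr A \<Longrightarrow> co (u + v) \<beta> = co u \<beta> + co v \<beta>"
    and co_scl: "u \<in> carr A \<Longrightarrow> co (scl A c u) \<beta> = c * co u \<beta>"
    and co_inj: "u \<in> carr A \<Longrightarrow> (\<And>\<beta>. co u \<beta> = 0) \<Longrightarrow> u = 0"
    and co_fin: "u \<in> carr A \<Longrightarrow> finite {\<beta>. co u \<beta> \<noteq> 0}"
    and co_surj: "finite {\<beta>. f \<beta> \<noteq> 0} \<Longrightarrow> \<exists>u\<in>carr A. co u = f"
    and co_unit: "co (unit A) \<beta> = (if \<beta> = 0 then 1 else 0)"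
    and co_left: "u \<in> carr A \<Longrightarrow>
      co (mul A (y j) u) \<beta> = (if \<beta> j = 0 then 0 else sg (lam j (dec j \<beta>)) (co u (dec j \<beta>)))"
    and co_right: "u \<in> carr A \<Longrightarrow>
      co (mul A u (y j)) \<beta> = (if \<beta> j = 0 then 0 else sg (rho j (dec j \<beta>)) (co u (dec j \<beta>)))"
    and piece_eq: "piece A n = {u \<in> carr A. \<forall>\<beta>. co u \<beta> \<noteq> 0 \<longrightarrow> 2 * mdeg \<beta> = n}"
begin

lemma skew_coords_op: "skew_coords (op_alg A) y eps rho lam co"
proof -
  interpret op: algebra_carrier "op_alg A"
    by (rule algebra_carrier.intro) (rule is_algebra_op)
  have [simp]: "carr (op_alg A) = carr A" "mul (op_alg A) = (\<lambda>u v. mul A v u)" "scl (op_alg A) = scl A"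
    "unit (op_alg A) = unit A" "piece (op_alg A) = piece A"
    by (simp_all add: op_alg_def)
  show ?thesis
  proof unfold_locales
    show "mul (op_alg A) (y i) (y j) = sg (eps i j) (mul (op_alg A) (y j) (y i))" for i j
      using y_comm[of j i] eps_sym[of i j] by simp
    show "(rho i (inc j \<beta>) \<noteq> rho j \<beta>) = ((rho j (inc i \<beta>) \<noteq> rho i \<beta>) \<noteq> eps i j)"
      "(lam i (inc j \<beta>) \<noteq> lam j \<beta>) = ((lam j (inc i \<beta>) \<noteq> lam i \<beta>) \<noteq> eps i j)" if "i \<noteq> j" for i j \<beta>
      using that by (fact rho_comm, fact lam_comm)
    show "eps i j = eps j i" for i j by (rule eps_sym)
  qed (simp_all add: y_carr co_add co_scl co_inj co_fin co_surj[simplified]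
      co_unit co_left co_right piece_eq)
qed

lemma co_zero [simp]: "co 0 \<beta> = 0"
  using co_add[OF carr.zero_W carr.zero_W, of \<beta>] by (metis add.right_neutral add_left_cancel)

lemma co_uminus: "u \<in> carr A \<Longrightarrow> co (- u) \<beta> = - co u \<beta>"
  using co_add[of u "- u" \<beta>] carr.uminus_W[of u] by (simp add: eq_neg_iff_add_eq_0 add.commute)

lemma co_diff: "u \<in> carr A \<Longrightarrow> v \<in> carr A \<Longrightarrow> co (u - v) \<beta> = co u \<beta> - co v \<beta>"
  using co_add[of u "- v" \<beta>] carr.uminus_W[of v] by (simp add: co_uminus)

lemma co_sg: "u \<in> carr A \<Longrightarrow> co (sg b u) \<beta> = sg b (co u \<beta>)"
  by (simp add: sg_def co_uminus)

lemma co_sum: "(\<And>i. i \<in> S \<Longrightarrow> u i \<in> carr A) \<Longrightarrow> co (sum u S) \<beta> = (\<Sum>i\<in>S. co (u i) \<beta>)"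
  by (induction S rule: infinite_finite_induct) (auto simp: co_add carr.sum_W)

lemma co_eqI:
  assumes "u \<in> carr A" "v \<in> carr A" "\<And>\<beta>. co u \<beta> = co v \<beta>"
  shows "u = v"
  using co_inj[of "u - v"] assms carr.diff_W by (simp add: co_diff)

definition elt :: "((idx \<Rightarrow> nat) \<Rightarrow> 'k) \<Rightarrow> 'a" where
  "elt f = (SOME u. u \<in> carr A \<and> co u = f)"

lemma elt:
  assumes "finite {\<beta>. f \<beta> \<noteq> 0}"
  shows "elt f \<in> carr A" "co (elt f) = f"
proof -
  have "\<exists>u. u \<in> carr A \<and> co u = f" using co_surj[OF assms] by blast
  from someI_ex[OF this] show "elt f \<in> carr A" "co (elt f) = f"
    by (simp_all add: elt_def)
qed

lemma unit_nonzero: "unit A \<noteq> 0"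
  using co_unit[of 0] by auto

text \<open>Here \<open>\<beta>\<close> is the exponent of the quotient, so the dividend is read at
  \<open>inc s \<beta>\<close>; the sign cancels the one in \<open>co_right\<close>.\<close>

definition rdel :: "idx \<Rightarrow> 'a \<Rightarrow> 'a" where
  "rdel s u = elt (\<lambda>\<beta>. if \<forall>t<s. \<beta> t = 0 then sg (rho s \<beta>) (co u (inc s \<beta>)) else 0)"

definition trunc :: "nat \<Rightarrow> 'a \<Rightarrow> 'a" where
  "trunc n u = elt (\<lambda>\<beta>. if \<forall>t. idx_pos t < n \<longrightarrow> \<beta> t = 0 then co u \<beta> else 0)"

lemma rdel:
  assumes "u \<in> carr A"
  shows "rdel s u \<in> carr A"
    "co (rdel s u) \<beta> = (if \<forall>t<s. \<beta> t = 0 then sg (rho s \<beta>) (co u (inc s \<beta>)) else 0)"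
proof -
  have "finite {\<beta>. co u (inc s \<beta>) \<noteq> 0}"
    using finite_vimageI[OF co_fin[OF assms], of "inc s"] by (simp add: inj_def vimage_def)
  then have "finite {\<beta>. (if \<forall>t<s. \<beta> t = 0 then sg (rho s \<beta>) (co u (inc s \<beta>)) else 0) \<noteq> 0}"
    by (rule rev_finite_subset) auto
  from elt[OF this] show "rdel s u \<in> carr A"
    "co (rdel s u) \<beta> = (if \<forall>t<s. \<beta> t = 0 then sg (rho s \<beta>) (co u (inc s \<beta>)) else 0)"
    by (simp_all add: rdel_def)
qed

lemma trunc:
  assumes "u \<in> carr A"
  shows "trunc n u \<in> carr A"
    "co (trunc n u) \<beta> = (if \<forall>t. idx_pos t < n \<longrightarrow> \<beta> t = 0 then co u \<beta> else 0)"
proof -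
  have "finite {\<beta>. (if \<forall>t. idx_pos t < n \<longrightarrow> \<beta> t = 0 then co u \<beta> else 0) \<noteq> 0}"
    by (rule rev_finite_subset[OF co_fin[OF assms]]) auto
  from elt[OF this] show "trunc n u \<in> carr A"
    "co (trunc n u) \<beta> = (if \<forall>t. idx_pos t < n \<longrightarrow> \<beta> t = 0 then co u \<beta> else 0)"
    by (simp_all add: trunc_def)
qed

lemma trunc_5: "u \<in> carr A \<Longrightarrow> trunc 5 u = scl A (co u 0) (unit A)"
proof (rule co_eqI)
  fix \<beta> :: "idx \<Rightarrow> nat" assume "u \<in> carr A"
  moreover have "(\<forall>t. idx_pos t < 5 \<longrightarrow> \<beta> t = 0) \<longleftrightarrow> \<beta> = 0"
    using idx_pos_range(2) by (auto simp: fun_eq_iff)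
  ultimately show "co (trunc 5 u) \<beta> = co (scl A (co u 0) (unit A)) \<beta>"
    by (auto simp: trunc co_scl unit_carr co_unit)
qed (simp_all add: trunc scl_carr unit_carr)

text \<open>For \<open>j < s\<close> every monomial of the product contains the earlier variable
  \<open>j\<close>, so division by \<open>s\<close> kills it. For \<open>s < j\<close> the
  commutation rule is \<open>rho_comm\<close> at \<open>dec j \<beta>\<close>.\<close>

lemma right_koszul: "koszul (carr A) (\<lambda>j u. mul A u (y j)) rdel trunc eps"
proof
  fix j s u assume u: "u \<in> carr A"
  note [simp] = co_right rdel trunc mul_carr y_carr u carr.sg_W co_sg
  show "rdel s (mul A u (y j)) = 0" if "j < s"
    using that by (intro co_eqI) (auto simp: carr.zero_W)
  show "rdel s (mul A u (y j)) = sg (eps s j) (mul A (rdel s u) (y j))" if "s < j"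
  proof (rule co_eqI)
    fix \<beta>
    have ne: "s \<noteq> j" using that by auto
    have *: "(rho s \<beta> \<noteq> rho j (inc s (dec j \<beta>))) = (eps s j \<noteq> (rho j (dec j \<beta>) \<noteq> rho s (dec j \<beta>)))"
      if "\<beta> j \<noteq> 0"
      using rho_comm[OF ne, of "dec j \<beta>"] that by auto
    have z: "(\<forall>t<s. dec j \<beta> t = 0) \<longleftrightarrow> (\<forall>t<s. \<beta> t = 0)" using that by auto
    show "co (rdel s (mul A u (y j))) \<beta> = co (sg (eps s j) (mul A (rdel s u) (y j))) \<beta>"
      using ne * z by (auto simp add: dec_inc_commute[of j s])
  qed simp_all
  show "mul A (rdel s u) (y s) = trunc (idx_pos s) u - trunc (Suc (idx_pos s)) u"
  proof (rule co_eqI)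
    fix \<beta>
    have z: "(\<forall>t<s. dec s \<beta> t = 0) \<longleftrightarrow> (\<forall>t<s. \<beta> t = 0)" by auto
    have p: "(\<forall>t. idx_pos t < idx_pos s \<longrightarrow> \<beta> t = 0) \<longleftrightarrow> (\<forall>t<s. \<beta> t = 0)"
      "(\<forall>t. idx_pos t < Suc (idx_pos s) \<longrightarrow> \<beta> t = 0) \<longleftrightarrow> (\<forall>t<s. \<beta> t = 0) \<and> \<beta> s = 0"
      by (auto simp: less_Suc_eq idx_pos_less_iff idx_pos_eq_iff)
    show "co (mul A (rdel s u) (y s)) \<beta> = co (trunc (idx_pos s) u - trunc (Suc (idx_pos s)) u) \<beta>"
      by (auto simp add: co_diff p z)
  qed (simp_all add: carr.diff_W)
  show "rdel s (mul A u (y s)) = trunc (idx_pos s) u"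
    by (intro co_eqI) (auto simp: idx_pos_less_iff)
  show "trunc 1 u = u"
  proof (rule co_eqI)
    have "idx_pos t \<noteq> 0" for t using idx_pos_range(1)[of t] by simp
    then have "\<not> idx_pos t < 1" for t by (metis less_one)
    then show "co (trunc 1 u) \<beta> = co u \<beta>" for \<beta> by (simp only: trunc(2)[OF u] simp_thms if_True)
  qed simp_all
next
  fix j u v assume u: "u \<in> carr A" "v \<in> carr A"
  show "rdel j (u + v) = rdel j u + rdel j v"
    using u by (intro co_eqI) (auto simp: rdel co_add carr.add_W sg_add)
qed (simp_all add: carr.zero_W carr.diff_W mul_carr y_carr mul_add_left rdel eps_sym)

definition ldel :: "idx \<Rightarrow> 'a \<Rightarrow> 'a" where
  "ldel = skew_coords.rdel (op_alg A) lam co"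

text \<open>The opposite algebra is an instance with \<open>lam\<close> and \<open>rho\<close>
  exchanged; \<open>trunc\<close> refers to coordinates only and is the same for both.\<close>

lemma left_koszul: "koszul (carr A) (\<lambda>j u. mul A (y j) u) ldel trunc eps"
proof -
  interpret op: skew_coords "op_alg A" y eps rho lam co by (rule skew_coords_op)
  have [simp]: "carr (op_alg A) = carr A" "mul (op_alg A) = (\<lambda>u v. mul A v u)"
    by (simp_all add: op_alg_def)
  have "op.trunc = trunc" unfolding op.trunc_def trunc_def op.elt_def elt_def by simp
  then show ?thesis using op.right_koszul by (simp add: ldel_def)
qed

text \<open>The bound is strict so that \<open>below 0\<close> is zero, where the induction over the
  filtration starts; constants have bound 1.\<close>

definition below :: "nat \<Rightarrow> 'a set" where
  "below t = {u \<in> carr A. \<forall>\<beta>. co u \<beta> \<noteq> 0 \<longrightarrow> mdeg \<beta> < t}"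

lemma below_group: "additive_group (below t)"
proof
  fix u v assume "u \<in> below t" "v \<in> below t"
  moreover have "co u \<beta> \<noteq> 0 \<or> co v \<beta> \<noteq> 0" if "co u \<beta> - co v \<beta> \<noteq> 0" for \<beta> using that by auto
  ultimately show "u - v \<in> below t"
    by (auto simp: below_def carr.diff_W co_diff)
qed (simp add: below_def carr.zero_W)

lemma below_0: "below 0 = {0}"
  by (auto simp: below_def carr.zero_W intro: co_inj)

lemma below_mono: "s \<le> t \<Longrightarrow> below s \<subseteq> below t"
  by (auto simp: below_def)

lemma below_carr: "u \<in> below t \<Longrightarrow> u \<in> carr A"
  by (simp add: below_def)

lemma below_exists: "u \<in> carr A \<Longrightarrow> \<exists>t. u \<in> below t"
proof
  assume u: "u \<in> carr A"
  show "u \<in> below (Suc (\<Sum>\<beta> | co u \<beta> \<noteq> 0. mdeg \<beta>))"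
    using u co_fin[OF u] by (auto simp: below_def less_Suc_eq_le intro: member_le_sum)
qed

lemma below_scl: "u \<in> below t \<Longrightarrow> scl A c u \<in> below t"
  by (auto simp: below_def scl_carr co_scl)

lemma below_right: "u \<in> below t \<Longrightarrow> mul A u (y j) \<in> below (Suc t)"
  by (auto simp: below_def mul_carr y_carr co_right mdeg_dec split: if_splits)

lemma below_rdel: "u \<in> below (Suc t) \<Longrightarrow> rdel j u \<in> below t"
  by (auto simp: below_def rdel split: if_splits)

lemma unit_below: "scl A c (unit A) \<in> below 1"
  by (auto simp: below_def scl_carr unit_carr co_scl co_unit split: if_splits)

definition mon :: "(idx \<Rightarrow> nat) \<Rightarrow> 'a" where
  "mon \<alpha> = elt (\<lambda>\<beta>. if \<beta> = \<alpha> then 1 else 0)"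

lemma mon: "mon \<alpha> \<in> carr A" "co (mon \<alpha>) \<beta> = (if \<beta> = \<alpha> then 1 else 0)"
  using elt[of "\<lambda>\<beta>. if \<beta> = \<alpha> then 1 else 0"] by (simp_all add: mon_def)

lemma mon_expand: "u \<in> carr A \<Longrightarrow> u = (\<Sum>\<alpha> | co u \<alpha> \<noteq> 0. scl A (co u \<alpha>) (mon \<alpha>))"
proof (rule co_eqI)
  fix \<beta> assume u: "u \<in> carr A"
  have "co (\<Sum>\<alpha> | co u \<alpha> \<noteq> 0. scl A (co u \<alpha>) (mon \<alpha>)) \<beta> = (\<Sum>\<alpha> | co u \<alpha> \<noteq> 0. co u \<alpha> * (if \<beta> = \<alpha> then 1 else 0))"
    by (simp add: co_sum scl_carr mon co_scl)
  also have "\<dots> = co u \<beta>"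
    using co_fin[OF u] by (simp add: if_distrib[of "(*) _"] sum.delta cong: if_cong)
  finally show "co u \<beta> = co (\<Sum>\<alpha> | co u \<alpha> \<noteq> 0. scl A (co u \<alpha>) (mon \<alpha>)) \<beta>" by simp
qed (auto intro!: carr.sum_W simp: scl_carr mon)

lemma mon_zero: "mon 0 = unit A"
  by (intro co_eqI) (simp_all add: mon unit_carr co_unit)

lemma mon_dec: "\<alpha> j \<noteq> 0 \<Longrightarrow> mon \<alpha> = sg (lam j (dec j \<alpha>)) (mul A (y j) (mon (dec j \<alpha>)))"
proof (rule co_eqI)
  fix \<beta> assume j: "\<alpha> j \<noteq> 0"
  have "\<beta> = \<alpha>" if "\<beta> j \<noteq> 0" "dec j \<beta> = dec j \<alpha>"
    using that j by (metis inc_dec)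
  then show "co (mon \<alpha>) \<beta> = co (sg (lam j (dec j \<alpha>)) (mul A (y j) (mon (dec j \<alpha>)))) \<beta>"
    using j by (auto simp: mon co_sg mul_carr y_carr co_left)
qed (simp_all add: mon carr.sg_W mul_carr y_carr)

text \<open>Coordinates of a product are known only for multiplication by a variable, so the
  monomial is taken apart one left factor at a time, each raising the degree by one.\<close>

lemma co_mul_mon_degree:
  assumes "v \<in> carr A" "co (mul A (mon \<alpha>) v) \<gamma> \<noteq> 0"
  shows "\<exists>\<beta>. co v \<beta> \<noteq> 0 \<and> mdeg \<gamma> = mdeg \<alpha> + mdeg \<beta>"
  using assms(2)
proof (induction "mdeg \<alpha>" arbitrary: \<alpha> \<gamma>)
  case 0
  then have "\<alpha> = 0" by (simp only: mdeg_eq_0_iff[symmetric])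
  then have "mul A (mon \<alpha>) v = v" using assms(1) by (simp only: mon_zero unit_left)
  then show ?case using 0 by (intro exI[of _ \<gamma>]) simp
next
  case (Suc n)
  then obtain j where j: "\<alpha> j \<noteq> 0"
    by (metis mdeg_eq_0_iff nat.distinct(1) ext zero_fun_apply)
  have "mul A (mon \<alpha>) v = sg (lam j (dec j \<alpha>)) (mul A (y j) (mul A (mon (dec j \<alpha>)) v))"
    unfolding mon_dec[of \<alpha> j, OF j] using assms(1)
    by (simp add: additive_op.op_sg[OF right_mul_op] mul_carr y_carr mon mul_assoc)
  then have "co (mul A (y j) (mul A (mon (dec j \<alpha>)) v)) \<gamma> \<noteq> 0"
    using Suc.prems assms(1) by (simp add: co_sg mul_carr y_carr mon)
  then have g: "\<gamma> j \<noteq> 0" "co (mul A (mon (dec j \<alpha>)) v) (dec j \<gamma>) \<noteq> 0"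
    using assms(1) by (simp_all add: co_left mul_carr mon split: if_splits)
  then show ?case
    using Suc.hyps(1)[of "dec j \<alpha>", OF _ g(2)] Suc.hyps(2) mdeg_dec[of \<alpha> j, OF j] mdeg_dec[of \<gamma> j, OF g(1)]
    by auto
qed

lemma co_mul_degree:
  assumes "u \<in> carr A" "v \<in> carr A" "co (mul A u v) \<gamma> \<noteq> 0"
  shows "\<exists>\<alpha> \<beta>. co u \<alpha> \<noteq> 0 \<and> co v \<beta> \<noteq> 0 \<and> mdeg \<gamma> = mdeg \<alpha> + mdeg \<beta>"
proof -
  have "mul A u v = (\<Sum>\<alpha> | co u \<alpha> \<noteq> 0. scl A (co u \<alpha>) (mul A (mon \<alpha>) v))"
    using assms(2) by (subst mon_expand[OF assms(1)])
      (simp add: additive_op.op_sum[OF right_mul_op] scl_carr mon mul_scl_left)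
  then have "co (mul A u v) \<gamma> = (\<Sum>\<alpha> | co u \<alpha> \<noteq> 0. co u \<alpha> * co (mul A (mon \<alpha>) v) \<gamma>)"
    using assms(2) by (simp add: co_sum co_scl scl_carr mul_carr mon)
  then obtain \<alpha> where "co u \<alpha> \<noteq> 0" "co (mul A (mon \<alpha>) v) \<gamma> \<noteq> 0"
    using assms(3) by (metis (mono_tags, lifting) mem_Collect_eq mult_zero_right sum.neutral)
  then show ?thesis using co_mul_mon_degree[OF assms(2)] by blast
qed

lemma below_mul: "u \<in> below (Suc s) \<Longrightarrow> v \<in> below (Suc t) \<Longrightarrow> mul A u v \<in> below (Suc (s + t))"
  using co_mul_degree by (fastforce simp: below_def mul_carr)

lemma piece_carr: "u \<in> piece A n \<Longrightarrow> u \<in> carr A"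
  by (simp add: piece_eq)

lemma piece_group: "additive_group (piece A n)"
proof
  fix u v assume "u \<in> piece A n" "v \<in> piece A n"
  moreover have "co u \<beta> \<noteq> 0 \<or> co v \<beta> \<noteq> 0" if "co u \<beta> - co v \<beta> \<noteq> 0" for \<beta> using that by auto
  ultimately show "u - v \<in> piece A n"
    by (auto simp: piece_eq carr.diff_W co_diff)
qed (simp add: piece_eq carr.zero_W)

lemma piece_mul: "u \<in> piece A m \<Longrightarrow> v \<in> piece A n \<Longrightarrow> mul A u v \<in> piece A (m + n)"
  using co_mul_degree by (fastforce simp: piece_eq mul_carr)

definition hom_part :: "nat \<Rightarrow> 'a \<Rightarrow> 'a" where
  "hom_part n u = elt (\<lambda>\<beta>. if 2 * mdeg \<beta> = n then co u \<beta> else 0)"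

lemma hom_part:
  assumes "u \<in> carr A"
  shows "hom_part n u \<in> piece A n" "hom_part n u \<in> carr A"
    "co (hom_part n u) \<beta> = (if 2 * mdeg \<beta> = n then co u \<beta> else 0)"
proof -
  have "finite {\<beta>. (if 2 * mdeg \<beta> = n then co u \<beta> else 0) \<noteq> 0}"
    by (rule rev_finite_subset[OF co_fin[OF assms]]) auto
  from elt[OF this] show "hom_part n u \<in> piece A n" "hom_part n u \<in> carr A"
    "co (hom_part n u) \<beta> = (if 2 * mdeg \<beta> = n then co u \<beta> else 0)"
    by (auto simp: hom_part_def piece_eq)
qed

lemma hom_part_piece: "u \<in> piece A m \<Longrightarrow> hom_part n u = (if n = m then u else 0)"
proof (rule co_eqI)
  assume u: "u \<in> piece A m"
  then have uc: "u \<in> carr A" and d: "co u \<beta> \<noteq> 0 \<Longrightarrow> 2 * mdeg \<beta> = m" for \<beta> by (simp_all add: piece_eq)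
  from uc show "hom_part n u \<in> carr A" "(if n = m then u else 0) \<in> carr A"
    by (simp_all add: hom_part carr.zero_W)
  show "co (hom_part n u) \<beta> = co (if n = m then u else 0) \<beta>" for \<beta>
    using d[of \<beta>] by (auto simp: hom_part uc)
qed

lemma hom_part_add: "u \<in> carr A \<Longrightarrow> v \<in> carr A \<Longrightarrow> hom_part n (u + v) = hom_part n u + hom_part n v"
  by (intro co_eqI) (simp_all add: hom_part carr.add_W co_add)

lemma hom_part_sum_eq:
  assumes "u \<in> below t" "finite S" "{..<2 * t} \<subseteq> S"
  shows "(\<Sum>n\<in>S. hom_part n u) = u"
proof (rule co_eqI)
  fix \<beta>
  have u: "u \<in> carr A" using assms(1) by (rule below_carr)
  have "co (\<Sum>n\<in>S. hom_part n u) \<beta> = (\<Sum>n\<in>S. if n = 2 * mdeg \<beta> then co u \<beta> else 0)"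
    using u by (simp add: co_sum hom_part eq_commute)
  also have "\<dots> = (if 2 * mdeg \<beta> \<in> S then co u \<beta> else 0)" using assms(2) by simp
  also have "\<dots> = co u \<beta>"
  proof (cases "co u \<beta> = 0")
    case False
    then have "2 * mdeg \<beta> \<in> {..<2 * t}" using assms(1) by (simp add: below_def)
    from subsetD[OF assms(3) this] show ?thesis by simp
  qed simp
  finally show "co (\<Sum>n\<in>S. hom_part n u) \<beta> = co u \<beta>" .
qed (use assms(1) in \<open>auto intro!: carr.sum_W simp: hom_part below_carr\<close>)

end

text \<open>Applying \<open>pr i\<close> to any decomposition of \<open>x\<close> returns its
  \<open>i\<close>-th summand, which gives uniqueness; existence is the family of
  projections.\<close>

lemma direct_sum_ofI:
  fixes V :: "'i \<Rightarrow> 'a::ab_group_add set"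
  assumes V: "\<And>i. V i \<subseteq> X" "\<And>i. additive_group (V i)"
    and proj: "\<And>i x. x \<in> X \<Longrightarrow> pr i x \<in> V i" "\<And>x. x \<in> X \<Longrightarrow> finite {i. pr i x \<noteq> 0}"
      "\<And>x. x \<in> X \<Longrightarrow> x = (\<Sum>i | pr i x \<noteq> 0. pr i x)"
    and X: "additive_group X"
    and add: "\<And>i x z. x \<in> X \<Longrightarrow> z \<in> X \<Longrightarrow> pr i (x + z) = pr i x + pr i z"
    and piece: "\<And>i j x. x \<in> V j \<Longrightarrow> pr i x = (if i = j then x else 0)"
  shows "direct_sum_of X V"
proof -
  interpret X: additive_group X by (rule X)
  have sum: "pr i (sum g S) = (\<Sum>j\<in>S. pr i (g j))" if "finite S" "\<And>j. j \<in> S \<Longrightarrow> g j \<in> X" for g S i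
    using that
  proof (induction S)
    case empty
    show ?case using add[OF X.zero_W X.zero_W, of i] by simp
  next
    case (insert j S)
    then show ?case by (simp add: add X.sum_W)
  qed
  have "\<exists>!f. (\<forall>i. lookup f i \<in> V i) \<and>
      x = (\<Sum>i\<in>keys f. lookup f i)" if x: "x \<in> X" for x
  proof (rule ex1I)
    let ?f = "Abs_poly_mapping (\<lambda>i. pr i x)"
    have l: "lookup ?f i = pr i x" for i
      using proj(2)[OF x] by (simp add: Abs_poly_mapping_inverse)
    then have "keys ?f = {i. pr i x \<noteq> 0}"
      by (auto simp: in_keys_iff)
    then show "(\<forall>i. lookup ?f i \<in> V i) \<and> x = (\<Sum>i\<in>keys ?f. lookup ?f i)"
      using proj(1)[OF x] proj(3)[OF x] by (simp add: l)
    fix f assume f: "(\<forall>i. lookup f i \<in> V i) \<and> x = (\<Sum>i\<in>keys f. lookup f i)"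
    show "f = ?f"
    proof (rule poly_mapping_eqI)
      fix i
      have "pr i x = (\<Sum>j\<in>keys f. pr i (lookup f j))"
        using f V(1) by (subst conjunct2[OF f], subst sum) auto
      also have "\<dots> = (\<Sum>j\<in>keys f. if j = i then lookup f i else 0)"
        using f by (intro sum.cong HOL.refl, subst piece) auto
      also have "\<dots> = lookup f i" by (simp add: in_keys_iff)
      finally show "lookup f i = lookup ?f i" by (simp add: l)
    qed
  qed
  then show ?thesis
    using V(1) additive_group.zero_W[OF V(2)] additive_group.diff_W[OF V(2)]
    unfolding direct_sum_of_def by blast
qed

context skew_coords
begin

lemma hom_part_finite:
  assumes "u \<in> carr A"
  shows "finite {n. hom_part n u \<noteq> 0}" "u = (\<Sum>n | hom_part n u \<noteq> 0. hom_part n u)"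
proof -
  obtain t where t: "u \<in> below t" using below_exists[OF assms] by blast
  have sub: "{n. hom_part n u \<noteq> 0} \<subseteq> {..<2 * t}"
  proof clarify
    fix n assume "hom_part n u \<noteq> 0"
    then obtain \<beta> where "co (hom_part n u) \<beta> \<noteq> 0" using hom_part[OF assms] co_inj by blast
    then show "n < 2 * t" using t by (auto simp: hom_part[OF assms] below_def split: if_splits)
  qed
  then show "finite {n. hom_part n u \<noteq> 0}" by (rule finite_subset) simp
  have "(\<Sum>n | hom_part n u \<noteq> 0. hom_part n u) = (\<Sum>n<2 * t. hom_part n u)"
    using sub by (intro sum.mono_neutral_left) auto
  then show "u = (\<Sum>n | hom_part n u \<noteq> 0. hom_part n u)"
    using hom_part_sum_eq[OF t, of "{..<2 * t}"] by simp
qed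

lemma direct_sum_pieces: "direct_sum_of (carr A) (piece A)"
  by (rule direct_sum_ofI[where pr = hom_part])
    (use hom_part_finite in \<open>auto simp: piece_carr piece_group hom_part hom_part_add hom_part_piece carr.additive_group_axioms\<close>)

lemma piece_0: "piece A 0 = range (\<lambda>c. scl A c (unit A))"
proof -
  have "u = scl A (co u 0) (unit A)" if "u \<in> piece A 0" for u
    using that by (intro co_eqI) (auto simp: piece_eq scl_carr unit_carr co_scl co_unit mdeg_eq_0_iff)
  moreover have "scl A c (unit A) \<in> piece A 0" for c
    by (auto simp: piece_eq scl_carr unit_carr co_scl co_unit split: if_splits)
  ultimately show ?thesis by blast
qed

lemma connected_graded: "connected_graded A"
  unfolding connected_graded_def
proof (intro conjI allI ballI)
  show "vs.subspace (piece A n)" for n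
    by (intro vs.subspaceI additive_group.zero_W[OF piece_group] additive_group.add_W[OF piece_group])
      (auto simp: piece_eq scl_carr co_scl)
  show "mul A u v \<in> piece A (m + n)" if "u \<in> piece A m" "v \<in> piece A n" for m n u v
    using that by (rule piece_mul)
qed (fact alg direct_sum_pieces piece_0 unit_nonzero)+

text \<open>The pieces of positive degree span exactly the elements with constant coefficient 0:
  such an element is the sum of its homogeneous parts, and its part of degree 0 vanishes.\<close>

lemma aug_eq: "u \<in> carr A \<Longrightarrow> aug A u = co u 0"
proof -
  assume u: "u \<in> carr A"
  let ?P = "{v \<in> carr A. co v 0 = 0}"
  have "vs.subspace ?P"
    by (auto simp: vs.subspace_def carr.zero_W carr.add_W co_add scl_carr co_scl)
  moreover have "(\<Union>n\<in>{1..}. piece A n) \<subseteq> ?P"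
    by (fastforce simp: piece_eq)
  ultimately have "vs.span (\<Union>n\<in>{1..}. piece A n) \<subseteq> ?P"
    by (rule vs.span_minimal[rotated])
  moreover have "v \<in> vs.span (\<Union>n\<in>{1..}. piece A n)" if v: "v \<in> ?P" for v
  proof -
    have "hom_part n v \<in> vs.span (\<Union>n\<in>{1..}. piece A n)" for n
    proof (cases "n = 0")
      case True
      have "hom_part 0 v = 0"
        using v by (intro co_inj) (auto simp: hom_part mdeg_eq_0_iff)
      then show ?thesis using True by (simp add: vs.span_zero)
    next
      case False
      then show ?thesis using hom_part(1)[of v n] v by (intro vs.span_base) auto
    qed
    then show ?thesis
      using hom_part_finite(2)[of v] v by (metis (no_types, lifting) mem_Collect_eq vs.span_sum)
  qed
  ultimately have span: "vs.span (\<Union>n\<in>{1..}. piece A n) = ?P" by blast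
  have "u - scl A c (unit A) \<in> ?P \<longleftrightarrow> c = co u 0" for c
    using u by (auto simp: carr.diff_W scl_carr unit_carr co_diff co_scl co_unit)
  then show ?thesis unfolding aug_def span by simp
qed

lemma below_alg_prod:
  assumes "\<And>x. x \<in> set xs \<Longrightarrow> x \<in> below (Suc t)"
  shows "alg_prod A xs \<in> below (Suc (length xs * t))"
  using assms
proof (induction xs)
  case Nil
  then show ?case using unit_below[of 1] by (simp add: alg_prod_def)
next
  case (Cons x xs)
  then have "mul A x (alg_prod A xs) \<in> below (Suc (t + length xs * t))"
    by (intro below_mul) auto
  then show ?case by (simp add: alg_prod_def)
qed

lemma dim_below:
  assumes "F \<subseteq> below t"
  shows "vs.dim (vs.span F) \<le> t ^ 4"
proof -
  let ?B = "mon ` {\<beta>. mdeg \<beta> < t}"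
  have "u \<in> vs.span ?B" if "u \<in> below t" for u
  proof -
    have "(\<Sum>\<alpha> | co u \<alpha> \<noteq> 0. scl A (co u \<alpha>) (mon \<alpha>)) \<in> vs.span ?B"
      using that by (intro vs.span_sum vs.span_scale vs.span_base) (auto simp: below_def)
    then show ?thesis using mon_expand[OF below_carr[OF that]] by simp
  qed
  then have "vs.span F \<subseteq> vs.span ?B"
    using assms by (intro vs.span_minimal vs.subspace_span) auto
  then have "vs.dim (vs.span F) \<le> card ?B"
    by (rule vs.dim_le_card) (simp add: finite_mdeg_less)
  also have "\<dots> \<le> t ^ 4"
    using card_image_le[OF finite_mdeg_less, of mon t] card_mdeg_less[of t] by linarith
  finally show ?thesis .
qed

text \<open>If the elements of \<open>F\<close> have \<open>y\<close>-degree at most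
  \<open>t\<close>, words of length at most \<open>n\<close> have degree at most \<open>n t\<close>
  and span dimension at most \<open>(n t + 1)^4\<close>, which is at most \<open>n^8\<close> once
  \<open>n \<ge> t + 2\<close>. The bound 8 is crude, but only finiteness is asked.\<close>

lemma GKdim_finite: "GKdim A < \<infinity>"
proof -
  have "limsup (\<lambda>n. ereal (log (real n) (real (vs.dim
       (vs.span {alg_prod A xs |xs. set xs \<subseteq> F \<and> length xs \<le> n}))))) \<le> 8"
    if F: "finite F" "F \<subseteq> carr A" for F
  proof (rule Limsup_bounded)
    have "\<exists>t. \<forall>u\<in>F. u \<in> below (Suc t)"
      using F
    proof (induction F)
      case (insert u F)
      then obtain s where s: "\<forall>u\<in>F. u \<in> below (Suc s)" by auto
      obtain t where t: "u \<in> below t" using below_exists[of u] insert.prems by auto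
      have "u \<in> below (Suc (s + t))" "\<forall>u\<in>F. u \<in> below (Suc (s + t))"
        using s t below_mono[of t "Suc (s + t)"] below_mono[of "Suc s" "Suc (s + t)"] by auto
      then show ?case by auto
    qed simp
    then obtain t where t: "\<And>u. u \<in> F \<Longrightarrow> u \<in> below (Suc t)" by blast
    show "eventually (\<lambda>n. ereal (log (real n) (real (vs.dim
       (vs.span {alg_prod A xs |xs. set xs \<subseteq> F \<and> length xs \<le> n})))) \<le> 8) sequentially"
    proof (rule eventually_sequentiallyI)
      fix n assume n: "n \<ge> t + 2"
      let ?d = "vs.dim (vs.span {alg_prod A xs |xs. set xs \<subseteq> F \<and> length xs \<le> n})"
      have "{alg_prod A xs |xs. set xs \<subseteq> F \<and> length xs \<le> n} \<subseteq> below (Suc (n * t))"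
      proof clarify
        fix xs assume xs: "set xs \<subseteq> F" "length xs \<le> n"
        then have "alg_prod A xs \<in> below (Suc (length xs * t))"
          using t by (intro below_alg_prod) auto
        moreover have "below (Suc (length xs * t)) \<subseteq> below (Suc (n * t))"
          using xs(2) by (intro below_mono) simp
        ultimately show "alg_prod A xs \<in> below (Suc (n * t))" by blast
      qed
      then have "?d \<le> Suc (n * t) ^ 4" by (rule dim_below)
      also have "\<dots> \<le> (n * n) ^ 4"
      proof (rule power_mono)
        have "Suc (n * t) \<le> n * (t + 1)" using n by simp
        also have "\<dots> \<le> n * n" using n by (intro mult_left_mono) auto
        finally show "Suc (n * t) \<le> n * n" .
      qed simp
      also have "(n * n) ^ 4 = n ^ 8" by (simp flip: power2_eq_square power_mult)
      finally have "?d \<le> n ^ 8" .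
      then have "real ?d \<le> real (n ^ 8)" by (rule of_nat_mono)
      then have d: "real ?d \<le> real n ^ 8" by simp
      have "log (real n) (real ?d) \<le> 8"
      proof (cases "?d = 0")
        \<comment> \<open>\<open>ln 0 = 0\<close> by convention, so dimension 0 does no
          harm.\<close>
        case True
        then show ?thesis by (simp add: log_def)
      next
        case False
        then have "log (real n) (real ?d) \<le> log (real n) (real n ^ 8)"
          using d n by (intro log_mono) auto
        also have "\<dots> = 8" using n by (subst log_nat_power) auto
        finally show ?thesis .
      qed
      then show "ereal (log (real n) (real ?d)) \<le> 8"
        by simp
    qed
  qed
  then have "GKdim A \<le> 8" unfolding GKdim_def by (intro SUP_least) auto
  then show ?thesis by (rule order_le_less_trans) simp
qed

end

section \<open>The Koszul resolution of a module\<close>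

definition pm_ext :: "('i \<Rightarrow> 'w \<Rightarrow> 'v) \<Rightarrow> ('i \<Rightarrow>\<^sub>0 'w::zero) \<Rightarrow> 'v::ab_group_add" where
  "pm_ext f v = (\<Sum>i\<in>keys v. f i (lookup v i))"

lemma pm_ext_superset:
  assumes "finite S" "keys v \<subseteq> S" "\<And>i. i \<in> S \<Longrightarrow> f i 0 = 0"
  shows "pm_ext f v = (\<Sum>i\<in>S. f i (lookup v i))"
  unfolding pm_ext_def using assms by (intro sum.mono_neutral_left) (auto simp: in_keys_iff)

lemma pm_ext_single: "f i 0 = 0 \<Longrightarrow> pm_ext f (single i a) = f i a"
  by (simp add: pm_ext_def)

lemma pm_ext_add:
  assumes W: "additive_group W"
    and f: "\<And>i a b. i \<in> I \<Longrightarrow> a \<in> W \<Longrightarrow> b \<in> W \<Longrightarrow> f i (a + b) = f i a + f i b"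
    and v: "v \<in> pm_set I W" and w: "w \<in> pm_set I W"
  shows "pm_ext f (v + w) = pm_ext f v + pm_ext f w"
proof -
  let ?S = "keys v \<union> keys w"
  have S: "?S \<subseteq> I" using v w by (auto simp: pm_set_def)
  have f0: "f i 0 = 0" if "i \<in> I" for i
    using f[OF that additive_group.zero_W[OF W] additive_group.zero_W[OF W]] by simp
  have "pm_ext f (v + w) = (\<Sum>i\<in>?S. f i (lookup (v + w) i))"
    using S f0 by (intro pm_ext_superset) (auto dest: subsetD[OF Poly_Mapping.keys_add])
  also have "\<dots> = (\<Sum>i\<in>?S. f i (lookup v i)) + (\<Sum>i\<in>?S. f i (lookup w i))"
    unfolding sum.distrib[symmetric]
    using S v w by (intro sum.cong) (auto simp: lookup_add pm_set_def intro!: f)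
  also have "\<dots> = pm_ext f v + pm_ext f w"
    using pm_ext_superset[of ?S v f] pm_ext_superset[of ?S w f] f0[OF subsetD[OF S]] by simp
  finally show ?thesis .
qed

locale koszul_resolution =
  skew_coords A y eps lam rho co + lmodule_basis A M B chi
  for A :: "('k::field, 'a::ab_group_add) galg" and y eps lam rho co
    and M :: "('a, 'm::ab_group_add, 'z) lmod_scheme" and B chi
begin

abbreviation W :: "('m \<Rightarrow>\<^sub>0 'a) set" where "W \<equiv> pm_set B (carr A)"

text \<open>\<open>A \<otimes>\<^sub>K M\<close> is free over \<open>A\<close> on \<open>B\<close>; \<open>Rm j\<close> and \<open>Sm j\<close> are \<open>(\<cdot> y\<^sub>j) \<otimes> 1\<close> and \<open>1 \<otimes> (y\<^sub>j \<cdot>)\<close>.\<close>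

definition tens :: "'a \<Rightarrow> 'm \<Rightarrow> 'm \<Rightarrow>\<^sub>0 'a" where
  "tens a x = Poly_Mapping.map (\<lambda>c. scl A c a) (chi x)"

definition Rm :: "idx \<Rightarrow> ('m \<Rightarrow>\<^sub>0 'a) \<Rightarrow> 'm \<Rightarrow>\<^sub>0 'a" where
  "Rm j = Poly_Mapping.map (\<lambda>u. mul A u (y j))"

definition Sm :: "idx \<Rightarrow> ('m \<Rightarrow>\<^sub>0 'a) \<Rightarrow> 'm \<Rightarrow>\<^sub>0 'a" where
  "Sm j = pm_ext (\<lambda>b a. tens a (act M (y j) b))"

definition ev :: "('m \<Rightarrow>\<^sub>0 'a) \<Rightarrow> 'm" where
  "ev = pm_ext (\<lambda>b a. act M a b)"

sublocale W: additive_group W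
  by (rule additive_group_pm_set) (rule carr.additive_group_axioms)

lemma lookup_tens: "lookup (tens a x) b = scl A (lookup (chi x) b) a"
  by (simp add: tens_def lookup_map_zero)

lemma lookup_Rm: "lookup (Rm j v) b = mul A (lookup v b) (y j)"
  by (simp add: Rm_def lookup_map_zero mul_zero_left y_carr)

lemma tens_W: "a \<in> carr A \<Longrightarrow> x \<in> mcarr M \<Longrightarrow> tens a x \<in> W"
  using chi_keys[of x] by (auto simp: pm_set_def lookup_tens scl_carr in_keys_iff subset_iff)

lemma tens_add_left: "tens (a + a') x = tens a x + tens a' x"
  by (intro poly_mapping_eqI) (simp add: lookup_tens lookup_add vs.scale_right_distrib)

lemma tens_zero_left [simp]: "tens 0 x = 0"
  by (intro poly_mapping_eqI) (simp add: lookup_tens)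

lemma tens_add_right: "x \<in> mcarr M \<Longrightarrow> x' \<in> mcarr M \<Longrightarrow> tens a (x + x') = tens a x + tens a x'"
  by (intro poly_mapping_eqI) (simp add: lookup_tens lookup_add chi_add vs.scale_left_distrib)

lemma tens_zero_right [simp]: "tens a 0 = 0"
  using tens_add_right[OF M.zero_W M.zero_W, of a] by simp

lemma tens_sum_right:
  "(\<And>i. i \<in> S \<Longrightarrow> f i \<in> mcarr M) \<Longrightarrow> tens a (sum f S) = (\<Sum>i\<in>S. tens a (f i))"
  by (induction S rule: infinite_finite_induct) (auto simp: tens_add_right M.sum_W)

lemma tens_uminus_right: "x \<in> mcarr M \<Longrightarrow> tens a (- x) = - tens a x"
  using tens_add_right[of x "- x" a] M.uminus_W[of x]
  by (simp add: eq_neg_iff_add_eq_0 add.commute)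

lemma tens_sg_right: "x \<in> mcarr M \<Longrightarrow> tens a (sg s x) = sg s (tens a x)"
  by (simp add: sg_def tens_uminus_right)

lemma tens_scl: "x \<in> mcarr M \<Longrightarrow> tens (scl A c a) x = tens a (ks c x)"
  by (intro poly_mapping_eqI) (simp add: lookup_tens chi_ks mult.commute)

lemma tens_basis: "b \<in> B \<Longrightarrow> tens a b = single b a"
  by (intro poly_mapping_eqI) (auto simp: lookup_tens chi_basis lookup_single when_def)

lemma Rm_tens: "a \<in> carr A \<Longrightarrow> Rm j (tens a x) = tens (mul A a (y j)) x"
  by (intro poly_mapping_eqI) (simp add: lookup_tens lookup_Rm mul_scl_left y_carr)

lemma act_tens: "a \<in> carr A \<Longrightarrow> u \<in> carr A \<Longrightarrow> Poly_Mapping.map (mul A a) (tens u x) = tens (mul A a u) x"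
  by (intro poly_mapping_eqI) (simp add: lookup_tens lookup_map_zero mul_zero_right mul_scl_right)

lemma M_B: "b \<in> B \<Longrightarrow> b \<in> mcarr M"
  using B_M by blast

lemma additive_tens:
  fixes f :: "('m \<Rightarrow>\<^sub>0 'a) \<Rightarrow> 'v::ab_group_add"
  assumes f: "\<And>v w. v \<in> W \<Longrightarrow> w \<in> W \<Longrightarrow> f (v + w) = f v + f w"
    and a: "a \<in> carr A" and x: "x \<in> mcarr M"
  shows "f (tens a x) = (\<Sum>b\<in>keys (chi x). f (tens (scl A (lookup (chi x) b) a) b))"
    (is "_ = (\<Sum>b\<in>_. f (?t b))")
proof -
  have f0: "f 0 = 0" using f[OF W.zero_W W.zero_W] by simp
  have "f (tens a x) = (\<Sum>b\<in>keys (tens a x). f (single b (lookup (tens a x) b)))"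
    by (rule additive_expand[OF carr.additive_group_axioms f tens_W[OF a x]])
  also have "\<dots> = (\<Sum>b\<in>keys (chi x). f (single b (lookup (tens a x) b)))"
    by (intro sum.mono_neutral_left) (auto simp: in_keys_iff lookup_tens f0)
  also have "\<dots> = (\<Sum>b\<in>keys (chi x). f (?t b))"
    using chi_keys[OF x] by (intro sum.cong) (auto simp: lookup_tens tens_basis)
  finally show ?thesis .
qed

text \<open>Additive maps on \<open>A \<otimes> M\<close> are determined by the tensors of algebra
  elements with basis elements; the operator identities that follow are verified there.\<close>

lemma W_eqI:
  fixes f g :: "('m \<Rightarrow>\<^sub>0 'a) \<Rightarrow> 'v::ab_group_add"
  assumes "\<And>v w. v \<in> W \<Longrightarrow> w \<in> W \<Longrightarrow> f (v + w) = f v + f w"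
    and "\<And>v w. v \<in> W \<Longrightarrow> w \<in> W \<Longrightarrow> g (v + w) = g v + g w"
    and eq: "\<And>b a. b \<in> B \<Longrightarrow> a \<in> carr A \<Longrightarrow> f (tens a b) = g (tens a b)"
    and "v \<in> W"
  shows "f v = g v"
proof (rule additive_eqI[where f = f and g = g, OF carr.additive_group_axioms])
  show "f (single i a) = g (single i a)" if "i \<in> B" "a \<in> carr A" for i a
    using eq[OF that] that by (simp only: tens_basis)
qed (fact assms)+

lemma Rm_op: "additive_op W (Rm j)"
  unfolding Rm_def by (rule additive_op_pm_set) (rule right_mul_op[OF y_carr])

lemma Sm_op: "additive_op W (Sm j)"
proof
  fix v w assume v: "v \<in> W" and w: "w \<in> W"
  show "Sm j v \<in> W"
    unfolding Sm_def pm_ext_def using v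
    by (intro W.sum_W tens_W act_M y_carr M_B) (auto simp: pm_set_def)
  show "Sm j (v + w) = Sm j v + Sm j w"
    unfolding Sm_def
    by (rule pm_ext_add[OF carr.additive_group_axioms _ v w]) (simp add: tens_add_left)
qed

lemma act_W_op: "a \<in> carr A \<Longrightarrow> additive_op W (Poly_Mapping.map (mul A a))"
  by (rule additive_op_pm_set) (rule left_mul_op)

lemma ev_add: "v \<in> W \<Longrightarrow> w \<in> W \<Longrightarrow> ev (v + w) = ev v + ev w"
  unfolding ev_def by (rule pm_ext_add[OF carr.additive_group_axioms]) (auto simp: act_add_left M_B)

lemma ev_M: "v \<in> W \<Longrightarrow> ev v \<in> mcarr M"
  unfolding ev_def pm_ext_def by (intro M.sum_W act_M M_B) (auto simp: pm_set_def)

lemma ev_zero [simp]: "ev 0 = 0"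
  by (simp add: ev_def pm_ext_def)

lemma ev_diff: "v \<in> W \<Longrightarrow> w \<in> W \<Longrightarrow> ev (v - w) = ev v - ev w"
  using ev_add[of "v - w" w] W.diff_W by simp

lemma ev_sum: "(\<And>i. i \<in> S \<Longrightarrow> f i \<in> W) \<Longrightarrow> ev (sum f S) = (\<Sum>i\<in>S. ev (f i))"
  by (induction S rule: infinite_finite_induct) (auto simp: ev_add W.sum_W)

text \<open>\<open>Sm\<close> is defined through the basis. Expanding \<open>x\<close> and moving
  scalars across the tensor shows that the same formula holds for every \<open>x\<close>, so the
  operator does not depend on the basis.\<close>

lemma Sm_tens:
  assumes a: "a \<in> carr A" and x: "x \<in> mcarr M"
  shows "Sm j (tens a x) = tens a (act M (y j) x)"
proof -
  let ?c = "lookup (chi x)"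
  have "Sm j (tens a x) = (\<Sum>b\<in>keys (chi x). Sm j (tens (scl A (?c b) a) b))"
    by (rule additive_tens[OF additive_op.op_add[OF Sm_op] a x])
  also have "\<dots> = (\<Sum>b\<in>keys (chi x). tens a (act M (y j) (ks (?c b) b)))"
  proof (rule sum.cong[OF HOL.refl])
    fix b assume "b \<in> keys (chi x)"
    then have b: "b \<in> B" using chi_keys[OF x] by blast
    then show "Sm j (tens (scl A (?c b) a) b) = tens a (act M (y j) (ks (?c b) b))"
      by (simp add: tens_basis[OF b] Sm_def pm_ext_single tens_scl act_M M_B y_carr act_ks)
  qed
  also have "\<dots> = tens a (\<Sum>b\<in>keys (chi x). act M (y j) (ks (?c b) b))"
    using chi_keys[OF x] by (intro tens_sum_right[symmetric] act_M y_carr ks_M M_B) auto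
  also have "(\<Sum>b\<in>keys (chi x). act M (y j) (ks (?c b) b))
      = act M (y j) (\<Sum>b\<in>keys (chi x). ks (?c b) b)"
    using chi_keys[OF x] by (intro additive_op.op_sum[OF act_op[OF y_carr], symmetric] ks_M M_B) auto
  also have "(\<Sum>b\<in>keys (chi x). ks (?c b) b) = x"
    by (rule chi_expand[OF x, symmetric])
  finally show ?thesis .
qed

lemma ev_tens:
  assumes a: "a \<in> carr A" and x: "x \<in> mcarr M"
  shows "ev (tens a x) = act M a x"
proof -
  let ?c = "lookup (chi x)"
  have "ev (tens a x) = (\<Sum>b\<in>keys (chi x). ev (tens (scl A (?c b) a) b))"
    by (rule additive_tens[OF ev_add a x])
  also have "\<dots> = (\<Sum>b\<in>keys (chi x). act M a (ks (?c b) b))"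
  proof (rule sum.cong[OF HOL.refl])
    fix b assume "b \<in> keys (chi x)"
    then have b: "b \<in> B" using chi_keys[OF x] by blast
    then show "ev (tens (scl A (?c b) a) b) = act M a (ks (?c b) b)"
      using a by (simp add: tens_basis[OF b] ev_def pm_ext_single act_zero_left act_scl M_B act_ks)
  qed
  also have "\<dots> = act M a (\<Sum>b\<in>keys (chi x). ks (?c b) b)"
    using chi_keys[OF x] by (intro additive_op.op_sum[OF act_op[OF a], symmetric] ks_M M_B) auto
  also have "(\<Sum>b\<in>keys (chi x). ks (?c b) b) = x"
    by (rule chi_expand[OF x, symmetric])
  finally show ?thesis .
qed

lemmas W_op_simps =
  additive_op.op_add[OF Rm_op] additive_op.op_add[OF Sm_op] additive_op.op_add[OF act_W_op]
  additive_op.op_W[OF Rm_op] additive_op.op_W[OF Sm_op] additive_op.op_W[OF act_W_op]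

lemma Rm_Rm: "v \<in> W \<Longrightarrow> Rm j (Rm k v) = sg (eps j k) (Rm k (Rm j v))"
proof (rule W_eqI[where f = "\<lambda>v. Rm j (Rm k v)" and g = "\<lambda>v. sg (eps j k) (Rm k (Rm j v))"])
  fix b a assume "b \<in> B" "a \<in> carr A"
  then show "Rm j (Rm k (tens a b)) = sg (eps j k) (Rm k (Rm j (tens a b)))"
    by (intro poly_mapping_eqI)
      (simp add: Rm_tens mul_carr y_carr mul_assoc lookup_tens lookup_sg y_comm[of k j] eps_sym[of k j]
        additive_op.op_sg[OF left_mul_op] scl_sg)
qed (simp_all add: W_op_simps sg_add)

lemma Sm_Sm: "v \<in> W \<Longrightarrow> Sm j (Sm k v) = sg (eps j k) (Sm k (Sm j v))"
proof (rule W_eqI[where f = "\<lambda>v. Sm j (Sm k v)" and g = "\<lambda>v. sg (eps j k) (Sm k (Sm j v))"])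
  fix b a assume ba: "b \<in> B" "a \<in> carr A"
  have "act M (y j) (act M (y k) b) = sg (eps j k) (act M (y k) (act M (y j) b))"
    using ba by (simp flip: act_mul add: y_carr M_B y_comm[of j k] act_sg_left mul_carr)
  then show "Sm j (Sm k (tens a b)) = sg (eps j k) (Sm k (Sm j (tens a b)))"
    using ba by (simp add: Sm_tens act_M y_carr M_B tens_sg_right)
qed (simp_all add: W_op_simps sg_add)

lemma Rm_Sm: "v \<in> W \<Longrightarrow> Rm j (Sm k v) = Sm k (Rm j v)"
  by (rule W_eqI[where f = "\<lambda>v. Rm j (Sm k v)" and g = "\<lambda>v. Sm k (Rm j v)"])
    (simp_all add: W_op_simps Sm_tens Rm_tens act_M mul_carr y_carr M_B)

lemma Rm_act:
  assumes a: "a \<in> carr A" and v: "v \<in> W"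
  shows "Rm j (Poly_Mapping.map (mul A a) v) = Poly_Mapping.map (mul A a) (Rm j v)"
  by (rule W_eqI[where f = "\<lambda>v. Rm j (Poly_Mapping.map (mul A a) v)", OF _ _ _ v])
    (simp_all add: W_op_simps a Rm_tens act_tens mul_carr y_carr mul_assoc)

lemma Sm_act:
  assumes a: "a \<in> carr A" and v: "v \<in> W"
  shows "Sm j (Poly_Mapping.map (mul A a) v) = Poly_Mapping.map (mul A a) (Sm j v)"
  by (rule W_eqI[where f = "\<lambda>v. Sm j (Poly_Mapping.map (mul A a) v)", OF _ _ _ v])
    (simp_all add: W_op_simps a Sm_tens act_tens act_M M_B mul_carr y_carr)

lemma ev_act:
  assumes a: "a \<in> carr A" and v: "v \<in> W"
  shows "ev (Poly_Mapping.map (mul A a) v) = act M a (ev v)"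
  by (rule W_eqI[where f = "\<lambda>v. ev (Poly_Mapping.map (mul A a) v)", OF _ _ _ v])
    (simp_all add: W_op_simps a ev_tens ev_add ev_M act_tens act_add act_mul M_B mul_carr)

lemma ev_Rm: "v \<in> W \<Longrightarrow> ev (Rm j v) = ev (Sm j v)"
  by (rule W_eqI[where f = "\<lambda>v. ev (Rm j v)" and g = "\<lambda>v. ev (Sm j v)"])
    (simp_all add: W_op_simps ev_tens ev_add Rm_tens Sm_tens act_M act_mul M_B mul_carr y_carr)

abbreviation Wc :: "('m \<Rightarrow>\<^sub>0 'a) set" where "Wc \<equiv> pm_set B (range (\<lambda>c. scl A c (unit A)))"

lemma scalars_group: "additive_group (range (\<lambda>c. scl A c (unit A)))"
  by (rule additive_group.intro) (auto simp flip: vs.scale_left_diff_distrib intro: range_eqI[of _ _ 0])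

text \<open>Applying \<open>chi\<close> to \<open>ev v\<close> recovers the scalars, because
  \<open>v\<close> lives on the basis with coefficients in the field. This removes the constant left
  over by the exactness argument in degree 0.\<close>

lemma ev_inj:
  assumes v: "v \<in> Wc" and ev: "ev v = 0"
  shows "v = 0"
proof (rule poly_mapping_eqI)
  fix b
  have "\<forall>b. \<exists>c. lookup v b = scl A c (unit A)"
    using v by (auto simp: pm_set_def)
  then obtain c where c: "\<And>b. lookup v b = scl A (c b) (unit A)" by metis
  have chi_sum: "chi (sum f S) = (\<Sum>i\<in>S. chi (f i))" if "finite S" "\<And>i. i \<in> S \<Longrightarrow> f i \<in> mcarr M" for f and S :: "'m set"
    using that
  proof (induction S)
    case empty
    show ?case using chi_add[OF M.zero_W M.zero_W] by simp
  next
    case (insert i S)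
    then show ?case by (simp add: chi_add M.sum_W)
  qed
  have K: "keys v \<subseteq> B" using v by (auto simp: pm_set_def)
  have "0 = chi (ev v)" using ev chi_sum[of "{}"] by simp
  also have "\<dots> = (\<Sum>b\<in>keys v. chi (ks (c b) b))"
    unfolding ev_def pm_ext_def c ks_def[symmetric] using K by (intro chi_sum ks_M M_B) auto
  finally have "0 = lookup (\<Sum>b\<in>keys v. chi (ks (c b) b)) b" by simp
  also have "\<dots> = (\<Sum>b'\<in>keys v. c b' * lookup (chi b') b)"
    unfolding lookup_sum using K by (intro sum.cong) (auto simp: chi_ks M_B)
  also have "\<dots> = (\<Sum>b'\<in>keys v. if b' = b then c b else 0)"
    using K by (intro sum.cong) (auto simp: chi_basis lookup_single when_def)
  also have "\<dots> = (if b \<in> keys v then c b else 0)" by simp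
  finally have "b \<in> keys v \<Longrightarrow> c b = 0" by simp
  then show "lookup v b = lookup 0 b"
    using c[of b] by (cases "b \<in> keys v") (auto simp: in_keys_iff)
qed

definition Em :: "nat \<Rightarrow> ('m \<Rightarrow>\<^sub>0 'a) \<Rightarrow> 'm \<Rightarrow>\<^sub>0 'a" where
  "Em n = Poly_Mapping.map (trunc n)"

lemma rdel_zero: "rdel j 0 = 0"
  by (intro co_eqI) (simp_all add: rdel carr.zero_W)

lemma koszul_Rm: "koszul W Rm (\<lambda>j. Poly_Mapping.map (rdel j)) Em eps"
  using koszul_pm_set[OF right_koszul, of B] by (simp add: Rm_def[abs_def] Em_def[abs_def])

sublocale K: koszul_bimodule W Rm "\<lambda>j. Poly_Mapping.map (rdel j)" Em eps Sm "\<lambda>t. pm_set B (below t)" Wc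
proof (rule koszul_bimodule.intro[OF koszul_Rm], rule koszul_bimodule_axioms.intro)
  fix j k t and v :: "'m \<Rightarrow>\<^sub>0 'a"
  show "additive_op W (Sm j)" by (rule Sm_op)
  show "v \<in> W \<Longrightarrow> Rm j (Rm k v) = sg (eps j k) (Rm k (Rm j v))" by (rule Rm_Rm)
  show "v \<in> W \<Longrightarrow> Sm j (Sm k v) = sg (eps j k) (Sm k (Sm j v))" by (rule Sm_Sm)
  show "v \<in> W \<Longrightarrow> Rm j (Sm k v) = Sm k (Rm j v)" by (rule Rm_Sm)
  show "additive_group (pm_set B (below t))" by (rule additive_group_pm_set[OF below_group])
  show "additive_group Wc" by (rule additive_group_pm_set[OF scalars_group])
  show "pm_set B (below 0) = {0}"
    by (auto simp: pm_set_def below_0 intro!: poly_mapping_eqI)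
  show "pm_set B (below t) \<subseteq> pm_set B (below (Suc t))"
    using below_mono[of t "Suc t"] by (auto simp: pm_set_def)
  show "W = (\<Union>t. pm_set B (below t))"
  proof
    show "(\<Union>t. pm_set B (below t)) \<subseteq> W" by (auto simp: pm_set_def intro: below_carr)
    show "W \<subseteq> (\<Union>t. pm_set B (below t))"
    proof
      fix w assume w: "w \<in> W"
      then have "\<forall>b. \<exists>t. lookup w b \<in> below t" using below_exists by (auto simp: pm_set_def)
      then obtain T where T: "\<And>b. lookup w b \<in> below (T b)" by metis
      have "lookup w b \<in> below (\<Sum>b\<in>keys w. T b)" for b
      proof (cases "b \<in> keys w")
        case True
        then have "T b \<le> (\<Sum>b\<in>keys w. T b)" by (intro member_le_sum) auto
        then show ?thesis using T below_mono by blast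
      next
        case False
        then show ?thesis by (simp add: in_keys_iff additive_group.zero_W[OF below_group])
      qed
      then show "w \<in> (\<Union>t. pm_set B (below t))" using w by (auto simp: pm_set_def)
    qed
  qed
  show "Rm j v \<in> pm_set B (below (Suc t))" if "v \<in> pm_set B (below t)"
    using that keys_map_subset[of "\<lambda>u. mul A u (y j)" v] below_right
    by (auto simp: pm_set_def lookup_Rm) (auto simp: Rm_def)
  show "Poly_Mapping.map (rdel j) v \<in> pm_set B (below t)" if "v \<in> pm_set B (below (Suc t))"
    using that keys_map_subset[of "rdel j" v] below_rdel
    by (auto simp: pm_set_def lookup_map_zero rdel_zero)
  show "Sm j v \<in> pm_set B (below t)" if v: "v \<in> pm_set B (below t)"
  proof -
    have *: "tens a x \<in> pm_set B (below t)" if "a \<in> below t" "x \<in> mcarr M" for a x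
      using tens_W[OF below_carr[OF that(1)] that(2)] that(1) by (auto simp: pm_set_def lookup_tens below_scl)
    have "lookup v b \<in> below t" "b \<in> keys v \<Longrightarrow> b \<in> B" for b
      using v by (auto simp: pm_set_def)
    then show ?thesis
      unfolding Sm_def pm_ext_def
      by (intro additive_group.sum_W[OF additive_group_pm_set[OF below_group]] * act_M y_carr M_B)
  qed
  show "Em 5 v \<in> Wc \<inter> pm_set B (below 1)" if v: "v \<in> W"
  proof -
    have t0: "trunc 5 0 = 0" using trunc_5[OF carr.zero_W] by simp
    have "lookup (Em 5 v) b = scl A (co (lookup v b) 0) (unit A)" for b
      using v by (simp add: Em_def lookup_map_zero t0 trunc_5 pm_set_lookup)
    moreover have "keys (Em 5 v) \<subseteq> B"
      using v keys_map_subset[of "trunc 5" v] by (auto simp: Em_def pm_set_def)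
    ultimately show ?thesis using unit_below by (auto simp: pm_set_def)
  qed
qed

end


section \<open>Koszul chains as finitely supported functions\<close>

text \<open>The type of resolutions prescribes the index type
  \<open>'m \<times> 'a \<times> nat\<close>. The exterior monomial is coded as a number; the middle
  component is a dummy.\<close>

definition chain_index :: "'m \<Rightarrow> idx set \<Rightarrow> 'm \<times> 'a::zero \<times> nat" where
  "chain_index b L = (b, 0, set_encode (idx_pos ` L))"

definition chain_basis :: "'m set \<Rightarrow> nat \<Rightarrow> ('m \<times> 'a::zero \<times> nat) set" where
  "chain_basis B p = {chain_index b L |b L. b \<in> B \<and> card L = p}"

definition chain_at :: "('m \<times> 'a \<times> nat \<Rightarrow>\<^sub>0 'a::zero) \<Rightarrow> idx set \<Rightarrow> 'm \<Rightarrow>\<^sub>0 'a" where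
  "chain_at f L = Poly_Mapping.map_key (\<lambda>b. chain_index b L) f"

definition chain_mk :: "(idx set \<Rightarrow> 'm \<Rightarrow>\<^sub>0 'a) \<Rightarrow> ('m \<times> 'a \<times> nat \<Rightarrow>\<^sub>0 'a::ab_group_add)" where
  "chain_mk F = (\<Sum>L\<in>UNIV. pm_push (\<lambda>b. chain_index b L) (F L))"

lemma chain_index_eq: "chain_index b L = chain_index b' L' \<longleftrightarrow> b = b' \<and> L = L'"
proof -
  have "inj idx_pos" by (simp add: inj_def idx_pos_eq_iff)
  then show ?thesis by (auto simp: chain_index_def set_encode_eq inj_image_eq_iff)
qed

lemma inj_chain_index: "inj (\<lambda>b. chain_index b L)"
  by (simp add: inj_def chain_index_eq)

lemma lookup_chain_at: "lookup (chain_at f L) b = lookup f (chain_index b L)"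
  by (simp add: chain_at_def map_key.rep_eq inj_chain_index)

lemma lookup_chain_mk:
  fixes F :: "idx set \<Rightarrow> 'm \<Rightarrow>\<^sub>0 'a::ab_group_add"
  shows "lookup (chain_mk F) (chain_index b L) = lookup (F L) b"
proof -
  have "lookup (chain_mk F) (chain_index b L)
      = (\<Sum>L'\<in>UNIV. if L' = L then lookup (F L) b else 0)"
    unfolding chain_mk_def lookup_sum
  proof (rule sum.cong[OF HOL.refl])
    fix L'
    show "lookup (pm_push (\<lambda>b. chain_index b L') (F L')) (chain_index b L :: 'm \<times> 'a \<times> nat)
        = (if L' = L then lookup (F L) b else 0)"
    proof (cases "L' = L")
      case True
      then show ?thesis using lookup_pm_push_app[OF inj_chain_index] by simp
    next
      case False
      then have "(chain_index b L :: 'm \<times> 'a \<times> nat) \<notin> range (\<lambda>b. chain_index b L')" by (auto simp: chain_index_eq)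
      then show ?thesis using False by (simp only: lookup_pm_push[OF inj_chain_index] if_False)
    qed
  qed
  then show ?thesis by simp
qed

lemma lookup_chain_mk_outside:
  assumes "\<And>b L. k \<noteq> chain_index b L"
  shows "lookup (chain_mk F) k = 0"
proof -
  have "k \<notin> range (\<lambda>b. chain_index b L)" for L using assms by auto
  then show ?thesis
    unfolding chain_mk_def lookup_sum by (simp only: lookup_pm_push[OF inj_chain_index] if_False sum.neutral_const)
qed

lemma chain_at_mk [simp]: "chain_at (chain_mk F) = F"
  by (intro ext poly_mapping_eqI) (simp add: lookup_chain_at lookup_chain_mk)

lemma chain_mk_eqI:
  assumes "\<And>b L. lookup f (chain_index b L) = lookup (F L) b"
    and "\<And>k. (\<And>b L. k \<noteq> chain_index b L) \<Longrightarrow> lookup f k = 0"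
  shows "f = chain_mk F"
proof (rule poly_mapping_eqI)
  fix k
  show "lookup f k = lookup (chain_mk F) k"
    by (cases "\<exists>b L. k = chain_index b L")
      (auto simp: lookup_chain_mk assms lookup_chain_mk_outside)
qed

lemma chain_mk_at:
  fixes f :: "'m \<times> 'a \<times> nat \<Rightarrow>\<^sub>0 'a::ab_group_add"
  assumes "f \<in> pm_set (chain_basis B p) W"
  shows "chain_mk (chain_at f) = f"
proof (rule chain_mk_eqI[symmetric])
  fix k :: "'m \<times> 'a \<times> nat" assume "\<And>b L. k \<noteq> chain_index b L"
  then have "k \<notin> chain_basis B p" by (simp add: chain_basis_def)
  then have "k \<notin> keys f" using assms unfolding pm_set_def by blast
  then show "lookup f k = 0" by (simp add: in_keys_iff)
qed (simp add: lookup_chain_at)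

lemma chain_at_pm_set:
  assumes "f \<in> pm_set (chain_basis B p) W"
  shows "chain_at f L \<in> pm_set B W" "chain_at f L \<noteq> 0 \<Longrightarrow> card L = p"
proof -
  have *: "b \<in> B \<and> card L = p" if "lookup f (chain_index b L) \<noteq> 0" for b
    using assms that by (fastforce simp: pm_set_def chain_basis_def chain_index_eq in_keys_iff)
  moreover have "lookup f k \<in> W" for k using assms unfolding pm_set_def by blast
  ultimately show "chain_at f L \<in> pm_set B W"
    by (auto simp: pm_set_def lookup_chain_at in_keys_iff)
  show "card L = p" if nz: "chain_at f L \<noteq> 0"
  proof -
    obtain b where "lookup (chain_at f L) b \<noteq> 0"
      using nz by (metis lookup_zero poly_mapping_eqI)
    then show ?thesis using * by (auto simp: lookup_chain_at)
  qed
qed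

lemma chain_mk_pm_set:
  assumes F: "\<And>L. F L \<in> pm_set B W" and supp: "\<And>L. F L \<noteq> 0 \<Longrightarrow> card L = p" and "0 \<in> W"
  shows "chain_mk F \<in> pm_set (chain_basis B p) W"
proof -
  have "lookup (chain_mk F) k \<in> W \<and>
      (lookup (chain_mk F) k \<noteq> 0 \<longrightarrow> k \<in> chain_basis B p)" for k
  proof (cases "\<exists>b L. k = chain_index b L")
    case True
    then obtain b L where k: "k = chain_index b L" by blast
    have "b \<in> B \<and> card L = p" if "lookup (F L) b \<noteq> 0"
    proof
      show "b \<in> B" using F[of L] that by (auto simp: pm_set_def in_keys_iff)
      show "card L = p" using that by (intro supp) auto
    qed
    then show ?thesis using F[of L] by (auto simp: k lookup_chain_mk pm_set_def chain_basis_def)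
  qed (use assms(3) in \<open>simp add: lookup_chain_mk_outside\<close>)
  then show ?thesis by (auto simp: pm_set_def in_keys_iff)
qed

lemma chain_at_add: "chain_at (f + g) = (\<lambda>L. chain_at f L + chain_at g L)"
  by (intro ext poly_mapping_eqI) (simp add: lookup_chain_at lookup_add)

lemma chain_mk_add: "chain_mk (\<lambda>L. F L + G L) = chain_mk F + chain_mk G"
  by (rule chain_mk_eqI[symmetric]) (simp_all add: lookup_add lookup_chain_mk lookup_chain_mk_outside)

context koszul_resolution
begin

definition koszul_P :: "nat \<Rightarrow> ('a, 'm \<times> 'a \<times> nat \<Rightarrow>\<^sub>0 'a) lmod" where
  "koszul_P p = free_lmod A (chain_basis B p)"

definition koszul_delta :: "('m \<times> 'a \<times> nat \<Rightarrow>\<^sub>0 'a) \<Rightarrow> ('m \<times> 'a \<times> nat \<Rightarrow>\<^sub>0 'a)" where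
  "koszul_delta f = chain_mk (K.koszul_b (chain_at f))"

definition koszul_aug :: "('m \<times> 'a \<times> nat \<Rightarrow>\<^sub>0 'a) \<Rightarrow> 'm" where
  "koszul_aug f = ev (chain_at f {})"

lemma mcarr_koszul_P: "mcarr (koszul_P p) = pm_set (chain_basis B p) (carr A)"
  by (simp add: koszul_P_def free_lmod_carr)

lemma chain_at_act:
  "a \<in> carr A \<Longrightarrow> chain_at (act (koszul_P p) a f) = (\<lambda>L. Poly_Mapping.map (mul A a) (chain_at f L))"
  by (intro ext poly_mapping_eqI)
    (simp add: lookup_chain_at koszul_P_def lookup_free_act lookup_map_zero mul_zero_right)

lemma chain_mk_act:
  "a \<in> carr A \<Longrightarrow> chain_mk (\<lambda>L. Poly_Mapping.map (mul A a) (F L)) = act (koszul_P p) a (chain_mk F)"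
  by (rule chain_mk_eqI[symmetric])
    (simp_all add: koszul_P_def lookup_free_act lookup_map_zero mul_zero_right lookup_chain_mk lookup_chain_mk_outside)

lemma koszul_b_act:
  assumes a: "a \<in> carr A" and F: "\<And>L. F L \<in> W"
  shows "K.koszul_b (\<lambda>L. Poly_Mapping.map (mul A a) (F L)) L = Poly_Mapping.map (mul A a) (K.koszul_b F L)"
proof -
  interpret m: additive_op W "Poly_Mapping.map (mul A a)" by (rule act_W_op[OF a])
  have RS: "Rm j (F L) \<in> W" "Sm j (F L) \<in> W" for j L
    using F by (simp_all add: W_op_simps)
  have d: "koszul_d kap Rm F L \<in> W" "koszul_d kap Sm F L \<in> W" for kap
    unfolding koszul_d_def by (intro W.sum_W W.sg_W RS)+
  show ?thesis
    unfolding K.koszul_b_def m.op_diff[OF d]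
    by (simp add: koszul_d_def Rm_act[OF a F] Sm_act[OF a F] m.op_sum m.op_sg RS W.sg_W)
qed

lemma koszul_delta_P: "f \<in> mcarr (koszul_P (Suc p)) \<Longrightarrow> koszul_delta f \<in> mcarr (koszul_P p)"
  unfolding koszul_delta_def mcarr_koszul_P
proof (rule chain_mk_pm_set[OF _ _ carr.zero_W])
  assume f: "f \<in> pm_set (chain_basis B (Suc p)) (carr A)"
  show "K.koszul_b (chain_at f) L \<in> W" for L by (rule K.koszul_b_W) (rule chain_at_pm_set(1)[OF f])
  show "card L = p" if "K.koszul_b (chain_at f) L \<noteq> 0" for L
    by (rule K.koszul_b_support[OF _ that]) (rule chain_at_pm_set(2)[OF f])
qed

lemma ev_koszul_b:
  assumes F: "\<And>L. F L \<in> W"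
  shows "ev (K.koszul_b F {}) = 0"
proof -
  have RS: "Rm j (F L) \<in> W" "Sm j (F L) \<in> W" for j L
    using F by (simp_all add: W_op_simps)
  have "ev (K.koszul_b F {}) = (\<Sum>j\<in>UNIV. ev (Rm j (F {j})) - ev (Sm j (F {j})))"
    unfolding K.koszul_b_def koszul_d_def
    by (simp add: left_sign_def right_sign_def ev_diff ev_sum W.sum_W RS sum_subtractf)
  then show ?thesis using F by (simp add: ev_Rm)
qed

text \<open>Exactness is \<open>koszul_b_exact\<close>, up to a constant \<open>c\<close> at the
  empty index set. In degree 0 the augmentation kills both the cycle and the boundary, so
  \<open>ev c = 0\<close> and \<open>c = 0\<close>; in positive degree neither the cycle nor the
  boundary has a coefficient at \<open>{}\<close>.\<close>

lemma koszul_projective_resolution: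
  "projective_resolution A M koszul_P (\<lambda>_. koszul_delta) koszul_aug"
proof -
  note at = chain_at_pm_set[of _ B _ "carr A", folded mcarr_koszul_P]
  have mk: "chain_mk F \<in> mcarr (koszul_P p)" if "\<And>L. F L \<in> W" "\<And>L. F L \<noteq> 0 \<Longrightarrow> card L = p" for F p
    unfolding mcarr_koszul_P by (rule chain_mk_pm_set[OF that carr.zero_W])
  have mk_at: "chain_mk (chain_at f) = f" if "f \<in> mcarr (koszul_P p)" for f p
    using that unfolding mcarr_koszul_P by (rule chain_mk_at)
  have mk_0: "chain_mk (\<lambda>L. 0) = (0 :: 'm \<times> 'a \<times> nat \<Rightarrow>\<^sub>0 'a)"
    by (rule chain_mk_eqI[symmetric]) simp_all
  have exact: "\<exists>g\<in>mcarr (koszul_P (Suc p)). \<exists>c\<in>Wc. \<forall>L.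
      chain_at f L = K.koszul_b (chain_at g) L + (if L = {} then c else 0)"
    if f: "f \<in> mcarr (koszul_P p)" and cyc: "p > 0 \<Longrightarrow> koszul_delta f = 0" for f p
  proof -
    have "K.koszul_b (chain_at f) L = 0" if "p > 0" for L
    proof -
      have "K.koszul_b (chain_at f) = chain_at (koszul_delta f)" by (simp add: koszul_delta_def)
      then show ?thesis
        using cyc[OF that] by (auto intro!: poly_mapping_eqI simp: lookup_chain_at)
    qed
    then obtain G c where G: "\<And>L. G L \<in> W" "\<And>L. G L \<noteq> 0 \<Longrightarrow> card L = Suc p" "c \<in> Wc"
      "\<And>L. chain_at f L = K.koszul_b G L + (if L = {} then c else 0)"
      using K.koszul_b_exact[of "chain_at f" p] at[OF f] by blast
    then show ?thesis using mk[OF G(1,2)] by (intro bexI[of _ "chain_mk G"] bexI[of _ c]) simp_all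
  qed
  have delta_hom: "is_hom A (koszul_P (Suc p)) (koszul_P p) koszul_delta" for p
    unfolding is_hom_def
  proof (intro conjI ballI)
    fix f g assume f: "f \<in> mcarr (koszul_P (Suc p))" and g: "g \<in> mcarr (koszul_P (Suc p))"
    show "koszul_delta (f + g) = koszul_delta f + koszul_delta g"
      unfolding koszul_delta_def chain_at_add chain_mk_add[symmetric]
      by (intro arg_cong[of _ _ chain_mk] ext K.koszul_b_add at(1)[OF f] at(1)[OF g])
  next
    fix a f assume a: "a \<in> carr A" and f: "f \<in> mcarr (koszul_P (Suc p))"
    show "koszul_delta (act (koszul_P (Suc p)) a f) = act (koszul_P p) a (koszul_delta f)"
      unfolding koszul_delta_def chain_at_act[OF a] chain_mk_act[OF a, symmetric]
      by (intro arg_cong[of _ _ chain_mk] ext koszul_b_act[OF a] at(1)[OF f])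
  qed (rule koszul_delta_P)
  have aug_hom: "is_hom A (koszul_P 0) M koszul_aug"
    unfolding is_hom_def koszul_aug_def
    by (auto simp: at ev_M chain_at_add ev_add chain_at_act ev_act)
  have aug_delta: "koszul_aug (koszul_delta f) = 0" if "f \<in> mcarr (koszul_P (Suc 0))" for f
    using ev_koszul_b[of "chain_at f"] at(1)[OF that] by (simp add: koszul_aug_def koszul_delta_def)
  have delta_delta: "koszul_delta (koszul_delta f) = 0" if "f \<in> mcarr (koszul_P p)" for f p
  proof -
    have "K.koszul_b (K.koszul_b (chain_at f)) = (\<lambda>L. 0)"
      by (rule ext) (rule K.koszul_b_koszul_b[OF at(1)[OF that]])
    then show ?thesis by (simp add: koszul_delta_def mk_0)
  qed
  have proj: "projective A (koszul_P p)" for p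
    unfolding koszul_P_def by (rule projective_free[OF unit_nonzero])
  show ?thesis
    unfolding projective_resolution_def
  proof (intro conjI allI)
    show "koszul_aug ` mcarr (koszul_P 0) = mcarr M"
    proof
      show "koszul_aug ` mcarr (koszul_P 0) \<subseteq> mcarr M" using aug_hom by (auto simp: is_hom_def)
      show "mcarr M \<subseteq> koszul_aug ` mcarr (koszul_P 0)"
      proof
        fix x assume x: "x \<in> mcarr M"
        let ?F = "\<lambda>L. if L = {} then tens (unit A) x else 0"
        have "chain_mk ?F \<in> mcarr (koszul_P 0)"
          by (rule mk) (auto simp: tens_W unit_carr x W.zero_W split: if_splits)
        moreover have "koszul_aug (chain_mk ?F) = x"
          by (simp add: koszul_aug_def ev_tens unit_carr x act_unit)
        ultimately show "x \<in> koszul_aug ` mcarr (koszul_P 0)" by force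
      qed
    qed
    show "{f \<in> mcarr (koszul_P 0). koszul_aug f = 0} = koszul_delta ` mcarr (koszul_P (Suc 0))"
    proof (intro equalityI subsetI)
      fix f assume "f \<in> {f \<in> mcarr (koszul_P 0). koszul_aug f = 0}"
      then have f: "f \<in> mcarr (koszul_P 0)" and f0: "koszul_aug f = 0" by auto
      obtain g c where g: "g \<in> mcarr (koszul_P (Suc 0))" "c \<in> Wc"
        "\<And>L. chain_at f L = K.koszul_b (chain_at g) L + (if L = {} then c else 0)"
        using exact[OF f] by auto
      have cW: "c \<in> W" using g(2) by (auto simp: pm_set_def scl_carr unit_carr) (metis rangeE scl_carr unit_carr)
      have "ev (chain_at f {}) = ev (K.koszul_b (chain_at g) {}) + ev c"
        unfolding g(3) using at(1)[OF g(1)] cW by (simp add: ev_add K.koszul_b_W)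
      then have "c = 0"
        using f0 ev_koszul_b[of "chain_at g"] at(1)[OF g(1)] ev_inj[OF g(2)]
        by (simp add: koszul_aug_def)
      then have "chain_at f = K.koszul_b (chain_at g)" using g(3) by auto
      then have "f = koszul_delta g" using mk_at[OF f] by (simp add: koszul_delta_def)
      then show "f \<in> koszul_delta ` mcarr (koszul_P (Suc 0))" using g(1) by blast
    next
      fix f assume "f \<in> koszul_delta ` mcarr (koszul_P (Suc 0))"
      then show "f \<in> {f \<in> mcarr (koszul_P 0). koszul_aug f = 0}"
        using koszul_delta_P aug_delta by auto
    qed
    show "{f \<in> mcarr (koszul_P (Suc i)). koszul_delta f = 0} = koszul_delta ` mcarr (koszul_P (Suc (Suc i)))" for i
    proof (intro equalityI subsetI)
      fix f assume "f \<in> {f \<in> mcarr (koszul_P (Suc i)). koszul_delta f = 0}"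
      then have f: "f \<in> mcarr (koszul_P (Suc i))" and f0: "koszul_delta f = 0" by auto
      obtain g c where g: "g \<in> mcarr (koszul_P (Suc (Suc i)))" "c \<in> Wc"
        "\<And>L. chain_at f L = K.koszul_b (chain_at g) L + (if L = {} then c else 0)"
        using exact[OF f f0] by auto
      have "chain_at f {} = 0" "K.koszul_b (chain_at g) {} = 0"
        using at(2)[OF f, of "{}"] K.koszul_b_support[where F = "chain_at g" and L = "{}", OF at(2)[OF g(1)]] by force+
      then have "c = 0" using g(3)[of "{}"] by simp
      then have "chain_at f = K.koszul_b (chain_at g)" using g(3) by auto
      then have "f = koszul_delta g" using mk_at[OF f] by (simp add: koszul_delta_def)
      then show "f \<in> koszul_delta ` mcarr (koszul_P (Suc (Suc i)))" using g(1) by blast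
    next
      fix f assume "f \<in> koszul_delta ` mcarr (koszul_P (Suc (Suc i)))"
      then show "f \<in> {f \<in> mcarr (koszul_P (Suc i)). koszul_delta f = 0}"
        using koszul_delta_P delta_delta by auto
    qed
  qed (fact proj delta_hom aug_hom)+
qed

lemma koszul_P_trivial: "p > 4 \<Longrightarrow> mcarr (koszul_P p) = {0}"
proof -
  assume "p > 4"
  then have "chain_basis B p = ({} :: ('m \<times> 'a \<times> nat) set)"
    by (auto simp: chain_basis_def) (metis card_idx_le not_less)
  then show ?thesis
    by (auto simp: mcarr_koszul_P pm_set_def carr.zero_W)
qed

end

section \<open>Global dimension\<close>

context skew_coords
begin

lemma gldim_le_4: "gldim_le U A 4"
  unfolding gldim_le_def
proof (intro allI impI)
  fix M :: "('a, 'b \<times> 'a) lmod"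
  assume "is_lmod A M"
  then interpret lmodule A M by unfold_locales
  obtain B chi where "lmodule_basis A M B chi" using basis_exists by blast
  then interpret koszul_resolution A y eps lam rho co M B chi
    by (intro koszul_resolution.intro skew_coords_axioms)
  show "pd_le A M 4"
    unfolding pd_le_def using koszul_projective_resolution koszul_P_trivial by blast
qed

section \<open>Koszul homology and the lower bound\<close>

text \<open>The Koszul resolution of the right module \<open>K\<close>, tensored with
  \<open>M\<close>: only the action of the variables on \<open>M\<close> remains.\<close>

definition left_d :: "('a, 'm::ab_group_add, 'z) lmod_scheme \<Rightarrow> (idx set \<Rightarrow> 'm) \<Rightarrow> idx set \<Rightarrow> 'm" where
  "left_d M = koszul_d (left_sign eps) (\<lambda>j. act M (y j))"

text \<open>Vanishing of the \<open>q\<close>-th Koszul homology of \<open>M\<close>, which is \<open>Tor\<^sub>q(K, M)\<close>.\<close>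

definition koszul_acyclic :: "('a, 'm::ab_group_add, 'z) lmod_scheme \<Rightarrow> nat \<Rightarrow> bool" where
  "koszul_acyclic M q \<longleftrightarrow> (\<forall>F. (\<forall>L. F L \<in> mcarr M) \<and> (\<forall>L. F L \<noteq> 0 \<longrightarrow> card L = q) \<and> (\<forall>L. left_d M F L = 0) \<longrightarrow>
     (\<exists>G. (\<forall>L. G L \<in> mcarr M) \<and> (\<forall>L. G L \<noteq> 0 \<longrightarrow> card L = Suc q) \<and> F = left_d M G))"

lemma koszul_acyclicD:
  assumes "koszul_acyclic M q" "\<And>L. F L \<in> mcarr M" "\<And>L. F L \<noteq> 0 \<Longrightarrow> card L = q" "\<And>L. left_d M F L = 0"
  obtains G where "\<And>L. G L \<in> mcarr M" "\<And>L. G L \<noteq> 0 \<Longrightarrow> card L = Suc q" "F = left_d M G"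
  using assms unfolding koszul_acyclic_def by metis

lemma left_d_hom:
  assumes M: "is_lmod A M" and f: "is_hom A M N f" and F: "\<And>L. F L \<in> mcarr M"
  shows "f (left_d M F L) = left_d N (\<lambda>L. f (F L)) L"
proof -
  interpret lmodule A M using M by unfold_locales
  have sum: "f (sum g S) = (\<Sum>i\<in>S. f (g i))" if "finite S" "\<And>i. i \<in> S \<Longrightarrow> g i \<in> mcarr M" for g and S :: "idx set"
    using that
  proof (induction S)
    case empty
    have "f 0 + f 0 = f 0" using f M.zero_W unfolding is_hom_def by (metis add_0)
    then show ?case by simp
  next
    case (insert i S)
    then show ?case using f M.sum_W[of S g] by (simp add: is_hom_def)
  qed
  have sgn: "f (sg b x) = sg b (f x)" if "x \<in> mcarr M" for b x
  proof -
    have "f x + f (- x) = 0"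
      using f that M.uminus_W[OF that] sum[of "{}" "\<lambda>_. 0"] unfolding is_hom_def
      by (metis add.right_inverse finite.emptyI sum.empty empty_iff)
    then show ?thesis by (simp add: sg_def eq_neg_iff_add_eq_0 add.commute)
  qed
  show ?thesis
    unfolding left_d_def koszul_d_def using f F
    by (simp add: sum sgn M.sg_W act_M y_carr is_hom_def)
qed

lemma left_d_M:
  assumes M: "is_lmod A M" and F: "\<And>L. F L \<in> mcarr M"
  shows "left_d M F L \<in> mcarr M"
proof -
  interpret lmodule A M using M by unfold_locales
  show ?thesis unfolding left_d_def koszul_d_def by (intro M.sum_W M.sg_W act_M y_carr F)
qed

lemma left_d_support:
  assumes M: "is_lmod A M" and "\<And>L. F L \<noteq> 0 \<Longrightarrow> card L = Suc q" "left_d M F L \<noteq> 0"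
  shows "card L = q"
proof -
  interpret lmodule A M using M by unfold_locales
  show ?thesis
    using koszul_d_support[where F = F and p = q and R = "\<lambda>j. act M (y j)" and kap = "left_sign eps" and L = L]
      assms(2,3) act_zero[OF y_carr] unfolding left_d_def by blast
qed

lemma left_d_left_d:
  assumes M: "is_lmod A M" and F: "\<And>L. F L \<in> mcarr M"
  shows "left_d M (left_d M F) L = 0"
proof -
  interpret lmodule A M using M by unfold_locales
  show ?thesis
    unfolding left_d_def
  proof (rule koszul_d_koszul_d[OF act_op[OF y_carr] koszul_sign_left _ F])
    show "act M (y j) (act M (y k) w) = sg (eps j k) (act M (y k) (act M (y j) w))"
      if "w \<in> mcarr M" for j k w
      using that by (simp flip: act_mul add: y_carr y_comm[of j k] act_sg_left mul_carr)
  qed (rule eps_sym)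
qed

lemma left_d_diff:
  assumes M: "is_lmod A M" and F: "\<And>L. F L \<in> mcarr M" and G: "\<And>L. G L \<in> mcarr M"
  shows "left_d M (\<lambda>L. F L - G L) L = left_d M F L - left_d M G L"
proof -
  interpret lmodule A M using M by unfold_locales
  show ?thesis
    unfolding left_d_def koszul_d_def
    by (simp add: additive_op.op_diff[OF act_op[OF y_carr] F G] sg_diff sum_subtractf)
qed

text \<open>The homotopy for left multiplication contracts the complex of a free module; what it
  leaves over sits at the empty index set, where a chain of degree \<open>q > 0\<close> is
  zero.\<close>

lemma koszul_acyclic_free:
  fixes I :: "'i set"
  assumes "q > 0"
  shows "koszul_acyclic (free_lmod A I) q"
proof -
  let ?W = "pm_set I (carr A)" and ?R = "\<lambda>j. Poly_Mapping.map (\<lambda>u. mul A (y j) u)"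
    and ?del = "\<lambda>j. Poly_Mapping.map (ldel j)" and ?a = "left_sign eps"
  interpret F: koszul ?W ?R ?del "\<lambda>n. Poly_Mapping.map (trunc n)" eps
    by (rule koszul_pm_set[OF left_koszul])
  have left: "left_d (free_lmod A I) = koszul_d ?a ?R"
    by (simp add: left_d_def free_lmod_def)
  show ?thesis
    unfolding koszul_acyclic_def free_lmod_carr left
  proof (intro allI impI)
    fix F assume "(\<forall>L. F L \<in> ?W) \<and> (\<forall>L. F L \<noteq> 0 \<longrightarrow> card L = q) \<and> (\<forall>L. koszul_d ?a ?R F L = 0)"
    then have F: "\<And>L. F L \<in> ?W" "\<And>L. F L \<noteq> 0 \<Longrightarrow> card L = q" "koszul_d ?a ?R F = (\<lambda>L. 0)" by auto
    have del0: "?del j (0 :: 'i \<Rightarrow>\<^sub>0 'a) = 0" for j by (rule additive_op.op_zero[OF F.del_op])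
    have E0: "Poly_Mapping.map (trunc 5) (0 :: 'i \<Rightarrow>\<^sub>0 'a) = 0"
      by (intro poly_mapping_eqI) (simp add: Poly_Mapping.map.rep_eq)
    have "F {} = 0" using F(2)[of "{}"] assms by auto
    then have "F L = koszul_d ?a ?R (koszul_h ?a ?del F) L" for L
      using F.koszul_homotopy[OF koszul_sign_left, of F L, OF eps_sym F(1)]
      by (simp add: F(3) koszul_h_def del0 E0 cong: if_cong)
    then have "F = koszul_d ?a ?R (koszul_h ?a ?del F)" by (rule ext)
    then show "\<exists>G. (\<forall>L. G L \<in> ?W) \<and> (\<forall>L. G L \<noteq> 0 \<longrightarrow> card L = Suc q) \<and> F = koszul_d ?a ?R G"
    proof (intro exI conjI allI impI)
      show "koszul_h ?a ?del F L \<in> ?W" for L by (rule F.koszul_h_W[OF F(1)])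
      show "card L = Suc q" if "koszul_h ?a ?del F L \<noteq> 0" for L
        by (rule koszul_h_support[where F = F and p = q, OF F(2) del0 that])
      show "F = koszul_d ?a ?R (koszul_h ?a ?del F)" by fact
    qed
  qed
qed

text \<open>A projective module is a retract of a free one, and \<open>left_d\<close> commutes with
  homomorphisms: embed the cycle, bound it there, and project back.\<close>

lemma koszul_acyclic_projective:
  fixes P :: "('a, 'm::ab_group_add, 'z) lmod_scheme"
  assumes P: "projective A P" and "q > 0"
  shows "koszul_acyclic P q"
proof -
  obtain I :: "'m set" and \<iota> \<pi> where lm: "is_lmod A P" and \<iota>: "is_hom A P (free_lmod A I) \<iota>"
    and \<pi>: "is_hom A (free_lmod A I) P \<pi>" and \<pi>\<iota>: "\<And>x. x \<in> mcarr P \<Longrightarrow> \<pi> (\<iota> x) = x"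
    using P unfolding projective_def by blast
  interpret lmodule A P using lm by unfold_locales
  note fl = is_lmod_free[of I]
  have fz: "0 \<in> mcarr (free_lmod A I)" using fl by (simp add: is_lmod_def)
  have \<iota>0: "\<iota> 0 = 0" using \<iota> M.zero_W unfolding is_hom_def by (metis add.right_neutral add_left_cancel)
  have \<pi>0: "\<pi> 0 = 0" using \<pi> fz unfolding is_hom_def by (metis add.right_neutral add_left_cancel)
  show ?thesis
    unfolding koszul_acyclic_def
  proof (intro allI impI)
    fix F assume "(\<forall>L. F L \<in> mcarr P) \<and> (\<forall>L. F L \<noteq> 0 \<longrightarrow> card L = q) \<and> (\<forall>L. left_d P F L = 0)"
    then have F: "\<And>L. F L \<in> mcarr P" "\<And>L. F L \<noteq> 0 \<Longrightarrow> card L = q" "\<And>L. left_d P F L = 0" by auto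
    have "left_d (free_lmod A I) (\<lambda>L. \<iota> (F L)) L = 0" for L
      using left_d_hom[OF lm \<iota>, of F L] F \<iota>0 by simp
    moreover have "\<iota> (F L) \<in> mcarr (free_lmod A I)" for L using \<iota> F(1) by (simp add: is_hom_def)
    moreover have "card L = q" if "\<iota> (F L) \<noteq> 0" for L using that F(2) \<iota>0 by force
    ultimately obtain G where G: "\<And>L. G L \<in> mcarr (free_lmod A I)" "\<And>L. G L \<noteq> 0 \<Longrightarrow> card L = Suc q"
      "(\<lambda>L. \<iota> (F L)) = left_d (free_lmod A I) G"
      using koszul_acyclicD[where F = "\<lambda>L. \<iota> (F L)", OF koszul_acyclic_free[OF assms(2), of I]] by metis
    have "F L = left_d P (\<lambda>L. \<pi> (G L)) L" for L
      using left_d_hom[OF fl \<pi>, of G L] G(1) fun_cong[OF G(3), of L] \<pi>\<iota>[OF F(1)[of L]] by simp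
    then show "\<exists>G. (\<forall>L. G L \<in> mcarr P) \<and> (\<forall>L. G L \<noteq> 0 \<longrightarrow> card L = Suc q) \<and> F = left_d P G"
    proof (intro exI conjI allI impI)
      show "\<pi> (G L) \<in> mcarr P" for L using \<pi> G(1) by (simp add: is_hom_def)
      show "card L = Suc q" if "\<pi> (G L) \<noteq> 0" for L using G(2)[of L] \<pi>0 that by metis
      show "F = left_d P (\<lambda>L. \<pi> (G L))" by (rule ext) fact
    qed
  qed
qed

definition kernel :: "('a, 'm::ab_group_add, 'z) lmod_scheme \<Rightarrow> ('m \<Rightarrow> 'n::zero) \<Rightarrow> ('a, 'm) lmod" where
  "kernel P f = \<lparr>mcarr = {x \<in> mcarr P. f x = 0}, act = act P\<rparr>"

lemma left_d_kernel: "left_d (kernel P f) = left_d P"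
  by (simp add: left_d_def kernel_def)

text \<open>The long exact sequence of \<open>0 \<rightarrow> kernel P f \<rightarrow> P
  \<rightarrow> N \<rightarrow> 0\<close> as a diagram chase: lift a cycle of \<open>N\<close> to
  \<open>P\<close>, write the differential of the lift as the differential of a chain in the kernel,
  subtract that chain, and bound the resulting cycle of \<open>P\<close>.\<close>

lemma koszul_acyclic_shift:
  assumes P: "is_lmod A P" and f: "is_hom A P N f" and onto: "f ` mcarr P = mcarr N"
    and acP: "koszul_acyclic P (Suc q)" and acZ: "koszul_acyclic (kernel P f) q"
  shows "koszul_acyclic N (Suc q)"
  unfolding koszul_acyclic_def
proof (intro allI impI)
  interpret lmodule A P using P by unfold_locales
  have f0: "f 0 = 0"
    using f M.zero_W unfolding is_hom_def by (metis add.right_neutral add_left_cancel)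
  have f_diff: "f (x - x') = f x - f x'" if "x \<in> mcarr P" "x' \<in> mcarr P" for x x'
    using f M.diff_W[OF that] that unfolding is_hom_def by (metis diff_add_cancel add_diff_cancel)
  fix F assume "(\<forall>L. F L \<in> mcarr N) \<and> (\<forall>L. F L \<noteq> 0 \<longrightarrow> card L = Suc q) \<and> (\<forall>L. left_d N F L = 0)"
  then have F: "\<And>L. F L \<in> mcarr N" "\<And>L. F L \<noteq> 0 \<Longrightarrow> card L = Suc q" "\<And>L. left_d N F L = 0" by auto
  \<comment> \<open>Zero is lifted to zero, so that the lift is supported in the same
    degree.\<close>
  have "\<exists>p. p \<in> mcarr P \<and> f p = F L \<and> (F L = 0 \<longrightarrow> p = 0)" for L
  proof (cases "F L = 0")
    case True
    then show ?thesis using f0 M.zero_W by auto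
  next
    case False
    have "F L \<in> f ` mcarr P" using F(1)[of L] unfolding onto .
    then show ?thesis using False by auto
  qed
  then obtain p where p: "\<And>L. p L \<in> mcarr P" "\<And>L. f (p L) = F L" "\<And>L. F L = 0 \<Longrightarrow> p L = 0" by metis
  have p_supp: "card L = Suc q" if "p L \<noteq> 0" for L using p(3)[of L] F(2)[of L] that by blast
  have dp: "f (left_d P p L) = 0" for L
    using left_d_hom[where F = p and L = L, OF P f p(1)] F(3) by (simp add: p(2))
  have "(\<forall>L. left_d P p L \<in> mcarr (kernel P f)) \<and> (\<forall>L. left_d P p L \<noteq> 0 \<longrightarrow> card L = q) \<and>
      (\<forall>L. left_d (kernel P f) (left_d P p) L = 0)"
    using dp left_d_M[where F = p, OF P p(1)]
      left_d_support[where F = p, OF P p_supp] left_d_left_d[where F = p, OF P p(1)]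
    unfolding left_d_kernel by (auto simp: kernel_def)
  then obtain z where z: "\<And>L. z L \<in> mcarr (kernel P f)" "\<And>L. z L \<noteq> 0 \<Longrightarrow> card L = Suc q"
    "left_d P p = left_d P z"
    using acZ unfolding koszul_acyclic_def left_d_kernel by blast
  have zP: "z L \<in> mcarr P" "f (z L) = 0" for L using z(1)[of L] by (auto simp: kernel_def)
  have pz: "p L - z L \<in> mcarr P" for L using p(1) zP(1) M.diff_W by blast
  have pz_supp: "card L = Suc q" if "p L - z L \<noteq> 0" for L
    using p_supp[of L] z(2)[of L] that by (metis diff_self)
  have pz_cyc: "left_d P (\<lambda>L. p L - z L) L = 0" for L
    using left_d_diff[where F = p and G = z, OF P p(1) zP(1)] fun_cong[OF z(3), of L] by simp
  obtain g where g: "\<And>L. g L \<in> mcarr P" "\<And>L. g L \<noteq> 0 \<Longrightarrow> card L = Suc (Suc q)"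
    "(\<lambda>L. p L - z L) = left_d P g"
    using koszul_acyclicD[where F = "\<lambda>L. p L - z L", OF acP pz pz_supp pz_cyc] by metis
  have "F L = left_d N (\<lambda>L. f (g L)) L" for L
  proof -
    have "F L = f (p L - z L)" using p zP by (simp add: f_diff)
    also have "\<dots> = f (left_d P g L)" using fun_cong[OF g(3), of L] by simp
    finally show ?thesis by (simp add: left_d_hom[where F = g, OF P f g(1)])
  qed
  then show "\<exists>G. (\<forall>L. G L \<in> mcarr N) \<and> (\<forall>L. G L \<noteq> 0 \<longrightarrow> card L = Suc (Suc q)) \<and> F = left_d N G"
  proof (intro exI conjI allI impI)
    show "f (g L) \<in> mcarr N" for L using f g(1) by (simp add: is_hom_def)
    show "card L = Suc (Suc q)" if "f (g L) \<noteq> 0" for L using g(2)[of L] f0 that by metis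
    show "F = left_d N (\<lambda>L. f (g L))" by (rule ext) fact
  qed
qed

lemma co_y_0: "co (y j) 0 = 0"
  using co_right[OF unit_carr, of j 0] by (simp add: unit_left y_carr)

lemma co_mul_0: "u \<in> carr A \<Longrightarrow> v \<in> carr A \<Longrightarrow> co (mul A u v) 0 = co u 0 * co v 0"
proof -
  assume u: "u \<in> carr A" and v: "v \<in> carr A"
  define w where "w = u - scl A (co u 0) (unit A)"
  have w: "w \<in> carr A" "co w 0 = 0"
    using u by (simp_all add: w_def carr.diff_W scl_carr unit_carr co_diff co_scl co_unit)
  have "co (mul A w v) 0 = 0"
    using co_mul_degree[OF w(1) v, of 0] w(2) by (auto simp: mdeg_eq_0_iff)
  moreover have "mul A u v = mul A w v + scl A (co u 0) v"
    using u v w by (simp add: w_def additive_op.op_diff[OF right_mul_op] scl_carr unit_carr mul_scl_left unit_left)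
  ultimately show ?thesis using u v w by (simp add: co_add mul_carr scl_carr co_scl)
qed

text \<open>\<open>gldim_le\<close> ranges over modules in \<open>'m \<times> 'a\<close>, so
  \<open>K\<close> is realised by the multiples of the unit in the second component;
  \<open>co a 0\<close> is the augmentation.\<close>

definition trivial_copy :: "('a, 'm::ab_group_add \<times> 'a) lmod" where
  "trivial_copy = \<lparr>mcarr = range (\<lambda>c. (0, scl A c (unit A))), act = (\<lambda>a x. (0, scl A (co a 0) (snd x)))\<rparr>"

lemma is_lmod_trivial_copy: "is_lmod A trivial_copy"
  unfolding is_lmod_def trivial_copy_def
  by (auto simp: co_add co_mul_0 co_unit vs.scale_left_distrib vs.scale_right_distrib zero_prod_def
      simp flip: vs.scale_left_diff_distrib intro: range_eqI[of _ _ 0])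

text \<open>The variables act on \<open>K\<close> by zero, so all differentials vanish and the top
  exterior monomial gives a nonzero class of degree 4.\<close>

lemma not_koszul_acyclic_trivial_copy:
  "\<not> koszul_acyclic (trivial_copy :: ('a, 'm::ab_group_add \<times> 'a) lmod) 4"
proof
  let ?T = "trivial_copy :: ('a, 'm \<times> 'a) lmod"
  define F where "F = (\<lambda>L :: idx set. if L = UNIV then (0 :: 'm, unit A) else 0)"
  assume ac: "koszul_acyclic ?T 4"
  have act0: "act ?T (y j) x = 0" for j x
    by (simp add: trivial_copy_def co_y_0 zero_prod_def)
  have d0: "left_d ?T G L = 0" for G L
    by (simp add: left_d_def koszul_d_def act0)
  have F_carr: "F L \<in> mcarr ?T" for L
    by (auto simp: F_def trivial_copy_def zero_prod_def intro: range_eqI[of _ _ 1] range_eqI[of _ _ 0])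
  have F_supp: "card L = 4" if "F L \<noteq> 0" for L
    using that by (simp add: F_def UNIV_idx split: if_splits)
  obtain G where "F = left_d ?T G"
    using koszul_acyclicD[where F = F, OF ac F_carr F_supp d0] by metis
  then have "F UNIV = 0" by (simp only: d0)
  then show False using unit_nonzero by (simp add: F_def zero_prod_def)
qed

text \<open>If \<open>d < 4\<close>, then \<open>P 4\<close> is zero and so is the kernel of
  \<open>\<delta> 2\<close>. Its homology vanishes in degree 0, and each step back through the
  kernels of \<open>\<delta> 1\<close>, \<open>\<delta> 0\<close> and \<open>\<eta>\<close> to
  \<open>K\<close> raises the degree of vanishing by one; after four steps the homology of
  \<open>K\<close> would vanish in degree 4.\<close>

lemma gldim_ge_4:
  fixes U :: "'m::ab_group_add itself"
  assumes "gldim_le U A d"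
  shows "4 \<le> d"
proof (rule ccontr)
  assume "\<not> 4 \<le> d"
  let ?T = "trivial_copy :: ('a, 'm \<times> 'a) lmod"
  obtain P :: "nat \<Rightarrow> ('a, ('a, 'm \<times> 'a) res) lmod" and \<delta> \<eta>
    where res: "projective_resolution A ?T P \<delta> \<eta>" and P0: "\<And>i. i > d \<Longrightarrow> mcarr (P i) = {0}"
    using assms is_lmod_trivial_copy unfolding gldim_le_def pd_le_def by blast
  have proj: "projective A (P i)" and lm: "is_lmod A (P i)" for i
    using res by (auto simp: projective_resolution_def projective_def)
  have hom: "is_hom A (P (Suc i)) (P i) (\<delta> i)" for i
    using res by (simp add: projective_resolution_def)
  have ker: "{x \<in> mcarr (P (Suc i)). \<delta> i x = 0} = \<delta> (Suc i) ` mcarr (P (Suc (Suc i)))" for i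
    using res by (simp add: projective_resolution_def)
  have ker0: "{x \<in> mcarr (P 0). \<eta> x = 0} = \<delta> 0 ` mcarr (P (Suc 0))"
    and hom0: "is_hom A (P 0) ?T \<eta>" and onto0: "\<eta> ` mcarr (P 0) = mcarr ?T"
    using res by (simp_all add: projective_resolution_def)
  have homZ: "is_hom A (P (Suc (Suc i))) (kernel (P (Suc i)) (\<delta> i)) (\<delta> (Suc i))" for i
    using hom[of "Suc i"] ker[of i] by (auto simp: is_hom_def kernel_def)
  have homZ0: "is_hom A (P (Suc 0)) (kernel (P 0) \<eta>) (\<delta> 0)"
    using hom[of 0] ker0 by (auto simp: is_hom_def kernel_def)
  have step: "koszul_acyclic (kernel (P (Suc i)) (\<delta> i)) (Suc q)"
    if "koszul_acyclic (kernel (P (Suc (Suc i))) (\<delta> (Suc i))) q" for i q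
    using koszul_acyclic_shift[OF lm homZ _ koszul_acyclic_projective[OF proj] that] ker[of i]
    by (simp add: kernel_def)
  have "mcarr (kernel (P 3) (\<delta> 2)) \<subseteq> {0}"
  proof -
    have "mcarr (P (Suc (Suc 2))) = {0}" using \<open>\<not> 4 \<le> d\<close> P0[of "Suc (Suc 2)"] by simp
    moreover have "\<delta> (Suc 2) 0 = 0"
      using hom[of "Suc 2"] \<open>mcarr (P (Suc (Suc 2))) = {0}\<close> unfolding is_hom_def
      by (metis add.right_neutral add_left_cancel singletonI)
    ultimately show ?thesis using ker[of 2] by (simp add: kernel_def)
  qed
  have "koszul_acyclic (kernel (P 3) (\<delta> 2)) 0"
    unfolding koszul_acyclic_def
  proof (intro allI impI)
    interpret lmodule A "P 3" using lm by unfold_locales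
    fix F assume F: "(\<forall>L. F L \<in> mcarr (kernel (P 3) (\<delta> 2))) \<and> (\<forall>L. F L \<noteq> 0 \<longrightarrow> card L = 0) \<and>
      (\<forall>L. left_d (kernel (P 3) (\<delta> 2)) F L = 0)"
    then have "F = (\<lambda>L. 0)" using \<open>mcarr (kernel (P 3) (\<delta> 2)) \<subseteq> {0}\<close> by blast
    moreover have "left_d (kernel (P 3) (\<delta> 2)) (\<lambda>L. 0) = (\<lambda>L. 0)"
      by (intro ext) (simp add: left_d_def koszul_d_def kernel_def act_zero y_carr)
    ultimately show "\<exists>G. (\<forall>L. G L \<in> mcarr (kernel (P 3) (\<delta> 2))) \<and> (\<forall>L. G L \<noteq> 0 \<longrightarrow> card L = Suc 0) \<and>
      F = left_d (kernel (P 3) (\<delta> 2)) G"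
      using F by (intro exI[of _ F]) auto
  qed
  then have "koszul_acyclic (kernel (P (Suc 1)) (\<delta> 1)) 1"
    using step[of 1 0] by (simp add: eval_nat_numeral)
  then have "koszul_acyclic (kernel (P (Suc 0)) (\<delta> 0)) 2"
    using step[of 0 1] by (simp add: eval_nat_numeral)
  then have "koszul_acyclic (kernel (P 0) \<eta>) (Suc 2)"
    using koszul_acyclic_shift[where q = 2, OF lm homZ0 _ koszul_acyclic_projective[OF proj]] ker0
    by (simp add: kernel_def)
  then have "koszul_acyclic ?T (Suc (Suc 2))"
    using koszul_acyclic_shift[where q = 3, OF lm hom0 onto0 koszul_acyclic_projective[OF proj]] by simp
  with not_koszul_acyclic_trivial_copy[where 'm = 'm] show False by simp
qed

lemma has_gldim_4: "has_gldim U A 4"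
  unfolding has_gldim_def using gldim_le_4 gldim_ge_4 by blast

end

section \<open>The Artin-Schelter Gorenstein condition\<close>

lemma card_Compl_idx: "card (- K :: idx set) = 4 - card K"
proof -
  have "card (UNIV :: idx set) = 4" by (simp add: UNIV_idx)
  then show ?thesis using card_Diff_subset[of K UNIV] by (simp add: Compl_eq_Diff_UNIV)
qed

lemma sum_fun_apply: "(\<Sum>n\<in>N. h n) x = (\<Sum>n\<in>N. h n (x :: 'b) :: 'c::ab_group_add)"
  by (induction N rule: infinite_finite_induct) simp_all

context skew_coords
begin

section \<open>Gradings by the integers\<close>

definition zpiece :: "int \<Rightarrow> 'a set" where
  "zpiece n = (if 0 \<le> n then piece A (nat n) else {0})"

definition zpart :: "int \<Rightarrow> 'a \<Rightarrow> 'a" where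
  "zpart n u = (if 0 \<le> n then hom_part (nat n) u else 0)"

lemma zpiece_group: "additive_group (zpiece n)"
  using piece_group[of "nat n"] by (auto simp: zpiece_def additive_group_def)

lemma zpiece_carr: "u \<in> zpiece n \<Longrightarrow> u \<in> carr A"
  by (auto simp: zpiece_def carr.zero_W intro: piece_carr split: if_splits)

lemma zpart_piece: "u \<in> carr A \<Longrightarrow> zpart n u \<in> zpiece n"
  by (simp add: zpart_def zpiece_def hom_part)

lemma zpart_carr: "u \<in> carr A \<Longrightarrow> zpart n u \<in> carr A"
  using zpart_piece zpiece_carr by blast

lemma hom_part_zero: "hom_part n 0 = 0"
  using hom_part_add[OF carr.zero_W carr.zero_W, of n] by simp

lemma zpart_zero [simp]: "zpart n 0 = 0"
  by (simp add: zpart_def hom_part_zero)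

lemma zpart_of_piece:
  assumes "u \<in> zpiece m"
  shows "zpart n u = (if n = m then u else 0)"
proof (cases "0 \<le> m")
  case True
  then have "u \<in> piece A (nat m)" using assms by (simp add: zpiece_def)
  then show ?thesis using True hom_part_piece[of u "nat m" "nat n"] by (auto simp: zpart_def eq_nat_nat_iff)
next
  case False
  then show ?thesis using assms by (simp add: zpiece_def)
qed

lemma zpart_add: "u \<in> carr A \<Longrightarrow> v \<in> carr A \<Longrightarrow> zpart n (u + v) = zpart n u + zpart n v"
  by (simp add: zpart_def hom_part_add)

lemma zpart_finite:
  assumes "u \<in> carr A"
  shows "finite {n. zpart n u \<noteq> 0}"
    "finite S \<Longrightarrow> {n. zpart n u \<noteq> 0} \<subseteq> S \<Longrightarrow> (\<Sum>n\<in>S. zpart n u) = u"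
proof -
  have eq: "{n. zpart n u \<noteq> 0} = int ` {n. hom_part n u \<noteq> 0}"
    by (auto simp: zpart_def image_iff split: if_splits) (metis int_nat_eq)
  show fin: "finite {n. zpart n u \<noteq> 0}"
    unfolding eq using hom_part_finite(1)[OF assms] by simp
  assume "finite S" "{n. zpart n u \<noteq> 0} \<subseteq> S"
  then have "(\<Sum>n\<in>S. zpart n u) = (\<Sum>n | zpart n u \<noteq> 0. zpart n u)"
    by (intro sum.mono_neutral_right) auto
  also have "\<dots> = (\<Sum>n | hom_part n u \<noteq> 0. zpart (int n) u)"
    unfolding eq by (subst sum.reindex) auto
  also have "\<dots> = u" using hom_part_finite(2)[OF assms] by (simp add: zpart_def)
  finally show "(\<Sum>n\<in>S. zpart n u) = u" .
qed

lemma zpiece_mul: "u \<in> zpiece m \<Longrightarrow> v \<in> zpiece n \<Longrightarrow> mul A u v \<in> zpiece (m + n)"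
proof -
  assume u: "u \<in> zpiece m" and v: "v \<in> zpiece n"
  have c: "u \<in> carr A" "v \<in> carr A" using u v zpiece_carr by auto
  show ?thesis
  proof (cases "0 \<le> m \<and> 0 \<le> n")
    case True
    then have "mul A u v \<in> piece A (nat m + nat n)"
      using u v by (intro piece_mul) (simp_all add: zpiece_def)
    then show ?thesis using True by (simp add: zpiece_def nat_add_distrib)
  next
    case False
    then have "u = 0 \<or> v = 0" using u v by (auto simp: zpiece_def split: if_splits)
    then have "mul A u v = 0" using c by (auto simp: mul_zero_left mul_zero_right)
    then show ?thesis using additive_group.zero_W[OF zpiece_group] by simp
  qed
qed

lemma y_zpiece: "y j \<in> zpiece 2"
proof -
  have "2 * mdeg \<beta> = 2" if "co (y j) \<beta> \<noteq> 0" for \<beta>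
  proof -
    have "\<beta> j \<noteq> 0" "dec j \<beta> = 0"
      using that co_right[OF unit_carr, of j \<beta>] by (auto simp: unit_left y_carr co_unit split: if_splits)
    then show ?thesis using mdeg_dec[of \<beta> j] by simp
  qed
  then show ?thesis by (simp add: zpiece_def piece_eq y_carr)
qed

lemma co_zpiece: "u \<in> zpiece n \<Longrightarrow> n \<noteq> 0 \<Longrightarrow> co u 0 = 0"
  by (force simp: zpiece_def piece_eq split: if_splits)

lemma unit_zpiece: "scl A c (unit A) \<in> zpiece 0"
  by (auto simp: zpiece_def piece_0)

text \<open>Grades a free module by placing all its generators in degree \<open>s\<close>;
  homogeneous parts are taken coordinatewise and finitely many are nonzero because supports are
  finite.\<close>

lemma direct_sum_pm_set:
  "direct_sum_of (pm_set I (carr A)) (\<lambda>n. {f \<in> pm_set I (carr A). \<forall>k. lookup f k \<in> zpiece (n - s)})"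
proof (rule direct_sum_ofI[where pr = "\<lambda>n. Poly_Mapping.map (zpart (n - s))"])
  let ?X = "pm_set I (carr A)"
  have lk: "lookup (Poly_Mapping.map (zpart n) f) k = zpart n (lookup f k)" for n f k
    by (simp add: lookup_map_zero)
  show "additive_group ?X" by (rule additive_group_pm_set) (rule carr.additive_group_axioms)
  then interpret X: additive_group ?X .
  show "additive_group {f \<in> ?X. \<forall>k. lookup f k \<in> zpiece (n - s)}" for n
    by unfold_locales (auto simp: X.zero_W X.diff_W lookup_minus
        additive_group.zero_W[OF zpiece_group] additive_group.diff_W[OF zpiece_group])
  fix f assume f: "f \<in> ?X"
  have fc: "lookup f k \<in> carr A" for k using f by (rule pm_set_lookup)
  show "Poly_Mapping.map (zpart (n - s)) f \<in> {f \<in> ?X. \<forall>k. lookup f k \<in> zpiece (n - s)}" for n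
    using f keys_map_subset[of "zpart (n - s)" f] zpart_piece[OF fc] zpart_carr[OF fc]
    by (auto simp: pm_set_def lk)
  define N where "N = {n. Poly_Mapping.map (zpart (n - s)) f \<noteq> 0}"
  have N_sup: "{n. zpart (n - s) (lookup f k) \<noteq> 0} \<subseteq> N" for k
    unfolding N_def by (auto simp flip: lk)
  have "N \<subseteq> (\<Union>k\<in>keys f. {n. zpart (n - s) (lookup f k) \<noteq> 0})"
  proof
    fix n assume "n \<in> N"
    then obtain k where k: "zpart (n - s) (lookup f k) \<noteq> 0"
      unfolding N_def using lk by (metis (mono_tags, lifting) lookup_zero mem_Collect_eq poly_mapping_eqI)
    then have "k \<in> keys f" by (auto simp: in_keys_iff)
    then show "n \<in> (\<Union>k\<in>keys f. {n. zpart (n - s) (lookup f k) \<noteq> 0})"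
      using k by blast
  qed
  moreover have "finite {n. zpart (n - s) u \<noteq> 0}" if "u \<in> carr A" for u
    using finite_vimageI[OF zpart_finite(1)[OF that], of "\<lambda>n. n - s"] by (simp add: inj_def vimage_def)
  ultimately have N_fin: "finite N" using fc by (auto intro: finite_subset)
  then show "finite {n. Poly_Mapping.map (zpart (n - s)) f \<noteq> 0}" by (simp add: N_def)
  show "f = (\<Sum>n | Poly_Mapping.map (zpart (n - s)) f \<noteq> 0. Poly_Mapping.map (zpart (n - s)) f)"
  proof (rule poly_mapping_eqI)
    fix k
    have "(\<Sum>n\<in>N. zpart (n - s) (lookup f k)) = (\<Sum>n\<in>(\<lambda>n. n - s) ` N. zpart n (lookup f k))"
      by (subst sum.reindex) (auto simp: inj_on_def)
    also have "\<dots> = lookup f k"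
    proof (rule zpart_finite(2)[OF fc])
      show "{n. zpart n (lookup f k) \<noteq> 0} \<subseteq> (\<lambda>n. n - s) ` N"
      proof
        fix n assume "n \<in> {n. zpart n (lookup f k) \<noteq> 0}"
        then have "n + s \<in> N" using N_sup[of k] by auto
        then show "n \<in> (\<lambda>n. n - s) ` N" by (intro image_eqI[of _ _ "n + s"]) auto
      qed
    qed (use N_fin in simp)
    finally show "lookup f k = lookup
        (\<Sum>n | Poly_Mapping.map (zpart (n - s)) f \<noteq> 0. Poly_Mapping.map (zpart (n - s)) f) k"
      by (simp add: lookup_sum lk N_def)
  qed
  fix g i assume g: "g \<in> ?X"
  show "Poly_Mapping.map (zpart (i - s)) (f + g) = Poly_Mapping.map (zpart (i - s)) f + Poly_Mapping.map (zpart (i - s)) g"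
    by (intro poly_mapping_eqI) (simp add: lk lookup_add zpart_add fc pm_set_lookup[OF g])
next
  fix i j f assume f: "f \<in> {f \<in> pm_set I (carr A). \<forall>k. lookup f k \<in> zpiece (j - s)}"
  then have fz: "lookup f k \<in> zpiece (j - s)" for k by simp
  show "Poly_Mapping.map (zpart (i - s)) f = (if i = j then f else 0)"
    by (intro poly_mapping_eqI) (simp add: lookup_map_zero zpart_of_piece[OF fz])
qed auto

lemma is_lmod_trivial: "is_lmod A (trivial_gmod A 0)"
  by (auto simp: is_lmod_def trivial_gmod_def aug_eq co_add co_mul_0 co_unit carr.add_W mul_carr unit_carr
      algebra_simps)

lemma lmodule_trivial: "lmodule A (trivial_gmod A 0)"
  by unfold_locales (rule is_lmod_trivial)

lemma ks_trivial: "lmodule.ks A (trivial_gmod A 0) c x = c * x"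
  unfolding lmodule.ks_def[OF lmodule_trivial]
  by (simp add: trivial_gmod_def aug_eq scl_carr unit_carr co_scl co_unit)

interpretation Tr: koszul_resolution A y eps lam rho co "trivial_gmod A 0" "{1}" "single 1"
proof (intro koszul_resolution.intro skew_coords_axioms lmodule_basis.intro lmodule_trivial
    lmodule_basis_axioms.intro)
  fix x x' b c :: 'k
  show "{1} \<subseteq> mcarr (trivial_gmod A 0)" by (simp add: trivial_gmod_def)
  show "keys (single 1 x) \<subseteq> {1 :: 'k}" by simp
  show "single 1 (x + x') = single 1 x + single (1 :: 'k) x'"
    by (rule single_add)
  show "lookup (single 1 (lmodule.ks A (trivial_gmod A 0) c x)) b
      = c * lookup (single 1 x) b"
    by (simp add: ks_trivial lookup_single when_def)
  show "b \<in> {1} \<Longrightarrow> single 1 b = single b 1" by simp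
  show "x = (\<Sum>b\<in>keys (single 1 x).
      lmodule.ks A (trivial_gmod A 0) (lookup (single 1 x) b) b)"
    by (simp add: ks_trivial)
qed

abbreviation coef :: "('k \<times> 'a \<times> nat \<Rightarrow>\<^sub>0 'a) \<Rightarrow> idx set \<Rightarrow> 'a" where
  "coef f L \<equiv> lookup f (chain_index 1 L)"

text \<open>The variables have degree 2, so an exterior monomial in \<open>p\<close> of them is
  placed in degree \<open>2 * p\<close>; this makes the differential homogeneous of degree
  0.\<close>

definition gP :: "nat \<Rightarrow> ('a, 'k \<times> 'a \<times> nat \<Rightarrow>\<^sub>0 'a) gmod" where
  "gP p = \<lparr>mcarr = mcarr (Tr.koszul_P p), act = act (Tr.koszul_P p),
     mpiece = (\<lambda>n. {f \<in> mcarr (Tr.koszul_P p). \<forall>k. lookup f k \<in> zpiece (n - 2 * int p)})\<rparr>"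

lemma mcarr_gP: "mcarr (gP p) = pm_set (chain_basis {1} p) (carr A)"
  by (simp add: gP_def Tr.mcarr_koszul_P)

lemma mpiece_gP:
  "mpiece (gP p) n = {f \<in> mcarr (gP p). \<forall>k. lookup f k \<in> zpiece (n - 2 * int p)}"
  by (simp add: gP_def)

lemma mpiece_gPD:
  assumes "f \<in> mpiece (gP p) n"
  shows "f \<in> mcarr (gP p)" "lookup f k \<in> zpiece (n - 2 * int p)"
  using assms unfolding mpiece_gP by blast+

lemma coef_carr: "f \<in> mcarr (gP p) \<Longrightarrow> coef f L \<in> carr A"
  unfolding mcarr_gP by (rule pm_set_lookup)

lemma lookup_act_gP:
  "a \<in> carr A \<Longrightarrow> lookup (act (gP p) a f) k = mul A a (lookup f k)"
  by (simp add: gP_def Tr.koszul_P_def lookup_free_act)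

lemma lookup_outside:
  assumes "f \<in> mcarr (gP p)" "k \<notin> chain_index 1 ` {L. card L = p}"
  shows "lookup f k = 0"
proof -
  have "k \<notin> chain_basis {1} p" using assms(2) by (auto simp: chain_basis_def)
  then show ?thesis using assms(1) by (auto simp: mcarr_gP pm_set_def in_keys_iff)
qed

lemma resolution_gP: "projective_resolution A (trivial_gmod A 0) gP (\<lambda>_. Tr.koszul_delta) Tr.koszul_aug"
  using Tr.koszul_projective_resolution
  by (simp add: projective_resolution_def projective_def is_lmod_def is_hom_def gP_def)

lemma is_lmod_gP: "is_lmod A (gP p)"
  using resolution_gP by (simp add: projective_resolution_def projective_def)

lemma is_gmod_gP: "is_gmod A (gP p)"
  unfolding is_gmod_def
proof (intro conjI allI ballI)
  show "is_lmod A (gP p)" by (rule is_lmod_gP)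
  show "direct_sum_of (mcarr (gP p)) (mpiece (gP p))"
    unfolding mpiece_gP[abs_def] mcarr_gP by (rule direct_sum_pm_set)
  fix i j a f assume a: "a \<in> piece A i" and f: "f \<in> mpiece (gP p) j"
  have ac: "a \<in> carr A" and az: "a \<in> zpiece (int i)" using a by (simp_all add: piece_carr zpiece_def)
  have "act (gP p) a f \<in> mcarr (gP p)"
    using is_lmod_gP ac f by (simp add: is_lmod_def mpiece_gP)
  moreover have "mul A a (lookup f k) \<in> zpiece (int i + j - 2 * int p)" for k
    using zpiece_mul[OF az mpiece_gPD(2)[OF f, of k]] by (simp add: add_diff_eq)
  ultimately show "act (gP p) a f \<in> mpiece (gP p) (int i + j)"
    by (simp add: mpiece_gP lookup_act_gP[OF ac])
qed

text \<open>On \<open>K\<close> the variables act by zero, so the part of the differential that acts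
  on the module drops out.\<close>

lemma coef_delta:
  "coef (Tr.koszul_delta f) L = (\<Sum>j\<in>- L. sg (left_sign eps j L) (mul A (coef f (insert j L)) (y j)))"
proof -
  have "act (trivial_gmod A 0) (y j) b = 0" for j b
    by (simp add: trivial_gmod_def aug_eq y_carr co_y_0)
  then have "Tr.Sm j v = 0" for j v
    by (simp add: Tr.Sm_def pm_ext_def)
  then show ?thesis
    by (simp add: Tr.koszul_delta_def lookup_chain_mk Tr.K.koszul_b_def koszul_d_def lookup_sum lookup_sg
        Tr.lookup_Rm lookup_chain_at lookup_minus)
qed

lemma delta_gP: "f \<in> mcarr (gP (Suc p)) \<Longrightarrow> Tr.koszul_delta f \<in> mcarr (gP p)"
  using Tr.koszul_delta_P by (simp add: gP_def)

lemma delta_delta_gP: "f \<in> mcarr (gP (Suc (Suc p))) \<Longrightarrow> Tr.koszul_delta (Tr.koszul_delta f) = 0"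
  using resolution_gP unfolding projective_resolution_def by blast

lemma zpiece_sg: "u \<in> zpiece n \<Longrightarrow> sg b u \<in> zpiece n"
  by (rule additive_group.sg_W[OF zpiece_group])

lemma graded_resolution_gP:
  "graded_projective_resolution A (trivial_gmod A 0) gP (\<lambda>_. Tr.koszul_delta) Tr.koszul_aug"
  unfolding graded_projective_resolution_def
proof (intro conjI allI)
  fix i
  show "is_graded_hom A (gP (Suc i)) (gP i) 0 Tr.koszul_delta"
    unfolding is_graded_hom_def
  proof (intro conjI allI subsetI)
    show "is_hom A (gP (Suc i)) (gP i) Tr.koszul_delta"
      using resolution_gP by (simp add: projective_resolution_def)
    fix n x assume "x \<in> Tr.koszul_delta ` mpiece (gP (Suc i)) n"
    then obtain f where f: "f \<in> mpiece (gP (Suc i)) n" and x: "x = Tr.koszul_delta f" by blast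
    have xm: "x \<in> mcarr (gP i)" using f delta_gP by (simp add: x mpiece_gP)
    have "coef x L \<in> zpiece (n - 2 * int i)" for L
      unfolding x coef_delta
    proof (intro additive_group.sum_W[OF zpiece_group] zpiece_sg)
      fix j
      have "coef f (insert j L) \<in> zpiece (n - 2 * int (Suc i))" by (rule mpiece_gPD(2)[OF f])
      from zpiece_mul[OF this y_zpiece[of j]]
      show "mul A (coef f (insert j L)) (y j) \<in> zpiece (n - 2 * int i)" by simp
    qed
    then have "lookup x k \<in> zpiece (n - 2 * int i)" for k
      using lookup_outside[OF xm, of k] additive_group.zero_W[OF zpiece_group]
      by (cases "k \<in> chain_index 1 ` {L. card L = i}") auto
    then show "x \<in> mpiece (gP i) (n + 0)" using xm by (simp add: mpiece_gP)
  qed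
next
  show "is_graded_hom A (gP 0) (trivial_gmod A 0) 0 Tr.koszul_aug"
    unfolding is_graded_hom_def
  proof (intro conjI allI subsetI)
    show "is_hom A (gP 0) (trivial_gmod A 0) Tr.koszul_aug"
      using resolution_gP by (simp add: projective_resolution_def)
    fix n x assume "x \<in> Tr.koszul_aug ` mpiece (gP 0) n"
    then obtain f where f: "f \<in> mpiece (gP 0) n" and x: "x = Tr.koszul_aug f" by blast
    have z: "coef f {} \<in> zpiece n" using mpiece_gPD(2)[OF f, of "chain_index 1 {}"] by simp
    have "chain_at f {} \<in> pm_set {1} (carr A)"
      using f by (intro chain_at_pm_set[of _ _ 0]) (simp add: mpiece_gP mcarr_gP)
    then have K: "keys (chain_at f {}) \<subseteq> {1}" by (simp add: pm_set_def)
    have "x = (\<Sum>b\<in>{1}. act (trivial_gmod A 0) (lookup (chain_at f {}) b) b)"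
      unfolding x Tr.koszul_aug_def Tr.ev_def
      by (rule pm_ext_superset[OF _ K]) (simp_all add: trivial_gmod_def aug_eq carr.zero_W)
    then have "x = co (coef f {}) 0"
      using zpiece_carr[OF z] by (simp add: lookup_chain_at trivial_gmod_def aug_eq)
    then show "x \<in> mpiece (trivial_gmod A 0) (n + 0)"
      using co_zpiece[OF z] by (auto simp: trivial_gmod_def)
  qed
qed (fact resolution_gP is_gmod_gP)+

definition gen :: "idx set \<Rightarrow> ('k \<times> 'a \<times> nat \<Rightarrow>\<^sub>0 'a)" where
  "gen L = single (chain_index 1 L) (unit A)"

lemma gen_gP: "gen L \<in> mcarr (gP (card L))"
  unfolding gen_def mcarr_gP
  by (rule single_pm_set) (auto simp: chain_basis_def unit_carr carr.zero_W)

lemma coef_gen: "coef (gen L) L' = (if L' = L then unit A else 0)"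
  by (auto simp: gen_def lookup_single when_def chain_index_eq)

lemma gen_mpiece: "gen L \<in> mpiece (gP (card L)) (2 * int (card L))"
proof -
  have "lookup (gen L) k \<in> zpiece 0" for k
    using unit_zpiece[of 1] additive_group.zero_W[OF zpiece_group]
    by (simp add: gen_def lookup_single when_def)
  then show ?thesis by (simp add: mpiece_gP gen_gP)
qed

section \<open>The dual complex\<close>

text \<open>A homomorphism from a free module is given by the images of its generators; this one
  sends \<open>gen L\<close> to \<open>g L\<close> and is normalised to 0 outside the carrier as
  \<open>dual_piece\<close> demands.\<close>

definition dual_hom :: "nat \<Rightarrow> (idx set \<Rightarrow> 'a) \<Rightarrow> ('k \<times> 'a \<times> nat \<Rightarrow>\<^sub>0 'a) \<Rightarrow> 'a" where
  "dual_hom p g x = (if x \<in> mcarr (gP p) then \<Sum>L | card L = p. mul A (coef x L) (g L) else 0)"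

lemma hom_gP_eq:
  assumes f: "is_hom A (gP p) (regular_gmod A) f" and x: "x \<in> mcarr (gP p)"
  shows "f x = (\<Sum>L | card L = p. mul A (coef x L) (f (gen L)))"
proof -
  have fc: "f v \<in> carr A" if "v \<in> mcarr (gP p)" for v
    using f that by (simp add: is_hom_def regular_gmod_def)
  have fadd: "f (v + w) = f v + f w" if "v \<in> mcarr (gP p)" "w \<in> mcarr (gP p)" for v w
    using f that by (simp add: is_hom_def)
  have fs: "f (single (chain_index 1 L) a) = mul A a (f (gen L))"
    if a: "a \<in> carr A" and L: "card L = p" for a L
  proof -
    have "single (chain_index 1 L) a = act (gP p) a (gen L)"
      by (intro poly_mapping_eqI)
        (simp add: lookup_act_gP[OF a] gen_def lookup_single when_def unit_right[OF a] mul_zero_right[OF a])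
    then show ?thesis using f a gen_gP[of L] L by (simp add: is_hom_def regular_gmod_def)
  qed
  let ?S = "chain_index 1 ` {L. card L = p} :: ('k \<times> 'a \<times> nat) set"
  have keys: "keys x \<subseteq> ?S"
  proof
    fix k assume "k \<in> keys x"
    then show "k \<in> ?S" using lookup_outside[OF x, of k] unfolding in_keys_iff by blast
  qed
  have z: "0 \<in> mcarr (gP p)" using is_lmod_gP by (simp add: is_lmod_def)
  have f0: "f 0 = 0" using fadd[OF z z] by simp
  have "f x = (\<Sum>k\<in>keys x. f (single k (lookup x k)))"
    by (rule additive_expand[OF carr.additive_group_axioms fadd[unfolded mcarr_gP] x[unfolded mcarr_gP]])
  also have "\<dots> = (\<Sum>k\<in>?S. f (single k (lookup x k)))"
    using keys by (intro sum.mono_neutral_left) (auto simp: in_keys_iff f0)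
  also have "\<dots> = (\<Sum>L | card L = p. f (single (chain_index 1 L) (coef x L)))"
    by (subst sum.reindex) (auto simp: inj_on_def chain_index_eq)
  also have "\<dots> = (\<Sum>L | card L = p. mul A (coef x L) (f (gen L)))"
    by (intro sum.cong) (simp_all add: fs coef_carr[OF x])
  finally show ?thesis .
qed

lemma dual_hom_carr: "(\<And>L. g L \<in> carr A) \<Longrightarrow> dual_hom p g x \<in> carr A"
  unfolding dual_hom_def by (auto intro!: carr.sum_W mul_carr coef_carr carr.zero_W)

lemma dual_hom_hom:
  assumes g: "\<And>L. g L \<in> carr A"
  shows "is_hom A (gP p) (regular_gmod A) (dual_hom p g)"
  unfolding is_hom_def
proof (intro conjI ballI)
  fix x z a assume x: "x \<in> mcarr (gP p)"
  show "dual_hom p g x \<in> mcarr (regular_gmod A)"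
    by (simp add: regular_gmod_def dual_hom_carr g)
  show "dual_hom p g (x + z) = dual_hom p g x + dual_hom p g z" if z: "z \<in> mcarr (gP p)"
  proof -
    have "x + z \<in> mcarr (gP p)"
      using x z additive_group.add_W[OF additive_group_pm_set[OF carr.additive_group_axioms]]
      unfolding mcarr_gP by blast
    then show ?thesis
      using x z by (simp add: dual_hom_def lookup_add mul_add_left coef_carr g sum.distrib)
  qed
  show "dual_hom p g (act (gP p) a x) = act (regular_gmod A) a (dual_hom p g x)" if a: "a \<in> carr A"
  proof -
    have "act (gP p) a x \<in> mcarr (gP p)" using is_lmod_gP x a by (simp add: is_lmod_def)
    then show ?thesis
      using x a by (simp add: dual_hom_def regular_gmod_def lookup_act_gP mul_assoc coef_carr g
          additive_op.op_sum[OF left_mul_op] mul_carr)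
  qed
qed

lemma dual_hom_gen: "(\<And>L. g L \<in> carr A) \<Longrightarrow> card L = p \<Longrightarrow> dual_hom p g (gen L) = g L"
proof -
  assume g: "\<And>L. g L \<in> carr A" and L: "card L = p"
  have "dual_hom p g (gen L) = (\<Sum>L' | card L' = p. if L' = L then g L else 0)"
  proof -
    have "(\<Sum>L' | card L' = p. mul A (coef (gen L) L') (g L')) = (\<Sum>L' | card L' = p. if L' = L then g L else 0)"
      by (intro sum.cong) (auto simp: coef_gen unit_left g mul_zero_left)
    then show ?thesis using gen_gP[of L] L by (simp only: dual_hom_def if_True)
  qed
  then show ?thesis using L by simp
qed

lemma dual_piece_sum:
  assumes N: "finite N" and h: "\<And>n. n \<in> N \<Longrightarrow> h n \<in> dual_piece A (gP p) n"
  shows "\<exists>g. (\<forall>L. g L \<in> carr A) \<and> (\<forall>L. g L \<noteq> 0 \<longrightarrow> card L = p) \<and> (\<Sum>n\<in>N. h n) = dual_hom p g"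
proof -
  define g where "g L = (if card L = p then \<Sum>n\<in>N. h n (gen L) else 0)" for L
  have hom: "is_hom A (gP p) (regular_gmod A) (h n)" and out: "x \<notin> mcarr (gP p) \<Longrightarrow> h n x = 0" if "n \<in> N" for n x
    using h[OF that] by (auto simp: dual_piece_def is_graded_hom_def)
  have hc: "h n (gen L) \<in> carr A" if "n \<in> N" "card L = p" for n L
    using hom[OF that(1)] gen_gP[of L] that(2) by (auto simp: is_hom_def regular_gmod_def)
  have "(\<Sum>n\<in>N. h n) x = dual_hom p g x" for x
  proof (cases "x \<in> mcarr (gP p)")
    case True
    have "(\<Sum>n\<in>N. h n x) = (\<Sum>n\<in>N. \<Sum>L | card L = p. mul A (coef x L) (h n (gen L)))"
      by (intro sum.cong HOL.refl hom_gP_eq hom True)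
    also have "\<dots> = (\<Sum>L | card L = p. \<Sum>n\<in>N. mul A (coef x L) (h n (gen L)))" by (rule sum.swap)
    also have "\<dots> = (\<Sum>L | card L = p. mul A (coef x L) (g L))"
      by (intro sum.cong) (auto simp: g_def additive_op.op_sum[OF left_mul_op[OF coef_carr[OF True]]] hc)
    finally show ?thesis using True by (simp add: dual_hom_def sum_fun_apply)
  next
    case False
    then show ?thesis using out by (simp add: dual_hom_def sum_fun_apply)
  qed
  moreover have "g L \<in> carr A" for L by (auto simp: g_def hc intro!: carr.sum_W carr.zero_W)
  ultimately show ?thesis by (intro exI[of _ g]) (auto simp: g_def)
qed

lemma dual_hom_piece:
  fixes g :: "idx set \<Rightarrow> 'a"
  assumes g: "\<And>L. card L = p \<Longrightarrow> g L \<in> zpiece (n + 2 * int p)" and gc: "\<And>L. g L \<in> carr A"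
  shows "dual_hom p g \<in> dual_piece A (gP p) n"
  unfolding dual_piece_def is_graded_hom_def
proof (intro CollectI conjI allI impI subsetI)
  show "is_hom A (gP p) (regular_gmod A) (dual_hom p g)" by (rule dual_hom_hom[OF gc])
  fix j u assume "u \<in> dual_hom p g ` mpiece (gP p) j"
  then obtain x where x: "x \<in> mpiece (gP p) j" and u: "u = dual_hom p g x" by blast
  have "(\<Sum>L | card L = p. mul A (coef x L) (g L)) \<in> zpiece (j + n)"
  proof (rule additive_group.sum_W[OF zpiece_group])
    fix L :: "idx set" assume "L \<in> {L. card L = p}"
    then show "mul A (coef x L) (g L) \<in> zpiece (j + n)"
      using zpiece_mul[OF mpiece_gPD(2)[OF x, of "chain_index 1 L"] g[of L]] by simp
  qed
  then show "u \<in> mpiece (regular_gmod A) (j + n)"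
    using mpiece_gPD(1)[OF x] by (simp add: u dual_hom_def regular_gmod_def zpiece_def)
qed (simp add: dual_hom_def)

text \<open>There are finitely many generators, and each image has finitely many homogeneous
  components; so the graded dual contains every homomorphism.\<close>

lemma dual_hom_mem:
  assumes gc: "\<And>L. g L \<in> carr A"
  shows "dual_hom p g \<in> mcarr (dual_gmod A (gP p))"
proof -
  \<comment> \<open>A homomorphism of degree \<open>n\<close> sends generators of degree
    \<open>2 * p\<close> into degree \<open>n + 2 * p\<close>.\<close>
  define N where "N = (\<Union>L\<in>UNIV. {n. zpart (n + 2 * int p) (g L) \<noteq> 0})"
  have "finite {n. zpart (n + 2 * int p) u \<noteq> 0}" if "u \<in> carr A" for u
    using finite_vimageI[OF zpart_finite(1)[OF that], of "\<lambda>n. n + 2 * int p"] by (simp add: inj_def vimage_def)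
  then have N: "finite N" unfolding N_def using gc by auto
  have gsum: "(\<Sum>n\<in>N. zpart (n + 2 * int p) (g L)) = g L" for L
  proof -
    have "(\<Sum>n\<in>N. zpart (n + 2 * int p) (g L)) = (\<Sum>n\<in>(\<lambda>n. n + 2 * int p) ` N. zpart n (g L))"
      by (subst sum.reindex) (auto simp: inj_on_def)
    also have "\<dots> = g L"
    proof (rule zpart_finite(2)[OF gc])
      show "{n. zpart n (g L) \<noteq> 0} \<subseteq> (\<lambda>n. n + 2 * int p) ` N"
      proof
        fix n assume "n \<in> {n. zpart n (g L) \<noteq> 0}"
        then have "n - 2 * int p \<in> N" by (auto simp: N_def)
        then show "n \<in> (\<lambda>n. n + 2 * int p) ` N" by (intro image_eqI[of _ _ "n - 2 * int p"]) auto
      qed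
    qed (use N in simp)
    finally show ?thesis .
  qed
  define h where "h n = dual_hom p (\<lambda>L. zpart (n + 2 * int p) (g L))" for n
  have "h n \<in> dual_piece A (gP p) n" for n
    unfolding h_def by (rule dual_hom_piece) (auto simp: zpart_piece zpart_carr gc)
  moreover have "dual_hom p g = (\<Sum>n\<in>N. h n)"
  proof
    fix x
    show "dual_hom p g x = (\<Sum>n\<in>N. h n) x"
    proof (cases "x \<in> mcarr (gP p)")
      case True
      have "(\<Sum>n\<in>N. h n x) = (\<Sum>L | card L = p. \<Sum>n\<in>N. mul A (coef x L) (zpart (n + 2 * int p) (g L)))"
        using True by (simp add: h_def dual_hom_def) (rule sum.swap)
      also have "\<dots> = (\<Sum>L | card L = p. mul A (coef x L) (g L))"
        by (intro sum.cong HOL.refl)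
          (simp add: additive_op.op_sum[OF left_mul_op[OF coef_carr[OF True]], symmetric] zpart_carr gc gsum)
      finally show ?thesis using True by (simp add: dual_hom_def sum_fun_apply)
    qed (simp add: dual_hom_def h_def sum_fun_apply)
  qed
  ultimately show ?thesis using N unfolding dual_gmod_def by auto
qed

lemma dual_memE:
  assumes "f \<in> mcarr (dual_gmod A (gP p))"
  obtains g where "\<And>L. g L \<in> carr A" "\<And>L. g L \<noteq> 0 \<Longrightarrow> card L = p" "f = dual_hom p g"
proof -
  obtain N h where "finite N" "\<And>n. n \<in> N \<Longrightarrow> h n \<in> dual_piece A (gP p) n" and f: "f = (\<Sum>n\<in>N. h n)"
    using assms by (auto simp: dual_gmod_def)
  from dual_piece_sum[OF this(1,2)] that show thesis unfolding f by blast
qed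

text \<open>The transposed differential on images of generators. It multiplies by the variables from
  the left, because a homomorphism of left modules multiplies coefficients on the right.\<close>

definition cod :: "(idx set \<Rightarrow> 'a) \<Rightarrow> idx set \<Rightarrow> 'a" where
  "cod g L = (\<Sum>j\<in>L. sg (left_sign eps j (L - {j})) (mul A (y j) (g (L - {j}))))"

lemma cod_carr: "(\<And>L. g L \<in> carr A) \<Longrightarrow> cod g L \<in> carr A"
  unfolding cod_def by (intro carr.sum_W carr.sg_W mul_carr y_carr)

lemma dual_hom_delta:
  assumes g: "\<And>L. g L \<in> carr A" and x: "x \<in> mcarr (gP (Suc p))"
  shows "dual_hom p g (Tr.koszul_delta x) = dual_hom (Suc p) (cod g) x"
proof -
  note xc = coef_carr[OF x]
  let ?t = "\<lambda>L j. sg (left_sign eps j L) (mul A (coef x (insert j L)) (mul A (y j) (g L)))"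
  have "mul A (\<Sum>j\<in>- L. sg (left_sign eps j L) (mul A (coef x (insert j L)) (y j))) (g L) = (\<Sum>j\<in>- L. ?t L j)" for L
    by (subst additive_op.op_sum[OF right_mul_op[OF g]])
      (auto simp: carr.sg_W mul_carr xc y_carr additive_op.op_sg[OF right_mul_op[OF g]] mul_assoc g)
  then have "dual_hom p g (Tr.koszul_delta x) = (\<Sum>L | card L = p. \<Sum>j\<in>- L. ?t L j)"
    using delta_gP[OF x] by (simp add: dual_hom_def coef_delta)
  also have "\<dots> = (\<Sum>(L, j)\<in>Sigma {L. card L = p} uminus. ?t L j)"
    by (rule sum.Sigma) auto
  also have "\<dots> = (\<Sum>(L, j)\<in>Sigma {L. card L = Suc p} (\<lambda>L. L). ?t (L - {j}) j)"
    by (rule sum.reindex_bij_witness[of _ "\<lambda>(L, j). (L - {j}, j)" "\<lambda>(L, j). (insert j L, j)"])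
      (auto simp: insert_absorb card_Diff_singleton)
  also have "\<dots> = (\<Sum>L | card L = Suc p. \<Sum>j\<in>L. ?t (L - {j}) j)"
    by (rule sum.Sigma[symmetric]) auto
  also have "\<dots> = (\<Sum>L | card L = Suc p. mul A (coef x L) (cod g L))"
  proof (rule sum.cong[OF HOL.refl])
    fix L
    have "(\<Sum>j\<in>L. ?t (L - {j}) j) = (\<Sum>j\<in>L. mul A (coef x L) (sg (left_sign eps j (L - {j})) (mul A (y j) (g (L - {j})))))"
      by (intro sum.cong HOL.refl)
        (simp add: insert_absorb additive_op.op_sg[OF left_mul_op[OF xc]] mul_carr y_carr g)
    then show "(\<Sum>j\<in>L. ?t (L - {j}) j) = mul A (coef x L) (cod g L)"
      unfolding cod_def
      by (subst additive_op.op_sum[OF left_mul_op[OF xc]]) (auto simp: carr.sg_W mul_carr y_carr g)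
  qed
  finally show ?thesis using x by (simp add: dual_hom_def)
qed

text \<open>
  Passing to complements of index sets turns the dual of the Koszul complex into a Koszul complex
  for multiplication on the other side.
\<close>

lemma cod_exact:
  assumes g: "\<And>L. g L \<in> carr A" and supp: "\<And>L. g L \<noteq> 0 \<Longrightarrow> card L = p" and cyc: "\<And>L. cod g L = 0"
    and p: "p \<le> 4"
  shows "\<exists>g'. (\<forall>L. g' L \<in> carr A) \<and> (\<forall>L. g' L \<noteq> 0 \<longrightarrow> Suc (card L) = p) \<and>
    (\<forall>L. g L = cod g' L + (if L = UNIV then scl A (co (g UNIV) 0) (unit A) else 0))"
proof -
  interpret L: koszul "carr A" "\<lambda>j u. mul A (y j) u" ldel trunc eps by (rule left_koszul)
  \<comment> \<open>Complementation turns deleting \<open>j\<close> from an index set into inserting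
    it; this is the sign of \<open>cod\<close> read at complements.\<close>
  define kap where "kap j K = left_sign eps j (- insert j K)" for j K
  have kap: "koszul_sign eps kap"
    unfolding koszul_sign_def
  proof (intro allI impI)
    fix K j k assume *: "j \<notin> K \<and> k \<notin> K \<and> j \<noteq> (k :: idx)"
    \<comment> \<open>All four index sets in the sign rule are \<open>N\<close> with at most one of
      \<open>j\<close>, \<open>k\<close> added, so the rule reduces to
      \<open>left_sign_insert\<close>.\<close>
    define N where "N = - insert j (insert k K)"
    have N: "- insert j K = insert k N" "- insert k K = insert j N" "- insert k (insert j K) = N"
      "- insert j (insert k K) = N" "j \<notin> N" "k \<notin> N"
      using * by (auto simp: N_def)
    have "j < k \<longleftrightarrow> \<not> k < j" using * by auto
    then show "((kap j K \<noteq> kap k (insert j K)) \<noteq> eps j k) \<longleftrightarrow> (kap k K = kap j (insert k K))"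
      using N(5,6) eps_sym[of j k] * by (auto simp: kap_def N(1-4) left_sign_insert)
  qed
  have d: "koszul_d kap (\<lambda>j u. mul A (y j) u) (\<lambda>K. f (- K)) K = cod f (- K)" for f K
    unfolding koszul_d_def cod_def
    by (intro sum.cong) (auto simp: kap_def Compl_insert intro!: arg_cong2[where f = sg] arg_cong[where f = "\<lambda>L. mul A _ (f L)"])
  define h where "h = koszul_h kap ldel (\<lambda>K. g (- K))"
  define g' where "g' L = h (- L)" for L
  have h: "h = (\<lambda>K. g' (- K))" by (simp add: g'_def)
  have del0: "ldel j 0 = 0" for j by (rule additive_op.op_zero[OF L.del_op])
  have hc: "h K \<in> carr A" for K unfolding h_def by (rule L.koszul_h_W) (rule g)
  \<comment> \<open>The part free of variables, at \<open>{}\<close> in the Koszul complex, ends up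
    at \<open>UNIV\<close>; this is why the cohomology sits in degree 4.\<close>
  have "g L = cod g' L + (if L = UNIV then scl A (co (g UNIV) 0) (unit A) else 0)" for L
  proof -
    have "koszul_h kap ldel (koszul_d kap (\<lambda>j u. mul A (y j) u) (\<lambda>K. g (- K))) (- L) = 0"
      by (simp add: koszul_h_def d cyc del0)
    moreover have "koszul_d kap (\<lambda>j u. mul A (y j) u) h (- L) = cod g' L"
      unfolding h d by simp
    moreover have "- L = {} \<longleftrightarrow> L = UNIV" by auto
    ultimately show ?thesis
      using L.koszul_homotopy[OF kap, of "\<lambda>K. g (- K)" "- L", OF g] trunc_5[OF g]
      by (auto simp: h_def[symmetric])
  qed
  moreover have "Suc (card L) = p" if "g' L \<noteq> 0" for L
  proof -
    have "card K = 4 - p" if "g (- K) \<noteq> 0" for K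
      using supp[OF that] card_Compl_idx[of K] card_idx_le[of K] by linarith
    then have "card (- L) = Suc (4 - p)"
      using koszul_h_support[where F = "\<lambda>K. g (- K)" and del = ldel and kap = kap and L = "- L"] del0 that
      unfolding g'_def h_def by blast
    then show ?thesis using p card_Compl_idx[of L] card_idx_le[of L] by linarith
  qed
  ultimately show ?thesis using hc by (intro exI[of _ g']) (auto simp: g'_def)
qed

lemma cod_support:
  assumes "\<And>L. g L \<noteq> 0 \<Longrightarrow> card L = p" "cod g L \<noteq> 0"
  shows "card L = Suc p"
proof -
  obtain j where j: "j \<in> L" "sg (left_sign eps j (L - {j})) (mul A (y j) (g (L - {j}))) \<noteq> 0"
    using assms(2) unfolding cod_def by (meson sum.neutral)
  then have "g (L - {j}) \<noteq> 0" using mul_zero_right[OF y_carr, of j] by auto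
  then have "card (L - {j}) = p" by (rule assms(1))
  then show ?thesis using j(1) by (metis card.remove finite_code)
qed

lemma cocycle_cod:
  assumes g: "\<And>L. g L \<in> carr A" and supp: "\<And>L. g L \<noteq> 0 \<Longrightarrow> card L = p"
    and cyc: "\<And>x. x \<in> mcarr (gP (Suc p)) \<Longrightarrow> dual_hom p g (Tr.koszul_delta x) = 0"
  shows "cod g L = 0"
proof (cases "card L = Suc p")
  case True
  then have "gen L \<in> mcarr (gP (Suc p))" using gen_gP[of L] by simp
  then have "dual_hom (Suc p) (cod g) (gen L) = 0"
    using cyc dual_hom_delta[OF g] by simp
  then show ?thesis using dual_hom_gen[OF cod_carr[OF g] True] by simp
next
  case False
  then show ?thesis using cod_support[where g = g and p = p and L = L, OF supp] by blast
qed

lemma dual_hom_zero: "dual_hom p (\<lambda>L. 0) = 0"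
  by (rule ext) (auto simp: dual_hom_def coef_carr mul_zero_right intro!: sum.neutral)

lemma zero_dual: "0 \<in> mcarr (dual_gmod A (gP p))"
  using dual_hom_mem[of "\<lambda>L. 0" p] by (simp add: dual_hom_zero carr.zero_W)

lemma dual_at_zero:
  assumes "f \<in> mcarr (dual_gmod A (gP p))"
  shows "f 0 = 0"
proof -
  obtain g where g: "\<And>L. g L \<in> carr A" "f = dual_hom p g" using dual_memE[OF assms] by metis
  then show ?thesis by (simp add: dual_hom_def mul_zero_left)
qed

lemma coboundaries_subset: "coboundaries A gP (\<lambda>_. Tr.koszul_delta) i \<subseteq> cocycles A gP (\<lambda>_. Tr.koszul_delta) i"
proof (cases i)
  case 0
  then show ?thesis by (simp add: cocycles_def zero_dual)
next
  case (Suc p)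
  show ?thesis
  proof
    fix f assume "f \<in> coboundaries A gP (\<lambda>_. Tr.koszul_delta) i"
    then obtain h where f: "f \<in> mcarr (dual_gmod A (gP i))" and h: "h \<in> mcarr (dual_gmod A (gP p))"
      and fh: "\<And>x. x \<in> mcarr (gP (Suc p)) \<Longrightarrow> f x = h (Tr.koszul_delta x)"
      by (auto simp: Suc)
    have "f (Tr.koszul_delta x) = 0" if "x \<in> mcarr (gP (Suc i))" for x
      using that delta_gP[of x i] delta_delta_gP[of x p] dual_at_zero[OF h] fh by (simp add: Suc)
    then show "f \<in> cocycles A gP (\<lambda>_. Tr.koszul_delta) i" using f by (simp add: cocycles_def)
  qed
qed

lemma cod_coboundary:
  assumes "\<And>L. g L \<in> carr A"
  shows "dual_hom (Suc p) (cod g) \<in> coboundaries A gP (\<lambda>_. Tr.koszul_delta) (Suc p)"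
  using dual_hom_mem[where g = "cod g" and p = "Suc p", OF cod_carr[OF assms]]
    dual_hom_mem[where g = g and p = p, OF assms] dual_hom_delta[where g = g and p = p, OF assms]
  by (auto intro!: bexI[of _ "dual_hom p g"])

text \<open>For \<open>i \<noteq> 4\<close> a cochain of degree \<open>i\<close> has no coefficient
  at \<open>UNIV\<close>, so \<open>cod_exact\<close> yields a primitive when
  \<open>i \<le> 4\<close>. In degree 0 the primitive, and hence the cocycle, is 0; above degree 4
  all cochains are 0.\<close>

lemma ext_vanishes_gP:
  assumes "i \<noteq> 4"
  shows "ext_vanishes A gP (\<lambda>_. Tr.koszul_delta) i"
  unfolding ext_vanishes_def
proof (intro equalityI coboundaries_subset subsetI)
  fix f assume f: "f \<in> cocycles A gP (\<lambda>_. Tr.koszul_delta) i"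
  then obtain g where g: "\<And>L. g L \<in> carr A" "\<And>L. g L \<noteq> 0 \<Longrightarrow> card L = i" "f = dual_hom i g"
    using dual_memE[of f i] by (auto simp: cocycles_def)
  have cyc: "cod g L = 0" for L
    using cocycle_cod[OF g(1,2)] f by (simp add: cocycles_def g(3))
  have gU: "g UNIV = 0" using g(2)[of UNIV] assms by (auto simp: UNIV_idx)
  show "f \<in> coboundaries A gP (\<lambda>_. Tr.koszul_delta) i"
  proof (cases "i \<le> 4")
    case True
    then obtain g' where g': "\<And>L. g' L \<in> carr A" "\<And>L. g' L \<noteq> 0 \<Longrightarrow> Suc (card L) = i" "\<And>L. g L = cod g' L"
      using cod_exact[OF g(1,2) cyc] gU by (auto cong: if_cong)
    have gg: "g = cod g'" using g'(3) by auto
    show ?thesis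
    proof (cases i)
      case 0
      then have "g' = (\<lambda>L. 0)" using g'(2) by auto
      then have "g = (\<lambda>L. 0)" unfolding gg by (auto simp: cod_def mul_zero_right y_carr)
      then show ?thesis using 0 by (simp add: g(3) dual_hom_zero)
    next
      case (Suc p)
      then show ?thesis unfolding g(3) gg using cod_coboundary[OF g'(1)] by simp
    qed
  next
    case False
    then have "g = (\<lambda>L. 0)" using g(2) card_idx_le by (metis not_less_eq_eq order_refl ext)
    then have "f = 0" by (simp add: g(3) dual_hom_zero)
    moreover obtain p where "i = Suc p" using False by (cases i) auto
    moreover have "cod (\<lambda>L. 0) = (\<lambda>L. 0)" by (auto simp: cod_def mul_zero_right y_carr)
    ultimately show ?thesis
      using cod_coboundary[of "\<lambda>L. 0" p] by (simp add: dual_hom_zero carr.zero_W del: coboundaries.simps)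
  qed
qed

text \<open>The class of a cocycle is the constant coefficient of its value on the top generator.
  That generator has degree 8, so a homomorphism of degree \<open>n\<close> can have a nonzero
  constant coefficient there only for \<open>n = -8\<close>: hence the shift 8. Coboundaries send
  the top generator into the augmentation ideal, and \<open>cod_exact\<close> gives the
  converse.\<close>

lemma ext_iso_gP: "ext_iso A gP (\<lambda>_. Tr.koszul_delta) 4 (trivial_gmod (op_alg A) 8)"
proof -
  let ?d = "\<lambda>_ :: nat. Tr.koszul_delta"
  let ?Z = "(dual_gmod A (gP 4))\<lparr>mcarr := cocycles A gP ?d 4,
             mpiece := \<lambda>n. cocycles A gP ?d 4 \<inter> dual_piece A (gP 4) n\<rparr>"
  have aug_op: "aug (op_alg A) a = co a 0" if "a \<in> carr A" for a
    using aug_eq[OF that] by (simp add: aug_def op_alg_def)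
  have UNIV4: "card (UNIV :: idx set) = 4" by (simp add: UNIV_idx)
  define \<phi> where "\<phi> f = co (f (gen UNIV)) 0" for f :: "('k \<times> 'a \<times> nat \<Rightarrow>\<^sub>0 'a) \<Rightarrow> 'a"
  have mem: "dual_hom 4 g \<in> cocycles A gP ?d 4" if gc: "\<And>L. g L \<in> carr A" for g
  proof -
    have "dual_hom 4 g (Tr.koszul_delta x) = 0" if x: "x \<in> mcarr (gP (Suc 4))" for x
    proof -
      \<comment> \<open>There are no five indices, so every cochain of degree 4 is a
        cocycle.\<close>
      have "{L :: idx set. card L = Suc 4} = {}"
        using card_idx_le by (metis (mono_tags, lifting) Collect_empty_eq Suc_n_not_le_n)
      then show ?thesis
        using dual_hom_delta[where g = g, OF gc x] by (simp add: dual_hom_def)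
    qed
    then show ?thesis using dual_hom_mem[where g = g, OF gc] by (simp add: cocycles_def)
  qed
  have fU: "f (gen UNIV) \<in> carr A" if f: "f \<in> cocycles A gP ?d 4" for f
  proof -
    obtain g where "\<And>L. g L \<in> carr A" "f = dual_hom 4 g"
      using f dual_memE[of f 4] unfolding cocycles_def by blast
    then show ?thesis using dual_hom_carr by simp
  qed
  have "is_graded_hom (op_alg A) ?Z (trivial_gmod (op_alg A) 8) 0 \<phi>"
    unfolding is_graded_hom_def is_hom_def
  proof (intro conjI ballI allI subsetI)
    fix f g a assume f: "f \<in> mcarr ?Z"
    then have f': "f \<in> cocycles A gP ?d 4" by simp
    show "\<phi> f \<in> mcarr (trivial_gmod (op_alg A) 8)" by (simp add: trivial_gmod_def)
    show "\<phi> (f + g) = \<phi> f + \<phi> g" if "g \<in> mcarr ?Z"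
      using fU[OF f'] fU[of g] that by (simp add: \<phi>_def co_add)
    show "\<phi> (act ?Z a f) = act (trivial_gmod (op_alg A) 8) a (\<phi> f)" if "a \<in> carr (op_alg A)"
    proof -
      have a: "a \<in> carr A" using that by (simp add: op_alg_def)
      show ?thesis
        using fU[OF f'] a by (simp add: \<phi>_def dual_gmod_def trivial_gmod_def aug_op co_mul_0)
    qed
  next
    fix n x assume "x \<in> \<phi> ` mpiece ?Z n"
    then obtain f where f: "f \<in> dual_piece A (gP 4) n" and x: "x = \<phi> f" by auto
    have "f ` mpiece (gP 4) 8 \<subseteq> mpiece (regular_gmod A) (8 + n)"
      using f by (simp add: dual_piece_def is_graded_hom_def)
    moreover have "gen UNIV \<in> mpiece (gP 4) 8" using gen_mpiece[of UNIV] by (simp add: UNIV4)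
    ultimately have "f (gen UNIV) \<in> zpiece (8 + n)" by (auto simp: regular_gmod_def zpiece_def)
    then show "x \<in> mpiece (trivial_gmod (op_alg A) 8) (n + 0)"
      using co_zpiece by (auto simp: x \<phi>_def trivial_gmod_def)
  qed
  moreover have "\<phi> ` mcarr ?Z = mcarr (trivial_gmod (op_alg A) 8)"
  proof -
    have "c \<in> \<phi> ` mcarr ?Z" for c
    proof -
      let ?g = "\<lambda>L :: idx set. scl A c (unit A)"
      have g: "?g L \<in> carr A" for L by (simp add: scl_carr unit_carr)
      have "\<phi> (dual_hom 4 ?g) = c"
        using dual_hom_gen[where g = ?g and L = UNIV, OF g UNIV4]
        by (simp add: \<phi>_def co_scl unit_carr co_unit)
      then show ?thesis using mem[of ?g, OF g] by force
    qed
    then show ?thesis by (auto simp: trivial_gmod_def)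
  qed
  moreover have "{f \<in> mcarr ?Z. \<phi> f = 0} = coboundaries A gP ?d 4"
  proof (intro equalityI subsetI)
    fix f assume "f \<in> {f \<in> mcarr ?Z. \<phi> f = 0}"
    then have f: "f \<in> cocycles A gP ?d 4" and f0: "\<phi> f = 0" by auto
    then obtain g where g: "\<And>L. g L \<in> carr A" "\<And>L. g L \<noteq> 0 \<Longrightarrow> card L = 4" "f = dual_hom 4 g"
      using dual_memE[of f 4] by (auto simp: cocycles_def)
    have cyc: "cod g L = 0" for L
      using cocycle_cod[OF g(1,2)] f by (simp add: cocycles_def g(3))
    have "co (g UNIV) 0 = 0"
      using f0 dual_hom_gen[where g = g and L = UNIV, OF g(1) UNIV4] by (simp add: \<phi>_def g(3))
    then obtain g' where g': "\<And>L. g' L \<in> carr A" "\<And>L. g L = cod g' L"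
      using cod_exact[OF g(1,2) cyc order_refl] by (auto cong: if_cong)
    have "g = cod g'" using g'(2) by auto
    then show "f \<in> coboundaries A gP ?d 4"
      using cod_coboundary[where g = g' and p = 3, OF g'(1)] by (simp add: g(3) numeral_eq_Suc)
  next
    fix f assume fb: "f \<in> coboundaries A gP ?d 4"
    then have f: "f \<in> cocycles A gP ?d 4" using coboundaries_subset by blast
    have "f \<in> coboundaries A gP ?d (Suc 3)" using fb by (simp add: eval_nat_numeral)
    then obtain h where h: "h \<in> mcarr (dual_gmod A (gP 3))"
      and fh: "\<And>x. x \<in> mcarr (gP (Suc 3)) \<Longrightarrow> f x = h (Tr.koszul_delta x)"
      unfolding coboundaries.simps by blast
    obtain g where g: "\<And>L. g L \<in> carr A" "h = dual_hom 3 g" using dual_memE[OF h] by metis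
    have "gen UNIV \<in> mcarr (gP (Suc 3))" using gen_gP[of UNIV] by (simp add: UNIV4)
    then have "f (gen UNIV) = cod g UNIV"
      using fh dual_hom_delta[OF g(1)] dual_hom_gen[where g = "cod g" and L = UNIV and p = "Suc 3", OF cod_carr[OF g(1)]]
      by (simp add: g(2) UNIV4)
    also have "co (cod g UNIV) 0 = 0"
      unfolding cod_def
      by (simp add: co_sum carr.sg_W mul_carr y_carr g(1) co_sg co_left)
    finally have "\<phi> f = 0" unfolding \<phi>_def .
    then show "f \<in> {f \<in> mcarr ?Z. \<phi> f = 0}" using f by simp
  qed
  ultimately show ?thesis unfolding ext_iso_def Let_def by blast
qed

lemma AS_Gorenstein: "AS_Gorenstein A 4 8"
  unfolding AS_Gorenstein_def
  using graded_resolution_gP ext_vanishes_gP ext_iso_gP by blast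

end

text \<open>The conditions on right modules are those on left modules over the opposite algebra,
  which has the same dimension 4 and shift 8.\<close>

theorem (in skew_coords) AS_regular: "AS_regular U A"
proof -
  interpret op: skew_coords "op_alg A" y eps rho lam co by (rule skew_coords_op)
  show ?thesis
    unfolding AS_regular_def
    using connected_graded GKdim_finite has_gldim_4 op.has_gldim_4 AS_Gorenstein op.AS_Gorenstein by blast
qed

section \<open>Linear extension and rewriting modulo an ideal\<close>

definition pm_lin :: "('k \<Rightarrow> 'v \<Rightarrow> 'v) \<Rightarrow> ('w \<Rightarrow> 'v) \<Rightarrow> ('w \<Rightarrow>\<^sub>0 'k::field) \<Rightarrow> 'v::ab_group_add" where
  "pm_lin sc F p = (\<Sum>w\<in>keys p. sc (lookup p w) (F w))"

lemma pm_induct_add [case_names zero add]: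
  fixes p :: "'w \<Rightarrow>\<^sub>0 'k::ab_group_add"
  assumes "P 0" "\<And>w c q. P q \<Longrightarrow> P (single w c + q)"
  shows "P p"
proof -
  have "P (\<Sum>w\<in>S. single w (lookup p w))" if "finite S" for S
    using that by (induction S) (simp_all add: assms)
  from this[of "keys p"] show ?thesis by (simp flip: pm_sum_single)
qed

context vector_space
begin

lemma pm_lin_zero [simp]: "pm_lin scale F 0 = 0"
  by (simp add: pm_lin_def)

lemma pm_lin_single [simp]: "pm_lin scale F (single w c) = scale c (F w)"
  by (simp add: pm_lin_def)

lemma pm_lin_superset:
  "finite S \<Longrightarrow> keys p \<subseteq> S \<Longrightarrow> pm_lin scale F p = (\<Sum>w\<in>S. scale (lookup p w) (F w))"
  unfolding pm_lin_def by (intro sum.mono_neutral_left) (auto simp: in_keys_iff)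

lemma pm_lin_add: "pm_lin scale F (p + q) = pm_lin scale F p + pm_lin scale F q"
proof -
  let ?S = "keys p \<union> keys q"
  have "pm_lin scale F (p + q) = (\<Sum>w\<in>?S. scale (lookup (p + q) w) (F w))"
    by (rule pm_lin_superset) (auto dest: subsetD[OF Poly_Mapping.keys_add])
  also have "\<dots> = pm_lin scale F p + pm_lin scale F q"
    using pm_lin_superset[of ?S p F] pm_lin_superset[of ?S q F]
    by (simp add: lookup_add scale_left_distrib sum.distrib)
  finally show ?thesis .
qed

lemma pm_lin_uminus: "pm_lin scale F (- p) = - pm_lin scale F p"
  using pm_lin_add[of F p "- p"] by (simp add: eq_neg_iff_add_eq_0 add.commute)

lemma pm_lin_diff: "pm_lin scale F (p - q) = pm_lin scale F p - pm_lin scale F q"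
  using pm_lin_add[of F p "- q"] by (simp add: pm_lin_uminus)

lemma pm_lin_mult_right:
  "pm_lin scale F (p * single v d) = pm_lin scale (\<lambda>u. scale d (F (u + v))) p"
  by (induction p rule: pm_induct_add) (simp_all add: pm_lin_add distrib_right mult_single)

lemma pm_lin_mult:
  "pm_lin scale F (p * q) = pm_lin scale (\<lambda>v. pm_lin scale (\<lambda>u. F (u + v)) p) q"
proof (induction q rule: pm_induct_add)
  case (add v d q)
  have "pm_lin scale (\<lambda>u. scale d (F (u + v))) p = scale d (pm_lin scale (\<lambda>u. F (u + v)) p)"
    by (simp add: pm_lin_def scale_sum_right mult.commute)
  then show ?case
    by (simp add: distrib_left pm_lin_add pm_lin_mult_right add.IH)
qed simp

end

definition cong_mod :: "'r::ring_1 set \<Rightarrow> 'r \<Rightarrow> 'r \<Rightarrow> bool" where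
  "cong_mod J x z \<longleftrightarrow> x - z \<in> J"

text \<open>Used for two ideals: \<open>{0}\<close> in \<open>T\<close>, where congruence is
  equality, and the ideal of the skew relators in the free algebra. Sorting monomials is thus done
  once for both.\<close>

locale two_sided =
  fixes J :: "'r::ring_1 set"
  assumes ideal: "two_sided_ideal J"
begin

lemma cong_refl [simp]: "cong_mod J x x"
  using ideal by (simp add: cong_mod_def two_sided_ideal_def)

lemma cong_add: "cong_mod J x z \<Longrightarrow> cong_mod J x' z' \<Longrightarrow> cong_mod J (x + x') (z + z')"
proof -
  assume "cong_mod J x z" "cong_mod J x' z'"
  then have "(x - z) + (x' - z') \<in> J" using ideal by (simp add: cong_mod_def two_sided_ideal_def)
  then show ?thesis by (simp add: cong_mod_def algebra_simps)
qed

lemma cong_trans: "cong_mod J x z \<Longrightarrow> cong_mod J z w \<Longrightarrow> cong_mod J x w"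
  using cong_add[of x z z w] by (simp add: cong_mod_def)

lemma cong_mult_left: "cong_mod J x z \<Longrightarrow> cong_mod J (a * x) (a * z)"
  unfolding cong_mod_def right_diff_distrib[symmetric] by (rule two_sided_ideal_mult[OF ideal])

lemma cong_mult_right: "cong_mod J x z \<Longrightarrow> cong_mod J (x * a) (z * a)"
  unfolding cong_mod_def left_diff_distrib[symmetric] by (rule two_sided_ideal_mult[OF ideal])

lemma cong_uminus: "cong_mod J x z \<Longrightarrow> cong_mod J (- x) (- z)"
  using cong_mult_left[of x z "- 1"] by simp

lemma cong_sg: "cong_mod J x z \<Longrightarrow> cong_mod J (sg b x) (sg b z)"
  by (simp add: sg_def cong_uminus)

end

lemma sg_mult_left: "sg b x * z = sg b (x * z)" and sg_mult_right: "x * sg b z = sg b (x * z)"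
  for x z :: "'r::ring_1"
  by (simp_all add: sg_def)

definition y_eps :: "idx \<Rightarrow> idx \<Rightarrow> bool" where
  "y_eps i j \<longleftrightarrow> (i, j) \<in> {(I1, I2), (I2, I1), (I1, I3), (I3, I1), (I2, I4), (I4, I2), (I3, I4), (I4, I3)}"

definition y_mon :: "(idx \<Rightarrow> 'r::monoid_mult) \<Rightarrow> (idx \<Rightarrow> nat) \<Rightarrow> 'r" where
  "y_mon Y \<beta> = Y I1 ^ \<beta> I1 * Y I2 ^ \<beta> I2 * Y I3 ^ \<beta> I3 * Y I4 ^ \<beta> I4"

text \<open>The parity of the number of anticommuting factors that \<open>y j\<close> passes when it
  enters an ordered monomial from the left.\<close>

definition y_lam :: "idx \<Rightarrow> (idx \<Rightarrow> nat) \<Rightarrow> bool" where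
  "y_lam j \<beta> \<longleftrightarrow> odd (\<Sum>i | i < j \<and> y_eps i j. \<beta> i)"

definition y_rho :: "idx \<Rightarrow> (idx \<Rightarrow> nat) \<Rightarrow> bool" where
  "y_rho j \<beta> \<longleftrightarrow> odd (\<Sum>i | j < i \<and> y_eps i j. \<beta> i)"

lemma y_lam_simps [simp]:
  "y_lam I1 \<beta> \<longleftrightarrow> False" "y_lam I2 \<beta> \<longleftrightarrow> odd (\<beta> I1)" "y_lam I3 \<beta> \<longleftrightarrow> odd (\<beta> I1)"
  "y_lam I4 \<beta> \<longleftrightarrow> odd (\<beta> I2 + \<beta> I3)"
proof -
  have *: "{i. i < I1 \<and> y_eps i I1} = {}" "{i. i < I2 \<and> y_eps i I2} = {I1}"
    "{i. i < I3 \<and> y_eps i I3} = {I1}" "{i. i < I4 \<and> y_eps i I4} = {I2, I3}"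
    by (rule set_eqI, rename_tac j, case_tac j; simp add: less_idx_def y_eps_def)+
  then show "y_lam I1 \<beta> \<longleftrightarrow> False" "y_lam I2 \<beta> \<longleftrightarrow> odd (\<beta> I1)" "y_lam I3 \<beta> \<longleftrightarrow> odd (\<beta> I1)"
    "y_lam I4 \<beta> \<longleftrightarrow> odd (\<beta> I2 + \<beta> I3)"
    by (simp_all only: y_lam_def *) simp_all
qed

lemma y_rho_simps [simp]:
  "y_rho I1 \<beta> \<longleftrightarrow> odd (\<beta> I2 + \<beta> I3)" "y_rho I2 \<beta> \<longleftrightarrow> odd (\<beta> I4)" "y_rho I3 \<beta> \<longleftrightarrow> odd (\<beta> I4)"
  "y_rho I4 \<beta> \<longleftrightarrow> False"
proof -
  have *: "{i. I1 < i \<and> y_eps i I1} = {I2, I3}" "{i. I2 < i \<and> y_eps i I2} = {I4}"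
    "{i. I3 < i \<and> y_eps i I3} = {I4}" "{i. I4 < i \<and> y_eps i I4} = {}"
    by (rule set_eqI, rename_tac j, case_tac j; simp add: less_idx_def y_eps_def)+
  then show "y_rho I1 \<beta> \<longleftrightarrow> odd (\<beta> I2 + \<beta> I3)" "y_rho I2 \<beta> \<longleftrightarrow> odd (\<beta> I4)" "y_rho I3 \<beta> \<longleftrightarrow> odd (\<beta> I4)"
    "y_rho I4 \<beta> \<longleftrightarrow> False"
    by (simp_all only: y_rho_def *) simp_all
qed

lemma y_eps_sym: "y_eps i j = y_eps j i"
  by (cases i; cases j) (simp_all add: y_eps_def)

lemma y_lam_comm: "i \<noteq> j \<Longrightarrow> (y_lam i (inc j \<beta>) \<noteq> y_lam j \<beta>) = ((y_lam j (inc i \<beta>) \<noteq> y_lam i \<beta>) \<noteq> y_eps i j)"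
  by (cases i; cases j) (auto simp: y_eps_def)

lemma y_rho_comm: "i \<noteq> j \<Longrightarrow> (y_rho i (inc j \<beta>) \<noteq> y_rho j \<beta>) = ((y_rho j (inc i \<beta>) \<noteq> y_rho i \<beta>) \<noteq> y_eps i j)"
  by (cases i; cases j) (auto simp: y_eps_def)

context two_sided
begin

definition passes :: "'r \<Rightarrow> bool \<Rightarrow> 'r \<Rightarrow> bool" where
  "passes x e a \<longleftrightarrow> cong_mod J (x * a) (sg e (a * x))"

lemma passes_one: "passes x False 1"
  by (simp add: passes_def)

lemma passes_mult:
  assumes "passes x e a" "passes x e' b"
  shows "passes x (e \<noteq> e') (a * b)"
proof -
  have "cong_mod J (x * a * b) (sg e (a * x) * b)"
    using assms(1) unfolding passes_def by (rule cong_mult_right)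
  moreover have "cong_mod J (sg e (a * x) * b) (sg e (a * sg e' (b * x)))"
    using cong_sg[OF cong_mult_left[OF assms(2)[unfolded passes_def], of a], of e]
    by (simp add: sg_mult_left mult.assoc)
  ultimately show ?thesis
    unfolding passes_def using cong_trans by (simp add: sg_mult_right mult.assoc)
qed

lemma passes_pow: "passes x e b \<Longrightarrow> passes x (e \<and> odd n) (b ^ n)"
proof (induction n)
  case (Suc n)
  have "(e \<noteq> (e \<and> odd n)) = (e \<and> odd (Suc n))" by auto
  then show ?case using passes_mult[OF Suc.prems Suc.IH[OF Suc.prems]] by simp
qed (simp add: passes_one)

lemma passes_sym: "passes x e a \<Longrightarrow> cong_mod J (a * x) (sg e (x * a))"
proof -
  assume "passes x e a"
  then have "cong_mod J (sg e (a * x)) (x * a)"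
    using cong_uminus[of "x * a" "sg e (a * x)"] by (simp add: passes_def cong_mod_def)
  from cong_sg[OF this, of e] show ?thesis by simp
qed

text \<open>From the left the new factor passes the powers of all earlier variables, from the right
  those of all later ones; a power contributes a sign only if its exponent is odd.\<close>

lemma cong_y_mon:
  fixes Y :: "idx \<Rightarrow> 'r"
  assumes "\<And>i j. cong_mod J (Y i * Y j) (sg (y_eps i j) (Y j * Y i))"
  shows "cong_mod J (Y j * y_mon Y \<beta>) (sg (y_lam j \<beta>) (y_mon Y (inc j \<beta>)))"
    and "cong_mod J (y_mon Y \<beta> * Y j) (sg (y_rho j \<beta>) (y_mon Y (inc j \<beta>)))"
proof -
  have pw: "passes (Y i) (y_eps i j \<and> odd n) (Y j ^ n)" for i j n
    by (rule passes_pow) (simp add: passes_def assms)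
  let ?a = "Y I1 ^ \<beta> I1" and ?b = "Y I2 ^ \<beta> I2" and ?c = "Y I3 ^ \<beta> I3" and ?d = "Y I4 ^ \<beta> I4"
  note p2 = pw[of I2 I1 "\<beta> I1"]
  note p3 = passes_mult[OF pw[of I3 I1 "\<beta> I1"] pw[of I3 I2 "\<beta> I2"]]
  note p4 = passes_mult[OF passes_mult[OF pw[of I4 I1 "\<beta> I1"] pw[of I4 I2 "\<beta> I2"]] pw[of I4 I3 "\<beta> I3"]]
  note q1 = passes_mult[OF pw[of I1 I2 "\<beta> I2"] passes_mult[OF pw[of I1 I3 "\<beta> I3"] pw[of I1 I4 "\<beta> I4"]]]
  note q2 = passes_mult[OF pw[of I2 I3 "\<beta> I3"] pw[of I2 I4 "\<beta> I4"]]
  note q3 = pw[of I3 I4 "\<beta> I4"]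
  show "cong_mod J (Y j * y_mon Y \<beta>) (sg (y_lam j \<beta>) (y_mon Y (inc j \<beta>)))"
  proof (cases j)
    case I1
    then show ?thesis by (simp add: y_mon_def mult.assoc)
  next
    case I2
    show ?thesis
      using cong_mult_right[OF p2[unfolded passes_def], of "?b * (?c * ?d)"]
      by (simp add: I2 y_mon_def y_eps_def mult.assoc sg_mult_left)
  next
    case I3
    show ?thesis
      using cong_mult_right[OF p3[unfolded passes_def], of "?c * ?d"]
      by (simp add: I3 y_mon_def y_eps_def mult.assoc sg_mult_left)
  next
    case I4
    show ?thesis
      using cong_mult_right[OF p4[unfolded passes_def], of "?d"]
      by (simp add: I4 y_mon_def y_eps_def mult.assoc sg_mult_left)
  qed
  show "cong_mod J (y_mon Y \<beta> * Y j) (sg (y_rho j \<beta>) (y_mon Y (inc j \<beta>)))"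
  proof (cases j)
    case I1
    show ?thesis
      using cong_mult_left[OF passes_sym[OF q1], of ?a]
      by (simp add: I1 y_mon_def y_eps_def sg_mult_right power_Suc2 mult.assoc del: power_Suc)
  next
    case I2
    show ?thesis
      using cong_mult_left[OF passes_sym[OF q2], of "?a * ?b"]
      by (simp add: I2 y_mon_def y_eps_def sg_mult_right power_Suc2 mult.assoc del: power_Suc)
  next
    case I3
    show ?thesis
      using cong_mult_left[OF passes_sym[OF q3], of "?a * (?b * ?c)"]
      by (simp add: I3 y_mon_def y_eps_def sg_mult_right power_Suc2 mult.assoc del: power_Suc)
  next
    case I4
    then show ?thesis by (simp add: y_mon_def mult.assoc power_Suc2 del: power_Suc)
  qed
qed

end

section \<open>Normal forms in T\<close>

lemma T_eqI: "p - q \<in> T_relators \<Longrightarrow> abs_T p = abs_T q"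
  by (simp add: T.abs_eq_iff T_eq_def hull_inc)

text \<open>The defining relations oriented as rewrite rules for the degree-lexicographic order in
  which the letters ascend as \<open>I4\<close>, \<open>I1\<close>, \<open>I2\<close>,
  \<open>I3\<close>.\<close>

lemma xT_rels:
  "xT I3 * xT I3 = xT I1 * (xT I2 :: 'k::field T)"
  "xT I2 * xT I1 = - (xT I4 * (xT I4 :: 'k T))"
  "xT I2 * xT I4 = xT I1 * (xT I3 :: 'k T)"
  "xT I3 * xT I2 = xT I4 * (xT I1 :: 'k T)"
  "xT I3 * xT I1 = xT I2 * (xT I3 :: 'k T)"
  "xT I1 * xT I4 = - (xT I4 * (xT I2 :: 'k T))"
proof -
  note ab = xT.abs_eq times_T.abs_eq uminus_T.abs_eq
  let ?x = "free_var :: idx \<Rightarrow> idx fword \<Rightarrow>\<^sub>0 'k"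
  have m: "p - q \<in> T_relators \<Longrightarrow> abs_T p = abs_T q" "p - q \<in> T_relators \<Longrightarrow> abs_T q = abs_T p" for p q :: "idx fword \<Rightarrow>\<^sub>0 'k"
    by (simp_all add: T_eqI)
  show "xT I3 * xT I3 = xT I1 * (xT I2 :: 'k T)" "xT I2 * xT I4 = xT I1 * (xT I3 :: 'k T)"
    unfolding ab by (rule m(2); simp add: T_relators_def Let_def)+
  show "xT I3 * xT I2 = xT I4 * (xT I1 :: 'k T)"
    unfolding ab by (rule m(2)) (simp add: T_relators_def Let_def)
  show "xT I3 * xT I1 = xT I2 * (xT I3 :: 'k T)"
    unfolding ab by (rule m(2)) (simp add: T_relators_def Let_def)
  have "abs_T (?x I4 * ?x I4) = abs_T (- (?x I2 * ?x I1))" "abs_T (?x I4 * ?x I2) = abs_T (- (?x I1 * ?x I4))"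
    by (rule m(1); simp add: T_relators_def Let_def)+
  then have "xT I4 * xT I4 = - (xT I2 * (xT I1 :: 'k T))" "xT I4 * xT I2 = - (xT I1 * (xT I4 :: 'k T))"
    unfolding ab .
  then show "xT I2 * xT I1 = - (xT I4 * (xT I4 :: 'k T))" "xT I1 * xT I4 = - (xT I4 * (xT I2 :: 'k T))"
    by simp_all
qed

text \<open>Together with the defining relations these form a Groebner basis.\<close>

lemma xT_cubic_rels:
  "xT I3 * (xT I4 * xT I1) = xT I1 * (xT I2 * (xT I2 :: 'k::field T))"
  "xT I3 * (xT I4 * xT I4) = - (xT I4 * (xT I1 * (xT I1 :: 'k T)))"
  "xT I3 * (xT I4 * xT I2) = - (xT I2 * (xT I3 * (xT I4 :: 'k T)))"
proof -
  \<comment> \<open>The three rules come from the overlaps 332, 321 and 314 of left-hand sides, each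
    rewritten in two ways.\<close>
  have "xT I3 * (xT I4 * xT I1) = xT I3 * xT I3 * (xT I2 :: 'k T)"
    unfolding mult.assoc xT_rels(4) ..
  also have "\<dots> = xT I1 * (xT I2 * xT I2)" by (simp only: xT_rels mult.assoc)
  finally show "xT I3 * (xT I4 * xT I1) = xT I1 * (xT I2 * (xT I2 :: 'k T))" .
  have "xT I3 * (xT I4 * xT I4) = - (xT I3 * xT I2 * (xT I1 :: 'k T))"
    unfolding mult.assoc xT_rels(2) by simp
  also have "\<dots> = - (xT I4 * (xT I1 * xT I1))" by (simp only: xT_rels mult.assoc)
  finally show "xT I3 * (xT I4 * xT I4) = - (xT I4 * (xT I1 * (xT I1 :: 'k T)))" .
  have "xT I3 * (xT I4 * xT I2) = - (xT I3 * xT I1 * (xT I4 :: 'k T))"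
    unfolding mult.assoc xT_rels(6) by simp
  also have "\<dots> = - (xT I2 * (xT I3 * xT I4))" by (simp only: xT_rels mult.assoc)
  finally show "xT I3 * (xT I4 * xT I2) = - (xT I2 * (xT I3 * (xT I4 :: 'k T)))" .
qed

text \<open>Products are nested to the right, so each rule is also needed in front of a further
  factor.\<close>

lemma mult_rewrite_tail: "x * z = (w :: 'r::semigroup_mult) \<Longrightarrow> x * (z * v) = w * v"
  and mult_rewrite_tail3: "x * (z * u) = (w :: 'r) \<Longrightarrow> x * (z * (u * v)) = w * v"
  by (metis mult.assoc)+

lemmas xT_normalize = mult.assoc minus_mult_left[symmetric] minus_mult_right[symmetric] minus_minus
  xT_rels xT_rels[THEN mult_rewrite_tail] xT_cubic_rels xT_cubic_rels[THEN mult_rewrite_tail3]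

definition yT :: "idx \<Rightarrow> 'k::field T" where
  "yT j = (case j of I1 \<Rightarrow> xT I1 * xT I1 | I2 \<Rightarrow> xT I2 * xT I2 | I3 \<Rightarrow> xT I3 * xT I4 | I4 \<Rightarrow> xT I4 * xT I3)"

text \<open>For each of the 16 pairs, rewriting brings both sides to the same normal form.\<close>

lemma yT_comm: "yT i * yT j = sg (y_eps i j) (yT j * (yT i :: 'k::field T))"
  by (cases i; cases j; simp only: yT_def idx.case, simp add: y_eps_def sg_def xT_normalize)

text \<open>
  The semidihedral group as \<open>r\<^sup>i\<close> (\<open>Pi\<close>) and \<open>r\<^sup>i s\<close> (\<open>Qi\<close>), where \<open>s r s = r\<^sup>3\<close>, with
  \<open>a = r s\<close>, \<open>b = s\<close>, \<open>c = r\<^sup>2\<close>, \<open>d = r\<^sup>4\<close>; the table is left multiplication by the generators.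
\<close>

datatype sd_elt = P0 | P1 | P2 | P3 | P4 | P5 | P6 | P7 | Q0 | Q1 | Q2 | Q3 | Q4 | Q5 | Q6 | Q7

primrec sd_tab :: "sd_elt \<Rightarrow> sd_gen \<Rightarrow> sd_elt" where
  "sd_tab P0 = case_sd_gen Q1 Q0 P2 P4"
| "sd_tab P1 = case_sd_gen Q4 Q3 P3 P5"
| "sd_tab P2 = case_sd_gen Q7 Q6 P4 P6"
| "sd_tab P3 = case_sd_gen Q2 Q1 P5 P7"
| "sd_tab P4 = case_sd_gen Q5 Q4 P6 P0"
| "sd_tab P5 = case_sd_gen Q0 Q7 P7 P1"
| "sd_tab P6 = case_sd_gen Q3 Q2 P0 P2"
| "sd_tab P7 = case_sd_gen Q6 Q5 P1 P3"
| "sd_tab Q0 = case_sd_gen P1 P0 Q2 Q4"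
| "sd_tab Q1 = case_sd_gen P4 P3 Q3 Q5"
| "sd_tab Q2 = case_sd_gen P7 P6 Q4 Q6"
| "sd_tab Q3 = case_sd_gen P2 P1 Q5 Q7"
| "sd_tab Q4 = case_sd_gen P5 P4 Q6 Q0"
| "sd_tab Q5 = case_sd_gen P0 P7 Q7 Q1"
| "sd_tab Q6 = case_sd_gen P3 P2 Q0 Q2"
| "sd_tab Q7 = case_sd_gen P6 P5 Q1 Q3"

text \<open>
  \<open>m_word g\<close> is a word of least length and of degree \<open>g\<close>; it generates the component \<open>T\<^sub>g\<close> over
  \<open>T\<^sub>e\<close>.  An entry \<open>(t, Y, g')\<close> of \<open>x_tab\<close> records \<open>x\<^sub>i m\<^sub>g = \<plusminus> m\<^sub>g\<^sub>' Y\<close>, with \<open>t\<close> for the sign minus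
  and \<open>Y\<close> one of the \<open>y\<^sub>j\<close> or absent.
\<close>

primrec m_word :: "sd_elt \<Rightarrow> idx list" where
  "m_word P0 = []"
| "m_word P1 = [I3]"
| "m_word P2 = [I1, I2]"
| "m_word P3 = [I1, I2, I3]"
| "m_word P4 = [I4, I4, I4, I4]"
| "m_word P5 = [I4, I4, I4]"
| "m_word P6 = [I4, I4]"
| "m_word P7 = [I4]"
| "m_word Q0 = [I1]"
| "m_word Q1 = [I2, I3]"
| "m_word Q2 = [I4, I1, I3]"
| "m_word Q3 = [I1, I3]"
| "m_word Q4 = [I4, I4, I2]"
| "m_word Q5 = [I4, I2]"
| "m_word Q6 = [I2]"
| "m_word Q7 = [I4, I1]"

primrec x_tab :: "sd_elt \<Rightarrow> idx \<Rightarrow> bool \<times> idx option \<times> sd_elt" where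
  "x_tab P0 = case_idx (False, None, Q0) (False, None, Q6) (False, None, P1) (False, None, P7)"
| "x_tab P1 = case_idx (False, None, Q3) (False, None, Q1) (False, None, P2) (False, Some I4, P0)"
| "x_tab P2 = case_idx (False, Some I4, Q6) (True, None, Q4) (False, None, P3) (False, Some I2, P1)"
| "x_tab P3 = case_idx (False, Some I2, Q1) (False, Some I4, Q7) (False, None, P4) (False, Some I1, P2)"
| "x_tab P4 = case_idx (True, Some I1, Q4) (False, Some I2, Q2) (False, Some I4, P5) (False, Some I3, P3)"
| "x_tab P5 = case_idx (True, Some I3, Q7) (False, Some I1, Q5) (True, Some I2, P6) (False, None, P4)"
| "x_tab P6 = case_idx (True, None, Q2) (False, Some I3, Q0) (True, Some I1, P7) (False, None, P5)"
| "x_tab P7 = case_idx (True, None, Q5) (False, None, Q3) (False, Some I3, P0) (False, None, P6)"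
| "x_tab Q0 = case_idx (False, Some I1, P0) (True, None, P6) (False, None, Q1) (False, None, Q7)"
| "x_tab Q1 = case_idx (False, None, P3) (False, Some I1, P1) (False, None, Q2) (True, Some I4, Q0)"
| "x_tab Q2 = case_idx (False, Some I4, P6) (False, None, P4) (False, Some I1, Q3) (True, Some I3, Q1)"
| "x_tab Q3 = case_idx (False, Some I3, P1) (True, Some I4, P7) (True, None, Q4) (False, None, Q2)"
| "x_tab Q4 = case_idx (True, None, P4) (True, Some I3, P2) (True, Some I4, Q5) (False, Some I2, Q3)"
| "x_tab Q5 = case_idx (True, Some I2, P7) (False, None, P5) (True, Some I3, Q6) (False, None, Q4)"
| "x_tab Q6 = case_idx (False, None, P2) (False, Some I2, P0) (False, None, Q7) (False, None, Q5)"
| "x_tab Q7 = case_idx (False, None, P5) (False, None, P3) (False, Some I2, Q0) (True, Some I1, Q6)"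

text \<open>A state stands for the signed basis element
  \<open>\<plusminus> m\<^sub>g y\<^sup>\<beta>\<close>, with \<open>True\<close> for minus. As a
  formal object it carries the action of \<open>T\<close> before linear independence is
  known.\<close>

type_synonym state = "bool \<times> sd_elt \<times> (idx \<Rightarrow> nat)"

text \<open>When the table yields a factor \<open>y j\<close>, it is sorted into the monomial at the
  cost of \<open>y_lam\<close>.\<close>

definition x_step :: "idx \<Rightarrow> state \<Rightarrow> state" where
  "x_step i = (\<lambda>(s, g, \<beta>). case x_tab g i of
     (t, None, g') \<Rightarrow> (s \<noteq> t, g', \<beta>)
   | (t, Some j, g') \<Rightarrow> (s \<noteq> (t \<noteq> y_lam j \<beta>), g', inc j \<beta>))"

definition word_T :: "idx list \<Rightarrow> 'k::field T" where
  "word_T w = prod_list (map xT w)"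

definition state_T :: "state \<Rightarrow> 'k::field T" where
  "state_T = (\<lambda>(s, g, \<beta>). sg s (word_T (m_word g) * y_mon yT \<beta>))"

lemma two_sided_ideal_zero: "two_sided_ideal {0 :: 'r::ring_1}"
  by (simp add: two_sided_ideal_def)

lemma cong_mod_zero: "cong_mod {0} x z \<longleftrightarrow> x = z"
  by (simp add: cong_mod_def)

lemma yT_y_mon:
  "yT j * y_mon yT \<beta> = sg (y_lam j \<beta>) (y_mon yT (inc j \<beta>) :: 'k::field T)"
  "y_mon yT \<beta> * yT j = sg (y_rho j \<beta>) (y_mon yT (inc j \<beta>) :: 'k::field T)"
proof -
  interpret two_sided "{0 :: 'k T}" by unfold_locales (rule two_sided_ideal_zero)
  have "cong_mod {0} (yT i * yT j) (sg (y_eps i j) (yT j * (yT i :: 'k T)))" for i j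
    unfolding cong_mod_zero by (rule yT_comm)
  from cong_y_mon[OF this]
  show "yT j * y_mon yT \<beta> = sg (y_lam j \<beta>) (y_mon yT (inc j \<beta>) :: 'k T)"
    "y_mon yT \<beta> * yT j = sg (y_rho j \<beta>) (y_mon yT (inc j \<beta>) :: 'k T)"
    unfolding cong_mod_zero by blast+
qed

lemma x_tab_T:
  "x_tab g i = (t, Y, g') \<Longrightarrow> xT i * word_T (m_word g)
    = sg t (word_T (m_word g') * (case Y of None \<Rightarrow> 1 | Some j \<Rightarrow> yT j) :: 'k::field T)"
  by (cases g; cases i; clarsimp simp: word_T_def yT_def sg_def xT_normalize)

lemma x_step_T: "xT i * state_T st = (state_T (x_step i st) :: 'k::field T)"
proof -
  obtain s g \<beta> where st: "st = (s, g, \<beta>)" by (cases st)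
  obtain t Y g' where tab: "x_tab g i = (t, Y, g')" by (cases "x_tab g i")
  have "xT i * state_T st = sg s (xT i * word_T (m_word g) * (y_mon yT \<beta> :: 'k T))"
    by (simp add: st state_T_def sg_mult_right mult.assoc)
  also have "\<dots> = state_T (x_step i st)"
    unfolding x_tab_T[OF tab]
    by (cases Y) (simp_all add: st x_step_def tab state_T_def sg_mult_left sg_mult_right mult.assoc yT_y_mon)
  finally show ?thesis .
qed

definition run :: "idx list \<Rightarrow> state \<Rightarrow> state" where
  "run w st = foldr x_step w st"

abbreviation start :: state where "start \<equiv> (False, P0, \<lambda>_. 0)"

text \<open>The spanning half of the normal form: letters act on states as they do in
  \<open>T\<close>, and the start state represents 1.\<close>

lemma word_T_run: "word_T w = (state_T (run w start) :: 'k::field T)"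
proof (induction w)
  case Nil
  show ?case by (simp add: run_def word_T_def state_T_def y_mon_def)
next
  case (Cons i w)
  then show ?case by (simp add: word_T_def run_def x_step_T)
qed

definition flip :: "bool \<Rightarrow> state \<Rightarrow> state" where
  "flip b = (\<lambda>(s, g, \<beta>). (s \<noteq> b, g, \<beta>))"

lemma x_step_flip: "x_step i (flip b st) = flip b (x_step i st)"
  by (auto simp: x_step_def flip_def split: prod.splits option.splits)

lemma run_flip: "run w (flip b st) = flip b (run w st)"
  by (induction w) (simp_all add: run_def x_step_flip)

text \<open>The independence half: the defining relations hold for operators on formal states, not
  merely for their values in \<open>T\<close>. For each \<open>g\<close> the signs involve only
  parities of exponents, and the exponents agree because increments commute.\<close>

lemma x_step_rels:
  "x_step I1 (x_step I2 st) = x_step I3 (x_step I3 st)"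
  "x_step I4 (x_step I4 st) = flip True (x_step I2 (x_step I1 st))"
  "x_step I1 (x_step I3 st) = x_step I2 (x_step I4 st)"
  "x_step I4 (x_step I1 st) = x_step I3 (x_step I2 st)"
  "x_step I2 (x_step I3 st) = x_step I3 (x_step I1 st)"
  "x_step I4 (x_step I2 st) = flip True (x_step I1 (x_step I4 st))"
proof -
  obtain s g \<beta> where st: "st = (s, g, \<beta>)" by (cases st)
  note i = inc_commute[of I2 I1] inc_commute[of I3 I1] inc_commute[of I4 I1] inc_commute[of I3 I2]
    inc_commute[of I4 I2] inc_commute[of I4 I3]
  show "x_step I1 (x_step I2 st) = x_step I3 (x_step I3 st)"
    "x_step I4 (x_step I4 st) = flip True (x_step I2 (x_step I1 st))"
    "x_step I1 (x_step I3 st) = x_step I2 (x_step I4 st)"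
    "x_step I4 (x_step I1 st) = x_step I3 (x_step I2 st)"
    "x_step I2 (x_step I3 st) = x_step I3 (x_step I1 st)"
    "x_step I4 (x_step I2 st) = flip True (x_step I1 (x_step I4 st))"
    unfolding st by (cases g; auto simp: x_step_def flip_def i)+
qed

lemma free_const_commute: "free_const c * p = p * (free_const c :: 'x fword \<Rightarrow>\<^sub>0 'k::field)"
  by (induction p rule: pm_induct_add)
    (simp_all add: free_const_def distrib_left distrib_right mult_single mult.commute)

lemma free_const_add: "free_const (c + d) = free_const c + free_const d"
  by (simp add: free_const_def single_add)

lemma free_const_mult: "free_const (c * d) = free_const c * free_const d"
  by (simp add: free_const_def mult_single)

lemma free_const_one: "free_const 1 = 1"
  by (simp add: free_const_def)

lemma vector_space_free: "vector_space (\<lambda>c p. free_const c * (p :: 'x fword \<Rightarrow>\<^sub>0 'k::field))"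
  by standard (simp_all add: distrib_left distrib_right free_const_add free_const_mult free_const_one mult.assoc)

lemma vector_space_T: "vector_space (scale_T :: 'k::field \<Rightarrow> 'k T \<Rightarrow> 'k T)"
proof
  fix a b :: 'k and x z :: "'k T"
  show "scale_T a (x + z) = scale_T a x + scale_T a z" by transfer (simp add: distrib_left T_eq_refl)
  show "scale_T (a + b) x = scale_T a x + scale_T b x"
    by transfer (simp add: free_const_add distrib_right T_eq_refl)
  show "scale_T a (scale_T b x) = scale_T (a * b) x"
    by transfer (simp add: free_const_mult mult.assoc T_eq_refl)
  show "scale_T 1 x = x" by transfer (simp add: free_const_one T_eq_refl)
qed

lemma scale_T_mult:
  "scale_T c x * z = scale_T c (x * z :: 'k::field T)" "x * scale_T c z = scale_T c (x * z)"
proof -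
  show "scale_T c x * z = scale_T c (x * z)" by transfer (simp add: mult.assoc T_eq_refl)
  show "x * scale_T c z = scale_T c (x * z)"
  proof transfer
    fix x z :: "idx fword \<Rightarrow>\<^sub>0 'k" and c
    have "x * (free_const c * z) = free_const c * (x * z)"
      by (metis free_const_commute mult.assoc)
    then show "T_eq (x * (free_const c * z)) (free_const c * (x * z))" by (simp add: T_eq_refl)
  qed
qed

interpretation TV: vector_space "scale_T :: 'k::field \<Rightarrow> 'k T \<Rightarrow> 'k T"
  by (rule vector_space_T)

lemma vector_space_times: "vector_space ((*) :: 'k::field \<Rightarrow> 'k \<Rightarrow> 'k)"
  by standard (simp_all add: algebra_simps)

interpretation KV: vector_space "(*) :: 'k::field \<Rightarrow> 'k \<Rightarrow> 'k"
  by (rule vector_space_times)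

definition free_word :: "'x list \<Rightarrow> ('x fword \<Rightarrow>\<^sub>0 'k::ring_1)" where
  "free_word w = single (FWord w) 1"

lemma free_word_Nil [simp]: "free_word [] = 1"
  by (simp add: free_word_def flip: zero_fword_def)

lemma free_word_append: "free_word (v @ w) = free_word v * free_word w"
  by (simp add: free_word_def mult_single plus_fword_def)

lemma free_word_Cons: "free_word (i # w) = free_var i * free_word w"
  using free_word_append[of "[i]" w] by (simp add: free_word_def free_var_def)

lemma free_expand: "p = pm_lin (\<lambda>c p. free_const c * p) (\<lambda>w. free_word (letters w)) p"
  for p :: "'x fword \<Rightarrow>\<^sub>0 'k::field"
proof -
  have "pm_lin (\<lambda>c p. free_const c * p) (\<lambda>w. free_word (letters w)) p
      = (\<Sum>w\<in>keys p. single w (lookup p w))"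
    by (simp add: pm_lin_def free_const_def free_word_def mult_single)
  then show ?thesis using pm_sum_single[of p] by simp
qed

lemma abs_T_sum: "abs_T (sum f S) = (\<Sum>i\<in>S. abs_T (f i) :: 'k::field T)"
  by (induction S rule: infinite_finite_induct) (simp_all add: zero_T_def flip: plus_T.abs_eq)

lemma abs_T_free_word: "abs_T (free_word w) = (word_T w :: 'k::field T)"
  by (induction w) (simp_all add: word_T_def one_T_def free_word_Cons xT.abs_eq flip: times_T.abs_eq)

lemma abs_T_eq: "abs_T p = (pm_lin scale_T (\<lambda>w. word_T (letters w)) p :: 'k::field T)"
  by (subst free_expand)
    (simp add: pm_lin_def abs_T_sum abs_T_free_word flip: scale_T.abs_eq)

section \<open>Coordinates on T\<close>

text \<open>The free vector space on the pairs \<open>(g, \<beta>)\<close> is seen through its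
  linear functionals \<open>f\<close>; a state contributes with its sign.\<close>

definition state_coef :: "(sd_elt \<times> (idx \<Rightarrow> nat) \<Rightarrow> 'k::field) \<Rightarrow> state \<Rightarrow> 'k" where
  "state_coef f = (\<lambda>(s, g, \<beta>). sg s (f (g, \<beta>)))"

text \<open>The value of the functional \<open>f\<close> at \<open>p \<cdot> st\<close>, where the
  free algebra acts through \<open>x_step\<close>.\<close>

definition run_coef :: "(sd_elt \<times> (idx \<Rightarrow> nat) \<Rightarrow> 'k::field) \<Rightarrow> state \<Rightarrow> (idx fword \<Rightarrow>\<^sub>0 'k) \<Rightarrow> 'k" where
  "run_coef f st = pm_lin (*) (\<lambda>w. state_coef f (run (letters w) st))"

lemma state_coef_flip: "state_coef f (flip b st) = sg b (state_coef f st)"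
  by (cases st) (auto simp: state_coef_def flip_def sg_def)

text \<open>The left factor is absorbed into the functional, \<open>h = f \<circ> a\<close>, while
  \<open>run_coef_right\<close> absorbs a right factor into the state. So if \<open>q\<close> gives
  0 for all functionals and states, then so does \<open>a * q * b\<close>.\<close>

lemma run_coef_left:
  "\<exists>h. \<forall>st. run_coef f st (a * q) = run_coef h st q"
proof (intro exI allI)
  fix st
  define G where "G st = run_coef f st a" for st
  \<comment> \<open>Functionals are given on unsigned pairs; compatibility with signs shows that
    \<open>G\<close> is of this form.\<close>
  have G_flip: "G (flip b st) = sg b (G st)" for b st
    by (simp add: G_def run_coef_def pm_lin_def run_flip state_coef_flip sg_def sum_negf)
  have G: "G st = state_coef (\<lambda>(g, \<beta>). G (False, g, \<beta>)) st" for st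
  proof -
    obtain s g \<beta> where st: "st = (s, g, \<beta>)" by (cases st)
    show ?thesis using G_flip[of s "(False, g, \<beta>)"] by (simp add: state_coef_def st flip_def)
  qed
  have "run_coef f st (a * q) = pm_lin (*) (\<lambda>v. G (run (letters v) st)) q"
    unfolding run_coef_def G_def by (simp add: KV.pm_lin_mult run_def)
  also have "\<dots> = run_coef (\<lambda>(g, \<beta>). G (False, g, \<beta>)) st q"
    unfolding run_coef_def by (subst G) (rule HOL.refl)
  finally show "run_coef f st (a * q) = run_coef (\<lambda>(g, \<beta>). G (False, g, \<beta>)) st q" .
qed

lemma run_coef_right: "run_coef f st (p * b) = pm_lin (*) (\<lambda>v. run_coef f (run (letters v) st) p) b"
  unfolding run_coef_def by (simp add: KV.pm_lin_mult run_def)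

text \<open>So \<^term>\<open>x_step\<close> makes the signed states a module over \<open>T\<close>.\<close>

lemma run_coef_ideal:
  assumes "p \<in> two_sided_ideal hull T_relators"
  shows "run_coef f st p = 0"
proof -
  let ?I = "{p :: idx fword \<Rightarrow>\<^sub>0 'a. \<forall>f st. run_coef f st p = 0}"
  have "two_sided_ideal ?I"
    unfolding two_sided_ideal_def
  proof (intro conjI ballI allI)
    show "0 \<in> ?I" by (simp add: run_coef_def)
    show "x + z \<in> ?I" if "x \<in> ?I" "z \<in> ?I" for x z
      using that by (simp add: run_coef_def KV.pm_lin_add)
    show "a * x * b \<in> ?I" if "x \<in> ?I" for x a b
    proof -
      have "run_coef f st (a * x) = 0" for f st
      proof -
        obtain h where "\<And>st. run_coef f st (a * x) = run_coef h st x" using run_coef_left[of f a x] by blast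
        then show ?thesis using that unfolding mem_Collect_eq by metis
      qed
      then show ?thesis by (simp add: run_coef_right) (simp add: pm_lin_def)
    qed
  qed
  moreover have "T_relators \<subseteq> ?I"
  proof -
    have fv: "free_var i * free_var j = (single (FWord [i, j]) 1 :: idx fword \<Rightarrow>\<^sub>0 'a)" for i j
      by (simp add: free_var_def mult_single plus_fword_def)
    show ?thesis
      by (auto simp: T_relators_def Let_def fv run_coef_def KV.pm_lin_add KV.pm_lin_diff run_def
          x_step_rels state_coef_flip sg_def)
  qed
  ultimately have "two_sided_ideal hull T_relators \<subseteq> ?I"
    by (intro hull_minimal)
  then show ?thesis using assms by blast
qed

text \<open>The coordinate at \<open>v\<close> in the basis
  \<open>m\<^sub>g y\<^sup>\<beta>\<close>, read off from the action on the start state, which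
  represents 1.\<close>

lift_definition T_coef :: "'k::field T \<Rightarrow> sd_elt \<times> (idx \<Rightarrow> nat) \<Rightarrow> 'k"
  is "\<lambda>p v. run_coef (\<lambda>u. if u = v then 1 else 0) start p"
proof
  fix p q :: "idx fword \<Rightarrow>\<^sub>0 'k" and v
  assume "T_eq p q"
  then have "run_coef (\<lambda>u. if u = v then 1 else 0) start (p - q) = 0"
    unfolding T_eq_def by (rule run_coef_ideal)
  then show "run_coef (\<lambda>u. if u = v then 1 else 0) start p = run_coef (\<lambda>u. if u = v then 1 else 0) start q"
    by (simp add: run_coef_def KV.pm_lin_diff)
qed

lemma T_coef_add: "T_coef (x + z) v = T_coef x v + T_coef z v"
  by transfer (simp add: run_coef_def KV.pm_lin_add)

lemma T_coef_scale: "T_coef (scale_T c x) v = c * T_coef x v"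
proof transfer
  fix p :: "idx fword \<Rightarrow>\<^sub>0 'a" and c v
  have eq: "free_const c * p = p * single 0 c"
    by (subst free_const_commute) (simp add: free_const_def)
  show "run_coef (\<lambda>u. if u = v then 1 else 0) start (free_const c * p)
      = c * run_coef (\<lambda>u. if u = v then 1 else 0) start p"
    unfolding eq run_coef_def KV.pm_lin_mult_right add_0_right
    unfolding pm_lin_def sum_distrib_left
    by (intro sum.cong HOL.refl) (simp add: mult.left_commute[of c])
qed

lemma T_coef_word: "T_coef (word_T w) v = state_coef (\<lambda>u. if u = v then 1 else 0) (run w start)"
  unfolding abs_T_free_word[symmetric] T_coef.abs_eq by (simp add: run_coef_def free_word_def)

lemma T_coef_zero [simp]: "T_coef 0 v = 0"
  using T_coef_add[of 0 0 v] by (metis add.right_neutral add_left_cancel)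

lemma T_coef_sum: "T_coef (sum f S) v = (\<Sum>i\<in>S. T_coef (f i) v)"
  by (induction S rule: infinite_finite_induct) (simp_all add: T_coef_add)

lemma T_coef_sg: "T_coef (sg b x) v = sg b (T_coef x v)"
proof -
  have "T_coef (- x) v = - T_coef x v"
    using T_coef_add[of x "- x" v] by (simp add: eq_neg_iff_add_eq_0 add.commute)
  then show ?thesis by (simp add: sg_def)
qed

section \<open>The grading by the semidihedral group\<close>

text \<open>Formal inverses act as \<open>a d\<close> for \<open>a\<close> and \<open>c d\<close>
  for \<open>c\<close>, because \<open>a\<close> and \<open>c\<close> square to the central
  involution \<open>d\<close>; \<open>b\<close> and \<open>d\<close> are their own inverses.\<close>

definition sd_act :: "sd_gen \<times> bool \<Rightarrow> sd_elt \<Rightarrow> sd_elt" where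
  "sd_act = (\<lambda>(g, s) x. if s then sd_tab x g else
     (case g of Ga \<Rightarrow> sd_tab (sd_tab x Gd) Ga | Gb \<Rightarrow> sd_tab x Gb
      | Gc \<Rightarrow> sd_tab (sd_tab x Gd) Gc | Gd \<Rightarrow> sd_tab x Gd))"

text \<open>A presentation alone gives no handle on which words are distinct. The regular action,
  once checked against the relations, does: a word of degree 1 must fix \<open>P0\<close>.\<close>

lift_definition sd_apply :: "sd16 \<Rightarrow> sd_elt \<Rightarrow> sd_elt" is "\<lambda>u x. foldr sd_act u x"
proof
  fix u v :: "(sd_gen \<times> bool) list" and x
  assume "presented_eq sd_relations u v"
  then show "foldr sd_act u x = foldr sd_act v x"
  proof (induction arbitrary: x)
    case (cancel g s)
    show ?case by (cases x; cases g; cases s; simp add: sd_act_def)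
  next
    case (relation u v)
    then show ?case
      unfolding sd_relations_def Let_def by (cases x; auto simp: sd_act_def)
  qed simp_all
qed

lemma sd_apply_one [simp]: "sd_apply 1 x = x"
  by transfer simp

lemma sd_apply_mult [simp]: "sd_apply (a * b) x = sd_apply a (sd_apply b x)"
  by transfer simp

lemma sd_apply_gen [simp]: "sd_apply (sd g) x = sd_tab x g"
  by transfer (simp add: sd_act_def)

lemma x_tab_deg: "x_tab g i = (t, Y, g') \<Longrightarrow> g' = sd_apply (x_deg i) g"
  by (cases g; cases i; clarsimp)

lemma x_step_invariants:
  assumes "x_step i (s, g, \<beta>) = (s', g', \<beta>')"
  shows "g' = sd_apply (x_deg i) g"
    "length (m_word g') + 2 * mdeg \<beta>' = Suc (length (m_word g) + 2 * mdeg \<beta>)"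
proof -
  obtain t Y h where tab: "x_tab g i = (t, Y, h)" by (cases "x_tab g i")
  have g': "g' = h" and \<beta>': "\<beta>' = (case Y of None \<Rightarrow> \<beta> | Some j \<Rightarrow> inc j \<beta>)"
    using assms tab by (auto simp: x_step_def split: option.splits)
  show "g' = sd_apply (x_deg i) g" using x_tab_deg[OF tab] g' by simp
  have "length (m_word h) + (case Y of None \<Rightarrow> 0 | Some j \<Rightarrow> 2) = Suc (length (m_word g))"
    using tab by (cases g; cases i; clarsimp)
  then show "length (m_word g') + 2 * mdeg \<beta>' = Suc (length (m_word g) + 2 * mdeg \<beta>)"
    by (cases Y) (simp_all add: g' \<beta>')
qed

text \<open>Each step moves the group component by the degree of its letter and adds one to the
  length count, a factor \<open>y j\<close> counting 2. So words of degree 1 end at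
  \<open>P0\<close>, and the exponents respect the grading by length.\<close>

lemma run_invariants:
  "run w start = (s, g, \<beta>) \<Longrightarrow> g = sd_apply (prod_list (map x_deg w)) P0 \<and>
    length w = length (m_word g) + 2 * mdeg \<beta>"
proof (induction w arbitrary: s g \<beta>)
  case Nil
  then show ?case by (auto simp: run_def mdeg_def)
next
  case (Cons i w)
  obtain s' g' \<beta>' where r: "run w start = (s', g', \<beta>')" by (cases "run w start")
  have st: "x_step i (s', g', \<beta>') = (s, g, \<beta>)" using Cons.prems r by (simp add: run_def)
  show ?case
    using Cons.IH[OF r] x_step_invariants[OF st] by simp
qed

lemma sd_relation: "(u, v) \<in> sd_relations \<Longrightarrow> abs_sd16 u = abs_sd16 v"
  by (simp add: sd16.abs_eq_iff presented_eq.relation)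

text \<open>The relations oriented so that products are sorted into the order a, b, c, d; they serve
  to compute the degrees of the \<open>y j\<close>.\<close>

lemma sd_rels:
  "sd Ga * sd Ga = sd Gd" "sd Gb * sd Gb = 1" "sd Gc * sd Gc = sd Gd" "sd Gd * sd Gd = 1"
  "sd Gb * sd Ga = sd Ga * (sd Gb * sd Gc)" "sd Gc * sd Ga = sd Ga * (sd Gc * sd Gd)"
  "sd Gc * sd Gb = sd Gb * (sd Gc * sd Gd)"
  "sd Gd * sd Ga = sd Ga * sd Gd" "sd Gd * sd Gb = sd Gb * sd Gd" "sd Gd * sd Gc = sd Gc * sd Gd"
proof -
  note ab = sd.abs_eq times_sd16.abs_eq one_sd16.abs_eq append_Cons append_Nil
  have rel: "(u, v) \<in> sd_relations \<Longrightarrow> abs_sd16 v = abs_sd16 u" for u v by (simp add: sd_relation)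
  show "sd Ga * sd Ga = sd Gd" "sd Gb * sd Gb = 1" "sd Gc * sd Gc = sd Gd" "sd Gd * sd Gd = 1"
    unfolding ab by (rule sd_relation; simp add: sd_relations_def Let_def)+
  show "sd Gd * sd Ga = sd Ga * sd Gd" "sd Gd * sd Gb = sd Gb * sd Gd" "sd Gd * sd Gc = sd Gc * sd Gd"
    unfolding ab by (rule rel; simp add: sd_relations_def Let_def)+
  \<comment> \<open>\<open>sd16\<close> is declared as a monoid; inverses are the classes of the
    formal inverse letters, and conjugation relations are cleared by multiplying with them.\<close>
  have inv: "abs_sd16 [(g, True)] * (abs_sd16 [(g, False)] * z) = z" for g z
  proof -
    have "abs_sd16 [(g, True)] * abs_sd16 [(g, False)] = 1"
      unfolding ab sd16.abs_eq_iff using presented_eq.cancel[of sd_relations g True] by simp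
    then show ?thesis by (metis mult.assoc mult_1_left)
  qed
  have conj: "sd h * sd g = sd g * abs_sd16 v" if "([(g, False), (h, True), (g, True)], v) \<in> sd_relations" for g h v
  proof -
    have "abs_sd16 [(g, False)] * (sd h * sd g) = abs_sd16 v"
      unfolding ab using sd_relation[OF that] .
    then show ?thesis using inv[of g "sd h * sd g"] unfolding sd.abs_eq by simp
  qed
  have two: "sd g * sd h = abs_sd16 [(g, True), (h, True)]" for g h
    unfolding ab ..
  show "sd Gb * sd Ga = sd Ga * (sd Gb * sd Gc)" "sd Gc * sd Ga = sd Ga * (sd Gc * sd Gd)"
    "sd Gc * sd Gb = sd Gb * (sd Gc * sd Gd)"
    unfolding two[of Gb Gc] two[of Gc Gd] by (rule conj; simp add: sd_relations_def Let_def)+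
qed

section \<open>Words for the ordered monomials\<close>

definition y_pair :: "idx \<Rightarrow> idx list" where
  "y_pair j = (case j of I1 \<Rightarrow> [I1, I1] | I2 \<Rightarrow> [I2, I2] | I3 \<Rightarrow> [I3, I4] | I4 \<Rightarrow> [I4, I3])"

definition y_word :: "(idx \<Rightarrow> nat) \<Rightarrow> idx list" where
  "y_word \<beta> = concat (replicate (\<beta> I1) (y_pair I1)) @ concat (replicate (\<beta> I2) (y_pair I2)) @
     concat (replicate (\<beta> I3) (y_pair I3)) @ concat (replicate (\<beta> I4) (y_pair I4))"

lemma prod_list_concat_replicate: "prod_list (concat (replicate n xs)) = prod_list xs ^ n"
  by (induction n) simp_all

lemma y_pair_deg: "prod_list (map x_deg (y_pair j)) = 1"
  by (cases j) (simp_all add: y_pair_def mult.assoc sd_rels sd_rels[THEN mult_rewrite_tail])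

lemma y_word_deg: "prod_list (map x_deg (y_word \<beta>)) = 1"
  by (simp add: y_word_def map_concat prod_list_concat_replicate y_pair_deg)

lemma word_y_word: "word_T (y_word \<beta>) = (y_mon yT \<beta> :: 'k::field T)"
proof -
  have "prod_list (map xT (y_pair j)) = (yT j :: 'k T)" for j
    by (cases j) (simp_all add: y_pair_def yT_def)
  then show ?thesis
    by (simp add: word_T_def y_word_def y_mon_def map_concat prod_list_concat_replicate mult.assoc)
qed

lemma run_append: "run (u @ v) st = run u (run v st)"
  by (simp add: run_def)

lemma run_y_pair: "run (y_pair j) (s, P0, \<beta>) = (s \<noteq> y_lam j \<beta>, P0, inc j \<beta>)"
  by (cases j) (auto simp: run_def y_pair_def x_step_def)

text \<open>The hypothesis excludes signs from smaller variables. It holds in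
  \<open>run_y_word\<close> because words act from their right end, so the largest variable enters
  first.\<close>

lemma run_y_pairs:
  assumes "\<And>n. \<not> y_lam j (\<beta>(j := n))"
  shows "run (concat (replicate n (y_pair j))) (False, P0, \<beta>) = (False, P0, \<beta>(j := \<beta> j + n))"
proof (induction n)
  case 0
  show ?case by (simp add: run_def)
next
  case (Suc n)
  have "run (concat (replicate (Suc n) (y_pair j))) (False, P0, \<beta>)
      = run (y_pair j) (False, P0, \<beta>(j := \<beta> j + n))"
    unfolding replicate_Suc concat.simps run_append Suc.IH ..
  also have "\<dots> = (False, P0, \<beta>(j := \<beta> j + Suc n))"
    unfolding run_y_pair using assms[of "\<beta> j + n"] by (simp add: inc_def)
  finally show ?case .
qed

lemma run_y_word: "run (y_word \<beta>) start = (False, P0, \<beta>)"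
proof -
  have "(\<lambda>_ :: idx. 0 :: nat)(I4 := \<beta> I4, I3 := \<beta> I3, I2 := \<beta> I2, I1 := \<beta> I1) = \<beta>"
    by (rule ext, rename_tac j, case_tac j) simp_all
  then show ?thesis
    by (simp add: y_word_def run_append run_y_pairs)
qed

text \<open>The coordinates at \<open>P0\<close> are dual to the monomials; this is their linear
  independence.\<close>

lemma T_coef_y_mon: "T_coef (y_mon yT \<beta>) (P0, \<gamma>) = (if \<gamma> = \<beta> then 1 else 0)"
  by (auto simp flip: word_y_word simp: T_coef_word run_y_word state_coef_def)

lemma word_T_degree_one:
  assumes "prod_list (map x_deg w) = 1"
  obtains s \<beta> where "run w start = (s, P0, \<beta>)" "word_T w = (sg s (y_mon yT \<beta>) :: 'k::field T)"
proof -
  obtain s g \<beta> where r: "run w start = (s, g, \<beta>)" by (cases "run w start")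
  then have "g = P0" using run_invariants[OF r] assms by simp
  then show thesis using that r word_T_run[of w] by (simp add: state_T_def word_T_def)
qed

section \<open>The identity component\<close>

context vector_space
begin

lemma pm_lin_scale: "scale c (pm_lin scale F q) = pm_lin scale F (pm_scale c q)"
proof -
  have "pm_lin scale F (pm_scale c q) = (\<Sum>w\<in>keys q. scale (lookup (pm_scale c q) w) (F w))"
    by (rule pm_lin_superset) (auto simp: in_keys_iff)
  then show ?thesis by (simp add: pm_lin_def scale_sum_right)
qed

lemma subspace_range_pm_lin: "subspace (range (pm_lin scale F))"
proof (rule subspaceI)
  show "0 \<in> range (pm_lin scale F)" by (rule range_eqI[of _ _ 0]) simp
  show "x + z \<in> range (pm_lin scale F)" if "x \<in> range (pm_lin scale F)" "z \<in> range (pm_lin scale F)" for x z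
    using that by (auto simp flip: pm_lin_add)
  show "scale c x \<in> range (pm_lin scale F)" if "x \<in> range (pm_lin scale F)" for c x
    using that by (auto simp: pm_lin_scale)
qed

lemma pm_lin_subspace: "subspace S \<Longrightarrow> (\<And>w. w \<in> keys q \<Longrightarrow> F w \<in> S) \<Longrightarrow> pm_lin scale F q \<in> S"
  unfolding pm_lin_def by (intro subspace_sum subspace_scale)

end

text \<open>Common form of the group components and of the pieces by length, so that both get their
  subspace and product properties at once.\<close>

definition word_space :: "(idx list \<Rightarrow> bool) \<Rightarrow> 'k::field T set" where
  "word_space Q = abs_T ` {p. \<forall>w\<in>keys p. Q (letters w)}"

lemma T_component_word_space: "T_component g = word_space (\<lambda>w. prod_list (map x_deg w) = g)"
  by (simp add: T_component_def word_space_def)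

lemma T_piece_word_space: "T_piece n = word_space (\<lambda>w. length w = n)"
  by (simp add: T_piece_def word_space_def)

lemma word_space_word: "Q w \<Longrightarrow> word_T w \<in> word_space Q"
  unfolding word_space_def abs_T_free_word[symmetric] by (intro imageI) (simp add: free_word_def)

lemma word_space_subspace: "TV.subspace (word_space Q)"
proof (rule TV.subspaceI)
  show "0 \<in> word_space Q"
    unfolding word_space_def zero_T_def by (intro imageI) simp
  show "x + z \<in> word_space Q" if xz: "x \<in> word_space Q" "z \<in> word_space Q" for x z
  proof -
    obtain p q where p: "x = abs_T p" "\<forall>w\<in>keys p. Q (letters w)"
      and q: "z = abs_T q" "\<forall>w\<in>keys q. Q (letters w)"
      using xz by (auto simp: word_space_def)
    have "\<forall>w\<in>keys (p + q). Q (letters w)"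
      using p(2) q(2) Poly_Mapping.keys_add[of p q] by blast
    then show ?thesis unfolding word_space_def p(1) q(1) plus_T.abs_eq by blast
  qed
  show "scale_T c x \<in> word_space Q" if x: "x \<in> word_space Q" for c x
  proof -
    obtain p where p: "x = abs_T p" "\<forall>w\<in>keys p. Q (letters w)"
      using x by (auto simp: word_space_def)
    have "keys (free_const c * p) \<subseteq> keys p"
      using keys_mult[of "free_const c" p] by (auto simp: free_const_def split: if_splits)
    then show ?thesis unfolding word_space_def p(1) scale_T.abs_eq using p(2) by blast
  qed
qed

lemma word_space_mult:
  assumes "x \<in> word_space Q" "z \<in> word_space Q'" "\<And>u v. Q u \<Longrightarrow> Q' v \<Longrightarrow> Q'' (u @ v)"
  shows "x * z \<in> word_space Q''"
proof -
  obtain p q where p: "x = abs_T p" "\<forall>w\<in>keys p. Q (letters w)"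
    and q: "z = abs_T q" "\<forall>w\<in>keys q. Q' (letters w)"
    using assms(1,2) by (auto simp: word_space_def)
  have "\<forall>w\<in>keys (p * q). Q'' (letters w)"
    using p(2) q(2) keys_mult[of p q] assms(3) by fastforce
  then show ?thesis unfolding word_space_def p(1) q(1) times_T.abs_eq by blast
qed

lemma T_component_one_mult: "x \<in> T_component 1 \<Longrightarrow> z \<in> T_component 1 \<Longrightarrow> x * z \<in> T_component 1"
  unfolding T_component_word_space by (erule (1) word_space_mult) simp

lemma T_component_subspace: "TV.subspace (T_component g)"
  unfolding T_component_word_space by (rule word_space_subspace)

lemma y_mon_T_component: "y_mon yT \<beta> \<in> T_component 1"
  unfolding T_component_word_space word_y_word[symmetric]
  by (rule word_space_word) (rule y_word_deg)

lemma y_mon_T_piece: "y_mon yT \<beta> \<in> T_piece (2 * mdeg \<beta>)"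
  unfolding T_piece_word_space word_y_word[symmetric]
  using run_invariants[OF run_y_word] by (intro word_space_word) simp

lemma yT_T_component: "yT j \<in> T_component 1"
proof -
  have "word_T (y_pair j) = yT j" by (cases j) (simp_all add: word_T_def y_pair_def yT_def)
  then show ?thesis
    unfolding T_component_word_space using word_space_word[of _ "y_pair j"] y_pair_deg by metis
qed

lemma y_mon_zero [simp]: "y_mon Y 0 = 1"
  by (simp add: y_mon_def)

text \<open>A word of degree 1 is a signed monomial by \<open>word_T_degree_one\<close>; conversely
  the monomials are classes of words of degree 1.\<close>

lemma T_component_one_eq: "T_component 1 = range (pm_lin scale_T (y_mon (yT :: idx \<Rightarrow> 'k::field T)))"
proof
  let ?R = "range (pm_lin scale_T (y_mon (yT :: idx \<Rightarrow> 'k T)))"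
  show "?R \<subseteq> T_component 1"
    by (auto intro: TV.pm_lin_subspace T_component_subspace y_mon_T_component)
  show "T_component 1 \<subseteq> ?R"
  proof
    fix x :: "'k T" assume "x \<in> T_component 1"
    then obtain p where p: "x = abs_T p" "\<And>w. w \<in> keys p \<Longrightarrow> prod_list (map x_deg (letters w)) = 1"
      by (auto simp: T_component_def)
    show "x \<in> ?R"
      unfolding p(1) abs_T_eq
    proof (rule TV.pm_lin_subspace[OF TV.subspace_range_pm_lin])
      fix w assume "w \<in> keys p"
      then obtain s \<beta> where "word_T (letters w) = (sg s (y_mon yT \<beta>) :: 'k T)"
        using word_T_degree_one[OF p(2)] by metis
      also have "\<dots> = pm_lin scale_T (y_mon yT) (single \<beta> (sg s 1))"
        by (simp add: sg_def)
      finally show "word_T (letters w) \<in> ?R" by blast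
    qed
  qed
qed

lemma T_coef_y_lin: "T_coef (pm_lin scale_T (y_mon yT) q) (P0, \<beta>) = lookup q \<beta>"
proof -
  have "T_coef (pm_lin scale_T (y_mon yT) q) (P0, \<beta>)
      = (\<Sum>\<gamma>\<in>keys q. if \<beta> = \<gamma> then lookup q \<gamma> else 0)"
    unfolding pm_lin_def T_coef_sum T_coef_scale T_coef_y_mon by (intro sum.cong) auto
  then show ?thesis by (simp add: in_keys_iff)
qed

text \<open>One computation for both sides: \<open>T\<close> will be left or right multiplication by
  \<open>y j\<close>, and \<open>l\<close> the sign that it produces.\<close>

lemma T_coef_shift:
  assumes "\<And>\<gamma>. T (y_mon yT \<gamma>) = sg (l \<gamma>) (y_mon yT (inc j \<gamma>))"
    and "T (pm_lin scale_T (y_mon yT) q) = pm_lin scale_T (\<lambda>\<gamma>. T (y_mon yT \<gamma>)) q"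
  shows "T_coef (T (pm_lin scale_T (y_mon yT) q)) (P0, \<beta>)
    = (if \<beta> j = 0 then 0 else sg (l (dec j \<beta>)) (lookup q (dec j \<beta>)))"
proof -
  have eq: "\<beta> = inc j \<gamma> \<longleftrightarrow> \<beta> j \<noteq> 0 \<and> \<gamma> = dec j \<beta>" for \<gamma>
    using inc_dec[of \<beta> j] by auto
  have "T_coef (T (pm_lin scale_T (y_mon yT) q)) (P0, \<beta>)
      = T_coef (pm_lin scale_T (\<lambda>\<gamma>. sg (l \<gamma>) (y_mon yT (inc j \<gamma>))) q) (P0, \<beta>)"
    unfolding assms(2) assms(1) ..
  also have "\<dots> = (\<Sum>\<gamma>\<in>keys q. lookup q \<gamma> * sg (l \<gamma>) (if \<beta> = inc j \<gamma> then 1 else 0))"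
    unfolding pm_lin_def T_coef_sum T_coef_scale T_coef_sg T_coef_y_mon ..
  also have "\<dots> = (\<Sum>\<gamma>\<in>keys q. if \<gamma> = dec j \<beta>
      then (if \<beta> j = 0 then 0 else sg (l (dec j \<beta>)) (lookup q (dec j \<beta>))) else 0)"
    unfolding eq by (intro sum.cong) (auto simp: sg_def)
  finally show ?thesis by (simp add: in_keys_iff)
qed

lemma T_e_sel [simp]:
  "carr T_e = T_component 1" "mul T_e = (*)" "unit T_e = 1" "scl T_e = scale_T"
  "piece T_e n = T_component 1 \<inter> T_piece n"
  by (simp_all add: T_e_def T_alg_def)

lemma is_algebra_T_e: "is_algebra T_e"
proof -
  have "1 \<in> T_component 1" using y_mon_T_component[of 0] by simp
  then show ?thesis
    unfolding is_algebra_def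
    by (simp add: vector_space_T T_component_subspace T_component_one_mult scale_T_mult
        distrib_left distrib_right mult.assoc)
qed

lemma T_coef_degree:
  assumes "x \<in> T_piece n" "T_coef x (P0, \<beta>) \<noteq> 0"
  shows "2 * mdeg \<beta> = n"
proof -
  obtain p where p: "x = abs_T p" "\<And>w. w \<in> keys p \<Longrightarrow> length (letters w) = n"
    using assms(1) by (auto simp: T_piece_def)
  have "(\<Sum>w\<in>keys p. lookup p w * T_coef (word_T (letters w)) (P0, \<beta>)) \<noteq> 0"
    using assms(2) unfolding p(1) abs_T_eq pm_lin_def T_coef_sum T_coef_scale .
  then obtain w where w: "w \<in> keys p" "T_coef (word_T (letters w) :: 'a T) (P0, \<beta>) \<noteq> 0"
    by (metis (no_types, lifting) mult_zero_right sum.neutral)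
  obtain s g \<gamma> where r: "run (letters w) start = (s, g, \<gamma>)" by (cases "run (letters w) start")
  have "g = P0" "\<gamma> = \<beta>" using w(2) by (auto simp: T_coef_word r state_coef_def split: if_splits)
  then show ?thesis using run_invariants[OF r] p(2)[OF w(1)] by simp
qed

text \<open>Makes \<open>T_e\<close> an instance of the general theory. That coordinates identify it
  with the finitely supported functions is spanning and independence of the monomials in
  one.\<close>

lemma skew_coords_T_e: "skew_coords T_e yT y_eps y_lam y_rho (\<lambda>x \<beta>. T_coef x (P0, \<beta>))"
proof (intro skew_coords.intro algebra_carrier.intro skew_coords_axioms.intro is_algebra_T_e)
  let ?L = "pm_lin scale_T (y_mon (yT :: idx \<Rightarrow> 'a T))"
  fix x z :: "'a T" and \<beta> and c and i j and n
  have lin: "\<exists>q. x = ?L q" if "x \<in> carr T_e" for x using that by (auto simp: T_component_one_eq)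
  show "yT j \<in> carr T_e" by (simp add: yT_T_component)
  show "y_eps i j = y_eps j i" by (rule y_eps_sym)
  show "mul T_e (yT i) (yT j) = (sg (y_eps i j) (mul T_e (yT j) (yT i)) :: 'a T)"
    using yT_comm[of i j] by simp
  show "i \<noteq> j \<Longrightarrow> (y_lam i (inc j \<beta>) \<noteq> y_lam j \<beta>) = ((y_lam j (inc i \<beta>) \<noteq> y_lam i \<beta>) \<noteq> y_eps i j)"
    by (rule y_lam_comm)
  show "i \<noteq> j \<Longrightarrow> (y_rho i (inc j \<beta>) \<noteq> y_rho j \<beta>) = ((y_rho j (inc i \<beta>) \<noteq> y_rho i \<beta>) \<noteq> y_eps i j)"
    by (rule y_rho_comm)
  show "T_coef (x + z) (P0, \<beta>) = T_coef x (P0, \<beta>) + T_coef z (P0, \<beta>)" by (rule T_coef_add)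
  show "T_coef (scl T_e c x) (P0, \<beta>) = c * T_coef x (P0, \<beta>)" by (simp add: T_coef_scale)
  show "T_coef (unit T_e) (P0, \<beta>) = (if \<beta> = 0 then 1 else 0)"
    using T_coef_y_mon[of 0 \<beta>] by (simp only: T_e_sel y_mon_zero)
  show "finite {\<beta>. f \<beta> \<noteq> 0} \<Longrightarrow> \<exists>u\<in>carr T_e. (\<lambda>\<beta>. T_coef u (P0, \<beta>)) = (f :: _ \<Rightarrow> 'a)" for f
    unfolding T_e_sel T_component_one_eq
    by (intro bexI[of _ "?L (Abs_poly_mapping f)"]) (simp_all add: T_coef_y_lin Abs_poly_mapping_inverse)
  assume x: "x \<in> carr T_e"
  then obtain q where q: "x = ?L q" using lin by blast
  show "x = 0" if "\<And>\<beta>. T_coef x (P0, \<beta>) = 0"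
  proof -
    have "q = 0" using that by (intro poly_mapping_eqI) (simp add: q T_coef_y_lin)
    then show ?thesis by (simp add: q)
  qed
  show "finite {\<beta>. T_coef x (P0, \<beta>) \<noteq> 0}"
    using finite_keys[of q] by (simp add: q T_coef_y_lin keys.rep_eq)
  show "T_coef (mul T_e (yT j) x) (P0, \<beta>)
      = (if \<beta> j = 0 then 0 else sg (y_lam j (dec j \<beta>)) (T_coef x (P0, dec j \<beta>)))"
  proof -
    have "yT j * ?L q = pm_lin scale_T (\<lambda>\<gamma>. yT j * y_mon yT \<gamma>) q"
      by (simp add: pm_lin_def sum_distrib_left scale_T_mult)
    from T_coef_shift[where T = "\<lambda>u. yT j * u" and j = j, OF yT_y_mon(1) this]
    show ?thesis unfolding q T_e_sel T_coef_y_lin .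
  qed
  show "T_coef (mul T_e x (yT j)) (P0, \<beta>)
      = (if \<beta> j = 0 then 0 else sg (y_rho j (dec j \<beta>)) (T_coef x (P0, dec j \<beta>)))"
  proof -
    have "?L q * yT j = pm_lin scale_T (\<lambda>\<gamma>. y_mon yT \<gamma> * yT j) q"
      by (simp add: pm_lin_def sum_distrib_right scale_T_mult)
    from T_coef_shift[where T = "\<lambda>u. u * yT j" and j = j, OF yT_y_mon(2) this]
    show ?thesis unfolding q T_e_sel T_coef_y_lin .
  qed
next
  fix n
  show "piece (T_e :: ('a, 'a T) galg) n = {u \<in> carr T_e. \<forall>\<beta>. T_coef u (P0, \<beta>) \<noteq> 0 \<longrightarrow> 2 * mdeg \<beta> = n}"
  proof (intro equalityI subsetI)
    fix u :: "'a T" assume "u \<in> piece T_e n"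
    then show "u \<in> {u \<in> carr T_e. \<forall>\<beta>. T_coef u (P0, \<beta>) \<noteq> 0 \<longrightarrow> 2 * mdeg \<beta> = n}"
      using T_coef_degree by auto
  next
    fix u :: "'a T" assume u: "u \<in> {u \<in> carr T_e. \<forall>\<beta>. T_coef u (P0, \<beta>) \<noteq> 0 \<longrightarrow> 2 * mdeg \<beta> = n}"
    then obtain q where q: "u = pm_lin scale_T (y_mon yT) q" by (auto simp: T_component_one_eq)
    have "u \<in> T_piece n"
      unfolding q
    proof (rule TV.pm_lin_subspace)
      show "TV.subspace (T_piece n :: 'a T set)" unfolding T_piece_word_space by (rule word_space_subspace)
      fix \<beta> assume "\<beta> \<in> keys q"
      then have "2 * mdeg \<beta> = n" using u by (simp add: q T_coef_y_lin in_keys_iff)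
      then show "y_mon yT \<beta> \<in> T_piece n" using y_mon_T_piece[of \<beta>] by simp
    qed
    then show "u \<in> piece T_e n" using u by simp
  qed
qed

lemma T_component_one_hull: "T_component 1 = is_subalgebra T_alg hull range (yT :: idx \<Rightarrow> 'k::field T)"
proof
  have sub: "is_subalgebra T_alg (T_component 1 :: 'k T set)"
    unfolding is_subalgebra_def T_alg_def
    using T_component_subspace T_component_one_mult y_mon_T_component[of 0] by auto
  show "is_subalgebra T_alg hull range (yT :: idx \<Rightarrow> 'k T) \<subseteq> T_component 1"
    by (rule hull_minimal) (auto simp: yT_T_component sub)
  show "T_component 1 \<subseteq> is_subalgebra T_alg hull range (yT :: idx \<Rightarrow> 'k T)"
    unfolding hull_def
  proof (intro subsetI InterI)
    fix x S assume x: "x \<in> (T_component 1 :: 'k T set)" and S: "S \<in> {t. is_subalgebra T_alg t \<and> range (yT :: idx \<Rightarrow> 'k T) \<subseteq> t}"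
    then have S: "TV.subspace S" "1 \<in> S" "\<And>u v. u \<in> S \<Longrightarrow> v \<in> S \<Longrightarrow> u * v \<in> S" "\<And>j. yT j \<in> S"
      by (auto simp: is_subalgebra_def T_alg_def)
    have pow: "yT j ^ n \<in> S" for j n
      by (induction n) (simp_all add: S)
    obtain q where "x = pm_lin scale_T (y_mon yT) q" using x by (auto simp: T_component_one_eq)
    then show "x \<in> S"
      by (simp add: TV.pm_lin_subspace[OF S(1)] y_mon_def S(3) pow)
  qed
qed

lemma free_eval_T_e: "free_eval T_e Y p = pm_lin scale_T (\<lambda>w. prod_list (map Y (letters w))) p"
proof -
  have "alg_prod T_e xs = prod_list xs" for xs :: "'a T list"
    by (induction xs) (simp_all add: alg_prod_def)
  then show ?thesis by (simp add: free_eval_def pm_lin_def)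
qed

lemma free_eval_add: "free_eval T_e Y (p + q) = free_eval T_e Y p + free_eval T_e Y q"
  and free_eval_diff: "free_eval T_e Y (p - q) = free_eval T_e Y p - free_eval T_e Y q"
  and free_eval_zero [simp]: "free_eval T_e Y 0 = 0"
  by (simp_all add: free_eval_T_e TV.pm_lin_add TV.pm_lin_diff)

lemma free_eval_mult: "free_eval T_e Y (p * q) = free_eval T_e Y p * free_eval T_e Y q"
  unfolding free_eval_T_e TV.pm_lin_mult
  by (simp add: pm_lin_def sum_distrib_left sum_distrib_right scale_T_mult)

lemma free_eval_var: "free_eval T_e Y (free_var i) = Y i"
  by (simp add: free_eval_T_e free_var_def)

lemma free_eval_const: "free_eval T_e Y (free_const c) = scale_T c 1"
  by (simp add: free_eval_T_e free_const_def)

lemma free_eval_one [simp]: "free_eval T_e Y 1 = 1"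
  using free_eval_const[of Y 1] by (simp add: free_const_one)

lemma free_eval_y_mon: "free_eval T_e Y (y_mon free_var \<beta>) = y_mon Y \<beta>"
proof -
  have "free_eval T_e Y (free_var i ^ n) = Y i ^ n" for i n
    by (induction n) (simp_all add: free_eval_mult free_eval_var)
  then show ?thesis by (simp add: y_mon_def free_eval_mult)
qed

section \<open>The presentation by skew relators\<close>

definition free_y_lin :: "((idx \<Rightarrow> nat) \<Rightarrow>\<^sub>0 'k::field) \<Rightarrow> (idx fword \<Rightarrow>\<^sub>0 'k)" where
  "free_y_lin = pm_lin (\<lambda>c p. free_const c * p) (y_mon free_var)"

interpretation FV: vector_space "\<lambda>c p. free_const c * (p :: 'x fword \<Rightarrow>\<^sub>0 'k::field)"
  by (rule vector_space_free)

lemma free_eval_sum: "free_eval T_e Y (sum f S) = (\<Sum>i\<in>S. free_eval T_e Y (f i))"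
  by (induction S rule: infinite_finite_induct) (simp_all add: free_eval_add)

lemma free_eval_y_lin: "free_eval T_e Y (free_y_lin q) = pm_lin scale_T (y_mon Y) q"
  by (simp add: free_y_lin_def pm_lin_def free_eval_sum free_eval_mult free_eval_const free_eval_y_mon scale_T_mult)

definition y_coeff :: "idx \<Rightarrow> idx \<Rightarrow> 'k::field" where
  "y_coeff i j = (if y_eps i j then - 1 else 1)"

lemma free_const_y_coeff: "free_const (y_coeff i j) * p = sg (y_eps i j) p"
  by (simp add: y_coeff_def sg_def free_const_one flip: free_const_one)

text \<open>The relators cover one order of each pair; the other follows because a sign is its own
  inverse.\<close>

lemma free_var_comm:
  fixes J :: "(idx fword \<Rightarrow>\<^sub>0 'k::field) set"
  defines "J \<equiv> two_sided_ideal hull skew_relators y_coeff"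
  shows "cong_mod J (free_var i * free_var j) (sg (y_eps i j) (free_var j * free_var i))"
proof -
  interpret two_sided J unfolding J_def by unfold_locales (rule two_sided_ideal_hull)
  have less: "cong_mod J (free_var j * free_var i) (sg (y_eps i j) (free_var i * free_var j))" if "i < j" for i j
  proof -
    have "free_var j * free_var i - free_const (y_coeff i j) * free_var i * free_var j \<in> skew_relators (y_coeff :: _ \<Rightarrow> _ \<Rightarrow> 'k)"
      using that by (auto simp: skew_relators_def)
    then have "free_var j * free_var i - free_const (y_coeff i j) * free_var i * free_var j \<in> J"
      unfolding J_def by (rule hull_inc)
    then show ?thesis by (simp add: cong_mod_def mult.assoc free_const_y_coeff sg_mult_left)
  qed
  consider "i < j" | "j < i" | "i = j" by (meson not_less_iff_gr_or_eq)
  then show ?thesis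
  proof cases
    case 1
    show ?thesis using passes_sym[of "free_var j" "y_eps i j" "free_var i"] less[OF 1] by (simp add: passes_def)
  next
    case 2
    then show ?thesis using less[OF 2] by (simp add: y_eps_sym)
  next
    case 3
    moreover have "\<not> y_eps j j" by (cases j) (simp_all add: y_eps_def)
    ultimately show ?thesis by simp
  qed
qed

text \<open>Words are sorted letter by letter with \<open>cong_y_mon\<close>, now modulo the skew
  relators.\<close>

lemma free_normal_form:
  fixes p :: "idx fword \<Rightarrow>\<^sub>0 'k::field"
  shows "\<exists>q. cong_mod (two_sided_ideal hull skew_relators y_coeff) p (free_y_lin q)"
proof -
  let ?J = "two_sided_ideal hull skew_relators (y_coeff :: _ \<Rightarrow> _ \<Rightarrow> 'k)"
  interpret two_sided ?J by unfold_locales (rule two_sided_ideal_hull)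
  have word: "\<exists>s \<beta>. cong_mod ?J (free_word w) (sg s (y_mon free_var \<beta>))" for w
  proof (induction w)
    case Nil
    have "cong_mod ?J (free_word []) (sg False (y_mon free_var 0))" by simp
    then show ?case by blast
  next
    case (Cons i w)
    then obtain s \<beta> where "cong_mod ?J (free_word w) (sg s (y_mon free_var \<beta>))" by blast
    then have "cong_mod ?J (free_word (i # w)) (sg s (free_var i * y_mon free_var \<beta>))"
      unfolding free_word_Cons using cong_mult_left sg_mult_right by metis
    moreover have "cong_mod ?J (sg s (free_var i * y_mon free_var \<beta>)) (sg s (sg (y_lam i \<beta>) (y_mon free_var (inc i \<beta>))))"
      by (rule cong_sg[OF cong_y_mon(1)[OF free_var_comm]])
    ultimately show ?case using cong_trans sg_simps(3) by metis
  qed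
  show ?thesis
  proof (induction p rule: pm_induct_add)
    case zero
    have "cong_mod ?J 0 (free_y_lin 0)" by (simp add: free_y_lin_def)
    then show ?case by blast
  next
    case (add w c p)
    then obtain q where q: "cong_mod ?J p (free_y_lin q)" by blast
    obtain s \<beta> where "cong_mod ?J (free_word (letters w)) (sg s (y_mon free_var \<beta>))" using word by blast
    from cong_mult_left[OF this, of "free_const c"]
    have "cong_mod ?J (single w c) (free_const c * sg s (y_mon free_var \<beta>))"
      by (simp add: free_const_def free_word_def mult_single)
    also have "free_const c * sg s (y_mon free_var \<beta>) = free_y_lin (single \<beta> (sg s c))"
    proof -
      have "free_const (- c) = (- free_const c :: idx fword \<Rightarrow>\<^sub>0 'k)" by (simp add: free_const_def single_uminus)
      then show ?thesis by (simp add: free_y_lin_def sg_def)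
    qed
    finally have "cong_mod ?J (single w c + p) (free_y_lin (single \<beta> (sg s c)) + free_y_lin q)"
      using q by (rule cong_add)
    also have "free_y_lin (single \<beta> (sg s c)) + free_y_lin q = free_y_lin (single \<beta> (sg s c) + q)"
      by (simp add: free_y_lin_def FV.pm_lin_add)
    finally show ?case by blast
  qed
qed

text \<open>For the kernel, replace \<open>p\<close> modulo the relators by a combination of ordered
  monomials. Its image is the same combination of monomials in \<open>T_e\<close>, which are
  independent, so all coefficients vanish and \<open>p\<close> lies in the ideal.\<close>

lemma skew_polynomial_T_e: "is_skew_polynomial_ring T_e (yT :: idx \<Rightarrow> 'k::field T)"
  unfolding is_skew_polynomial_ring_def
proof (intro conjI exI)
  let ?J = "two_sided_ideal hull skew_relators (y_coeff :: _ \<Rightarrow> _ \<Rightarrow> 'k)"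
  let ?e = "free_eval T_e (yT :: idx \<Rightarrow> 'k T)"
  show "is_algebra (T_e :: ('k, 'k T) galg)" by (rule is_algebra_T_e)
  show "range yT \<subseteq> carr (T_e :: ('k, 'k T) galg)" by (auto simp: yT_T_component)
  show "\<forall>i j. i < j \<longrightarrow> (y_coeff i j :: 'k) \<noteq> 0" by (simp add: y_coeff_def)
  show "range ?e = carr T_e"
  proof
    have pw: "prod_list (map yT w) \<in> (T_component 1 :: 'k T set)" for w
    proof (induction w)
      case Nil
      show ?case using y_mon_T_component[of 0] by simp
    qed (simp add: T_component_one_mult yT_T_component)
    then show "range ?e \<subseteq> carr T_e"
      by (auto simp: free_eval_T_e intro: TV.pm_lin_subspace T_component_subspace)
    show "carr T_e \<subseteq> range ?e"
      by (auto simp: T_component_one_eq simp flip: free_eval_y_lin)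
  qed
  have J: "?J \<subseteq> {p. ?e p = 0}"
  proof (rule hull_minimal)
    have "free_eval T_e yT (free_const (y_coeff i j) * free_var i * free_var j) = yT j * (yT i :: 'k T)" for i j
    proof -
      have "free_eval T_e yT (sg b p) = (sg b (free_eval T_e yT p) :: 'k T)" for b p
        using free_eval_diff[of yT 0 p] by (simp add: sg_def)
      then show ?thesis
        by (simp only: free_const_y_coeff free_eval_mult free_eval_var yT_comm[of j i] y_eps_sym[of j i] sg_mult_left)
    qed
    then show "skew_relators (y_coeff :: _ \<Rightarrow> _ \<Rightarrow> 'k) \<subseteq> {p. ?e p = 0}"
      by (auto simp: skew_relators_def free_eval_diff) (simp add: free_eval_mult free_eval_var)
    show "two_sided_ideal {p. ?e p = 0}"
      by (simp add: two_sided_ideal_def free_eval_add free_eval_mult)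
  qed
  show "{p. ?e p = 0} = ?J"
  proof (intro equalityI J subsetI)
    fix p assume p: "p \<in> {p. ?e p = 0}"
    obtain q where q: "p - free_y_lin q \<in> ?J" using free_normal_form[of p] by (auto simp: cong_mod_def)
    then have "?e (p - free_y_lin q) = 0" using J by blast
    then have "pm_lin scale_T (y_mon yT) q = (0 :: 'k T)" using p by (simp add: free_eval_diff free_eval_y_lin)
    then have "lookup q \<beta> = 0" for \<beta> using T_coef_y_lin[of q \<beta>] by simp
    then have "q = 0" by (intro poly_mapping_eqI) simp
    then show "p \<in> ?J" using q by (simp add: free_y_lin_def)
  qed
qed

theorem proposition3p2p11:
  fixes U :: "'m::ab_group_add itself"
    and y1 y2 y3 y4 :: "'k::{alg_closed_field, field_char_0} T"
  assumes "y1 = xT I1 * xT I1" and "y2 = xT I2 * xT I2"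
    and "y3 = xT I3 * xT I4" and "y4 = xT I4 * xT I3"
  shows "T_component 1 = is_subalgebra T_alg hull {y1, y2, y3, y4}
    \<and> y1 * y2 = - (y2 * y1) \<and> y1 * y3 = - (y3 * y1)
    \<and> y2 * y4 = - (y4 * y2) \<and> y3 * y4 = - (y4 * y3)
    \<and> y1 * y4 = y4 * y1 \<and> y2 * y3 = y3 * y2
    \<and> is_skew_polynomial_ring T_e (\<lambda>i. case i of I1 \<Rightarrow> y1 | I2 \<Rightarrow> y2 | I3 \<Rightarrow> y3 | I4 \<Rightarrow> y4)
    \<and> AS_regular U (T_e :: ('k, 'k T) galg)"
proof -
  have y: "y1 = yT I1" "y2 = yT I2" "y3 = yT I3" "y4 = yT I4"
    by (simp_all add: assms yT_def)
  have fam: "(\<lambda>i. case i of I1 \<Rightarrow> y1 | I2 \<Rightarrow> y2 | I3 \<Rightarrow> y3 | I4 \<Rightarrow> y4) = yT"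
    unfolding y by (rule ext, rename_tac i, case_tac i) simp_all
  have "range yT = {y1, y2, y3, y4}" unfolding y UNIV_idx by simp
  then have hull: "T_component 1 = is_subalgebra T_alg hull {y1, y2, y3, y4}"
    using T_component_one_hull by metis
  have "y1 * y2 = - (y2 * y1)" "y1 * y3 = - (y3 * y1)" "y2 * y4 = - (y4 * y2)" "y3 * y4 = - (y4 * y3)"
    "y1 * y4 = y4 * y1" "y2 * y3 = y3 * y2"
    unfolding y by (rule yT_comm[THEN HOL.trans], simp add: y_eps_def sg_def)+
  then show ?thesis
    using hull skew_polynomial_T_e skew_coords.AS_regular[OF skew_coords_T_e] unfolding fam by blast
qed

end
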